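(* Let $d\ge2$. Let $\nu_1$ and $\nu_2$ be two finite measures on $]0,+\infty[$ with positive masses. Then, for all $0<\alpha<1$ and all $\rho>1$, $$\widehat{\lambda}_c(\alpha\nu_1+(1-\alpha)H^{\rho}\nu_2)\le\min\big(\widehat{\lambda}_c(\alpha\nu_1),\widehat{\lambda}_c((1-\alpha)H^{\rho}\nu_2)\big)=\min\left(\frac{\widehat{\lambda}_c(\nu_1)}{\alpha},\frac{\widehat{\lambda}_c(\nu_2)}{1-\alpha}\right).$$ Moreover, for all $0<\alpha<1$, $$\widehat{\lambda}_c(\alpha\nu_1+(1-\alpha)H^{\rho}\nu_2)\to\min\left(\frac{\widehat{\lambda}_c(\nu_1)}{\alpha},\frac{\widehat{\lambda}_c(\nu_2)}{1-\alpha}\right)\text{ as }\rho\to\infty,$$ and this convergence is uniform in $\alpha\in]0,1[$.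
   Context: Boolean model: for a finite measure $\nu$ on $]0,+\infty[$, let $\xi$ be a Poisson point process on $\mathbb{R}^d\times]0,+\infty[$ with intensity the product of Lebesgue measure on $\mathbb{R}^d$ by $\nu$; the Boolean model driven by $\nu$ is the random set $\Sigma(\nu)=\bigcup_{(c,r)\in\xi}B(c,r)$, where $B(c,r)$ is the open Euclidean ball of radius $r$ centered at $c$. $S(r)=\{x\in\mathbb{R}^d:\|x\|_2=r\}$. For $A,B\subset\mathbb{R}^d$ and a random set $\Sigma$, $A\leftrightarrow_{\Sigma}B$ denotes the event that there exists a continuous path contained in $\Sigma$ from a point of $A$ to a point of $B$. Critical parameter: $\widehat{\lambda}_c(\nu)=\sup\{\lambda>0: P(S(r/2)\leftrightarrow_{\Sigma(\lambda\nu)}S(r))\to0 \text{ as } r\to\infty\}$ (equal to $0$ if the set is empty). Scaling: for $\rho>1$, $H^{\rho}\nu$ is the measure on $]0,+\infty[$ defined by $H^{\rho}\nu(A)=\rho^d\nu(\rho A)$; thus $\rho^{-1}\Sigma(\nu)$ is a Boolean model driven by $H^{\rho}\nu$. *)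

theory Defs
  imports "HOL-Probability.Probability"
begin

section \<open>Measures on the open half-line\<close>

definition radius_measure :: "real measure \<Rightarrow> bool" where
  "radius_measure \<nu> \<longleftrightarrow> sets \<nu> = sets (restrict_space borel {0<..}) \<and> finite_measure \<nu>"

text \<open>The sum is only meaningful for measures on the same \<open>\<sigma>\<close>-algebra.\<close>

definition add_measure :: "'a measure \<Rightarrow> 'a measure \<Rightarrow> 'a measure" where
  "add_measure \<mu> \<nu> = measure_of (space \<mu>) (sets \<mu>) (\<lambda>A. emeasure \<mu> A + emeasure \<nu> A)"

lemma sets_add_measure [simp]: "sets (add_measure \<mu> \<nu>) = sets \<mu>"
  by (simp add: add_measure_def)

lemma emeasure_add_measure:
  assumes "sets \<mu> = sets \<nu>" "A \<in> sets \<mu>"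
  shows "emeasure (add_measure \<mu> \<nu>) A = emeasure \<mu> A + emeasure \<nu> A"
proof (rule emeasure_measure_of[OF add_measure_def])
  show "sets \<mu> \<subseteq> Pow (space \<mu>)"
    by (rule sets.space_closed)
  show "A \<in> sets (add_measure \<mu> \<nu>)"
    using assms by simp
  show "positive (sets (add_measure \<mu> \<nu>)) (\<lambda>A. emeasure \<mu> A + emeasure \<nu> A)"
    by (simp add: positive_def)
  show "countably_additive (sets (add_measure \<mu> \<nu>)) (\<lambda>A. emeasure \<mu> A + emeasure \<nu> A)"
    unfolding countably_additive_def sets_add_measure
  proof (intro allI impI)
    fix F :: "nat \<Rightarrow> 'a set"
    assume F: "range F \<subseteq> sets \<mu>" "disjoint_family F"
    have "(\<Sum>i. emeasure \<mu> (F i) + emeasure \<nu> (F i)) = (\<Sum>i. emeasure \<mu> (F i)) + (\<Sum>i. emeasure \<nu> (F i))"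
      by (intro suminf_add[symmetric]) auto
    also have "\<dots> = emeasure \<mu> (\<Union>i. F i) + emeasure \<nu> (\<Union>i. F i)"
      using F assms(1) by (simp add: suminf_emeasure)
    finally show "(\<Sum>i. emeasure \<mu> (F i) + emeasure \<nu> (F i)) = emeasure \<mu> (\<Union>i. F i) + emeasure \<nu> (\<Union>i. F i)" .
  qed
qed

text \<open>The measure \<open>H\<^sup>\<rho> \<nu>\<close> in dimension \<open>d\<close>, written as a multiple of the image of \<open>\<nu>\<close> under division by
  \<open>\<rho>\<close>; \<open>emeasure_contract\<close> below is the formula \<open>H\<^sup>\<rho> \<nu>(A) = \<rho>\<^sup>d \<nu>(\<rho> A)\<close>.\<close>

definition contract :: "nat \<Rightarrow> real \<Rightarrow> real measure \<Rightarrow> real measure" where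
  "contract d \<rho> \<nu> = scale_measure (ennreal (\<rho> ^ d)) (distr \<nu> \<nu> (\<lambda>r. r / \<rho>))"

lemma sets_contract [simp]: "sets (contract d \<rho> \<nu>) = sets \<nu>"
  by (simp add: contract_def)

lemma emeasure_contract:
  assumes "radius_measure \<nu>" "\<rho> > 0" "A \<in> sets \<nu>"
  shows "emeasure (contract d \<rho> \<nu>) A = ennreal (\<rho> ^ d) * emeasure \<nu> ((*) \<rho> ` A)"
proof -
  have sets: "sets \<nu> = sets (restrict_space borel {0<..})"
    using assms(1) by (simp add: radius_measure_def)
  have space: "space \<nu> = {0<..}"
    using sets_eq_imp_space_eq[OF sets] by (simp add: space_restrict_space)
  have "(\<lambda>r. r / \<rho>) \<in> restrict_space borel {0<..} \<rightarrow>\<^sub>M restrict_space borel {0<..}"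
    using assms(2) by (intro measurable_restrict_space3) auto
  then have meas: "(\<lambda>r. r / \<rho>) \<in> \<nu> \<rightarrow>\<^sub>M \<nu>"
    using measurable_cong_sets[OF sets sets] by simp
  have "A \<subseteq> {0<..}"
    using sets.sets_into_space[OF assms(3)] space by simp
  then have "(\<lambda>r. r / \<rho>) -` A \<inter> space \<nu> = (*) \<rho> ` A"
    using assms(2) unfolding space
    by (auto simp: image_iff zero_less_mult_iff zero_less_divide_iff intro!: bexI[of _ "_ / \<rho>"])
  then show ?thesis
    using meas assms(3) by (simp add: contract_def emeasure_distr)
qed

section \<open>Poisson point processes and the Boolean model\<close>

text \<open>A point process is a random set of points, and \<open>point_count\<close> is its counting measure with values
  in \<open>[0, \<infinity>]\<close>. Representing configurations by sets restricts the definition to simple processes;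
  this loses nothing here, since the intensities below have no atoms.\<close>

definition point_count :: "('w \<Rightarrow> 'x set) \<Rightarrow> 'x set \<Rightarrow> 'w \<Rightarrow> ennreal" where
  "point_count \<xi> A \<omega> = emeasure (count_space UNIV) (\<xi> \<omega> \<inter> A)"

definition poisson_point_process :: "'w measure \<Rightarrow> 'x measure \<Rightarrow> ('w \<Rightarrow> 'x set) \<Rightarrow> bool" where
  "poisson_point_process M \<mu> \<xi> \<longleftrightarrow>
     prob_space M \<and>
     (\<forall>\<omega>\<in>space M. \<xi> \<omega> \<subseteq> space \<mu>) \<and>
     (\<forall>A\<in>sets \<mu>. point_count \<xi> A \<in> borel_measurable M) \<and>
     (\<forall>A\<in>sets \<mu>. emeasure \<mu> A < \<infinity> \<longrightarrow>
        (\<forall>n. \<P>(\<omega> in M. point_count \<xi> A \<omega> = of_nat n)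
             = measure \<mu> A ^ n / fact n * exp (- measure \<mu> A))) \<and>
     (\<forall>A\<in>sets \<mu>. emeasure \<mu> A = \<infinity> \<longrightarrow> (AE \<omega> in M. point_count \<xi> A \<omega> = \<infinity>)) \<and>
     (\<forall>n. \<forall>A :: nat \<Rightarrow> 'x set. A ` {..<n} \<subseteq> sets \<mu> \<longrightarrow> disjoint_family_on A {..<n} \<longrightarrow>
        prob_space.indep_vars M (\<lambda>_. borel) (\<lambda>i. point_count \<xi> (A i)) {..<n})"

definition boolean_intensity :: "real measure \<Rightarrow> ((real ^ 'd) \<times> real) measure" where
  "boolean_intensity \<nu> = lborel \<Otimes>\<^sub>M \<nu>"

definition covered_region :: "((real ^ 'd) \<times> real) set \<Rightarrow> (real ^ 'd) set" where
  "covered_region C = (\<Union>(c, r)\<in>C. ball c r)"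

definition joined_in :: "'a::topological_space set \<Rightarrow> 'a set \<Rightarrow> 'a set \<Rightarrow> bool" where
  "joined_in S A B \<longleftrightarrow>
     (\<exists>g. path g \<and> path_image g \<subseteq> S \<and> pathstart g \<in> A \<and> pathfinish g \<in> B)"

text \<open>The event below is measurable: as balls are open, it says that some finite chain of successively
  intersecting balls links the two spheres, and the admissible centre-radius tuples of such a chain
  form an open set. Its probability depends only on the law of the Poisson process, hence only on
  the intensity.\<close>

definition crossing_prob :: "'w measure \<Rightarrow> ('w \<Rightarrow> ((real ^ 'd) \<times> real) set) \<Rightarrow> real \<Rightarrow> real" where
  "crossing_prob M \<xi> r =
     \<P>(\<omega> in M. joined_in (covered_region (\<xi> \<omega>)) (sphere 0 (r / 2)) (sphere 0 r))"

text \<open>Sample spaces are taken on the type of configurations: there every Poisson process is realised,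
  through its law, by the identity map. All realisations have the same crossing probabilities, so the
  existential quantifier merely selects a Boolean model driven by \<open>\<nu>\<close>. The supremum is taken in
  \<open>[0, \<infinity>]\<close>, where the supremum of the empty set is \<open>0\<close>.\<close>

definition subcritical :: "'d::finite itself \<Rightarrow> real measure \<Rightarrow> bool" where
  "subcritical (_ :: 'd itself) \<nu> \<longleftrightarrow>
     (\<exists>(M :: ((real ^ 'd) \<times> real) set measure) \<xi> :: _ \<Rightarrow> ((real ^ 'd) \<times> real) set.
        poisson_point_process M (boolean_intensity \<nu>) \<xi> \<and> (crossing_prob M \<xi> \<longlongrightarrow> 0) at_top)"

definition critical_parameter :: "'d::finite itself \<Rightarrow> real measure \<Rightarrow> ennreal" where
  "critical_parameter d \<nu> =
     Sup (ennreal ` {t. 0 < t \<and> subcritical d (scale_measure (ennreal t) \<nu>)})"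

text \<open>The measure \<open>\<alpha> \<nu>\<^sub>1 + (1 - \<alpha>) H\<^sup>\<rho> \<nu>\<^sub>2\<close>.\<close>

definition two_scale_mixture :: "nat \<Rightarrow> real \<Rightarrow> real measure \<Rightarrow> real \<Rightarrow> real measure \<Rightarrow> real measure" where
  "two_scale_mixture d \<alpha> \<nu>1 \<rho> \<nu>2 =
     add_measure (scale_measure (ennreal \<alpha>) \<nu>1) (scale_measure (ennreal (1 - \<alpha>)) (contract d \<rho> \<nu>2))"

end

theory Submission
  imports Defs
begin

text \<open>Only the last limit is hard: if \<open>a < \<lambda>\<^sub>c(\<nu>1)\<close> and \<open>b < \<lambda>\<^sub>c(\<nu>2)\<close>, then \<open>a \<nu>1 + b H\<^sup>\<rho> \<nu>2\<close> must be subcritical for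
  large \<open>\<rho>\<close>. By one step of renormalisation, a Boolean model is subcritical as soon as, at a single scale \<open>R\<close>,
  both its crossing probability and the tail of its \<open>d\<close>-th moment beyond \<open>R\<close> are below a constant depending
  only on \<open>d\<close>. Fix \<open>R\<close> for which a slightly denser version of \<open>a \<nu>1\<close> satisfies this. As \<open>\<rho>\<close> grows, the clusters of
  \<open>b H\<^sup>\<rho> \<nu>2\<close> inside the ball of radius \<open>R\<close> become microscopic, and their effect on crossings is dominated by
  multiplying the radii of \<open>a \<nu>1\<close> by some \<open>\<kappa> > 1\<close>, that is, by replacing \<open>a\<close> with \<open>a \<kappa>\<^sup>d\<close>. For uniformity in \<open>\<alpha>\<close>, note that
  for \<open>t \<le> \<theta> min (\<lambda>\<^sub>c(\<nu>1) / \<alpha>, \<lambda>\<^sub>c(\<nu>2) / (1 - \<alpha>))\<close> the mixture multiplied by \<open>t\<close> is dominated by \<open>a \<nu>1 + b H\<^sup>\<rho> \<nu>2\<close> with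
  \<open>a = \<theta> \<lambda>\<^sub>c(\<nu>1)\<close> and \<open>b = \<theta> \<lambda>\<^sub>c(\<nu>2)\<close>, whatever \<open>\<alpha>\<close>. Finiteness of \<open>\<lambda>\<^sub>c\<close> comes from planar crossings of a slice.

  A Poisson process is handled through its law on sets of points, which is determined by the void
  probabilities; superposition, mapping and restriction of processes then reduce to one-line computations.\<close>

section \<open>Laws of Poisson configurations\<close>

text \<open>The obstacle is that enlarged radii cannot make up for H^\<rho> \<nu>2 in the whole
  space: however large \<rho> is, clusters of macroscopic size occur somewhere, and somewhere the
  balls of \<nu>1 may be too small for a factor \<kappa> to bridge a gap. Both defects are rare in a
  bounded window, so the comparison concerns one crossing at one scale R, and a criterion that reads
  a single scale does the rest. This dictates the order of choices: \<kappa> from the gap between a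
  and the critical value, then R, then a lower cut-off on the radii, and \<rho> last. The moment
  half of the criterion comes for free: subcriticality forces a finite d-th moment, and the factor
  \<rho>^d in H^\<rho> makes its moment tail beyond R equal to that of \<nu>2 beyond \<rho> R.
  Multiplying radii by \<kappa> costs a factor \<kappa>^d in the intensity because a homothety of
  ratio 1 / \<kappa> restores the radii and makes the centres \<kappa>^d times denser.\<close>

definition config_algebra :: "'x::topological_space set measure" where
  "config_algebra = sigma UNIV {{C. C \<inter> A = {}} | A. A \<in> sets borel}"

text \<open>\<open>void_prob m\<close> is \<open>exp (- m)\<close> with the convention \<open>exp (- \<infinity>) = 0\<close>, which \<open>enn2real \<infinity> = 0\<close> would violate.\<close>

definition void_prob :: "ennreal \<Rightarrow> real" where
  "void_prob x = (if x = \<infinity> then 0 else exp (- enn2real x))"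

definition poisson_law :: "'x::topological_space measure \<Rightarrow> 'x set measure \<Rightarrow> bool" where
  "poisson_law \<mu> P \<longleftrightarrow> prob_space P \<and> sets P = sets config_algebra \<and>
     (\<forall>A\<in>sets borel. measure P {C. C \<inter> A = {}} = void_prob (emeasure \<mu> A))"

section \<open>Measurability of configurations and continuity of void probabilities\<close>

lemma space_config_algebra [simp]: "space config_algebra = UNIV"
  by (simp add: config_algebra_def)

lemma sets_config_algebra:
  "sets config_algebra = sigma_sets UNIV {{C. C \<inter> A = {}} | A. A \<in> sets borel}"
  by (simp add: config_algebra_def)

lemma void_event_measurable [measurable (raw)]:
  "A \<in> sets borel \<Longrightarrow> {C. C \<inter> A = {}} \<in> sets config_algebra"
  by (auto simp: sets_config_algebra)

lemma hit_event_measurable: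
  assumes "A \<in> sets borel"
  shows "{C. C \<inter> A \<noteq> {}} \<in> sets config_algebra"
proof -
  have "{C. C \<inter> A \<noteq> {}} = space config_algebra - {C. C \<inter> A = {}}"
    by auto
  then show ?thesis
    using void_event_measurable[OF assms] by (metis sets.compl_sets)
qed

lemma measurable_config_algebraI:
  fixes f :: "'w \<Rightarrow> 'x::topological_space set"
  assumes "\<And>A. A \<in> sets borel \<Longrightarrow> {\<omega>\<in>space M. f \<omega> \<inter> A = {}} \<in> sets M"
  shows "f \<in> M \<rightarrow>\<^sub>M config_algebra"
  unfolding config_algebra_def
proof (rule measurable_measure_of)
  fix y assume "y \<in> {{C. C \<inter> A = {}} | A. A \<in> sets (borel :: 'x measure)}"
  then obtain A where "A \<in> sets borel" "y = {C. C \<inter> A = {}}"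
    by auto
  moreover have "f -` {C. C \<inter> A = {}} \<inter> space M = {\<omega>\<in>space M. f \<omega> \<inter> A = {}}"
    by auto
  ultimately show "f -` y \<inter> space M \<in> sets M"
    using assms by simp
qed auto

lemma Int_stable_void_events: "Int_stable {{C. C \<inter> A = {}} | A. A \<in> sets borel}"
proof (rule Int_stableI)
  fix a b assume "a \<in> {{C. C \<inter> A = {}} |A. A \<in> sets (borel :: 'a measure)}"
    "b \<in> {{C. C \<inter> A = {}} |A. A \<in> sets (borel :: 'a measure)}"
  then obtain A B where "a = {C. C \<inter> A = {}}" "b = {C. C \<inter> B = {}}" "A \<in> sets borel" "B \<in> sets borel"
    by auto
  then have "a \<inter> b = {C. C \<inter> (A \<union> B) = {}}" "A \<union> B \<in> sets borel"
    by auto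
  then show "a \<inter> b \<in> {{C. C \<inter> A = {}} |A. A \<in> sets borel}"
    by auto
qed

lemma void_prob_nonneg [simp]: "0 \<le> void_prob x"
  by (simp add: void_prob_def)

lemma void_prob_0 [simp]: "void_prob 0 = 1"
  by (simp add: void_prob_def)

lemma void_prob_ennreal [simp]: "0 \<le> x \<Longrightarrow> void_prob (ennreal x) = exp (- x)"
  by (simp add: void_prob_def)

lemma void_prob_top [simp]: "void_prob \<top> = 0"
  by (simp add: void_prob_def)

lemma void_prob_add: "void_prob (x + y) = void_prob x * void_prob y"
proof (cases "x = \<infinity> \<or> y = \<infinity>")
  case True
  then show ?thesis
    by (auto simp: void_prob_def)
next
  case False
  then obtain a b where "x = ennreal a" "0 \<le> a" "y = ennreal b" "0 \<le> b"
    by (metis ennreal_cases infinity_ennreal_def)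
  then show ?thesis
    by (simp add: exp_add[symmetric] flip: ennreal_plus)
qed

lemma void_prob_sum: "finite I \<Longrightarrow> void_prob (\<Sum>i\<in>I. f i) = (\<Prod>i\<in>I. void_prob (f i))"
  by (induction I rule: finite_induct) (auto simp: void_prob_add)

lemma void_prob_antimono: "x \<le> y \<Longrightarrow> void_prob y \<le> void_prob x"
  by (auto simp: void_prob_def top_unique less_top intro!: enn2real_mono)

text \<open>The value at infinity is included because a set of infinite intensity is exhausted by
  sets of finite intensity, along which the void probabilities must tend to 0.\<close>

lemma tendsto_void_prob:
  assumes "(f \<longlongrightarrow> x) F"
  shows "((\<lambda>i. void_prob (f i)) \<longlongrightarrow> void_prob x) F"
proof (cases "x = \<infinity>")
  case False
  then have ev: "\<forall>\<^sub>F i in F. f i \<noteq> \<infinity>"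
    using order_tendstoD(2)[OF assms, of \<infinity>] by (auto simp: less_top elim: eventually_mono)
  have "((\<lambda>i. exp (- enn2real (f i))) \<longlongrightarrow> exp (- enn2real x)) F"
    using assms False by (intro tendsto_intros tendsto_enn2real) (auto simp: less_top)
  then have "((\<lambda>i. void_prob (f i)) \<longlongrightarrow> exp (- enn2real x)) F"
    by (rule Lim_transform_eventually) (use ev in \<open>auto simp: void_prob_def elim: eventually_mono\<close>)
  then show ?thesis
    using False by (simp add: void_prob_def)
next
  case True
  show ?thesis
    unfolding tendsto_iff
  proof (intro allI impI)
    fix e :: real assume "e > 0"
    \<comment> \<open>\<open>max 0\<close> keeps \<open>ennreal K\<close> from truncating a negative
      number; the summand 1 makes exp (- K) < e strict.\<close>
    define K where "K = max 0 (- ln e) + 1"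
    have "\<forall>\<^sub>F i in F. ennreal K < f i"
      using order_tendstoD(1)[OF assms, of "ennreal K"] True by simp
    moreover have "void_prob y < e" if "ennreal K < y" for y
    proof -
      have "void_prob y \<le> void_prob (ennreal K)"
        using that by (intro void_prob_antimono) auto
      also have "\<dots> = exp (- K)"
        by (subst void_prob_ennreal) (auto simp: K_def)
      also have "\<dots> < exp (ln e)"
        by (subst exp_less_cancel_iff) (simp add: K_def max_def)
      finally show ?thesis
        using \<open>e > 0\<close> by simp
    qed
    ultimately show "\<forall>\<^sub>F i in F. dist (void_prob (f i)) (void_prob x) < e"
      using True by (auto elim!: eventually_mono)
  qed
qed

section \<open>Uniqueness, mapping, restriction, superposition and independence\<close>

text \<open>Void events form a pi-system, since avoiding A and avoiding B is avoiding their union,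
  and they generate the sigma-algebra; so the pi-lambda theorem applies.\<close>

lemma poisson_law_unique:
  assumes "poisson_law \<mu> P" "poisson_law \<mu> Q"
  shows "P = Q"
proof -
  interpret P: prob_space P using assms(1) by (simp add: poisson_law_def)
  interpret Q: prob_space Q using assms(2) by (simp add: poisson_law_def)
  show ?thesis
  proof (rule measure_eqI_generator_eq[OF Int_stable_void_events])
    show "sets P = sigma_sets UNIV {{C. C \<inter> A = {}} | A. A \<in> sets borel}"
      "sets Q = sigma_sets UNIV {{C. C \<inter> A = {}} | A. A \<in> sets borel}"
      using assms by (simp_all add: poisson_law_def sets_config_algebra)
    \<comment> \<open>\<open>UNIV\<close> is the void event of the empty set, so a constant sequence
      in the generator exhausts the space.\<close>
    show "range (\<lambda>_. UNIV) \<subseteq> {{C. C \<inter> A = {}} |A. A \<in> sets (borel :: 'a measure)}"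
      by (auto intro!: exI[of _ "{}"])
    show "emeasure P X = emeasure Q X" if "X \<in> {{C. C \<inter> A = {}} |A. A \<in> sets (borel :: 'a measure)}" for X
      using that assms by (auto simp: poisson_law_def P.emeasure_eq_measure Q.emeasure_eq_measure)
  qed auto
qed

text \<open>Entry point of every construction: a random configuration on any sample space is
  replaced by its image law, after which the sample space can be forgotten.\<close>

lemma poisson_law_distr:
  assumes "prob_space M" "\<xi> \<in> M \<rightarrow>\<^sub>M config_algebra"
    and "\<And>A. A \<in> sets borel \<Longrightarrow> measure M {\<omega>\<in>space M. \<xi> \<omega> \<inter> A = {}} = void_prob (emeasure \<mu> A)"
  shows "poisson_law \<mu> (distr M config_algebra \<xi>)"
  unfolding poisson_law_def
proof (intro conjI ballI)
  show "prob_space (distr M config_algebra \<xi>)"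
    using assms by (simp add: prob_space.prob_space_distr)
  fix A :: "'b set" assume A: "A \<in> sets borel"
  have "\<xi> -` {C. C \<inter> A = {}} \<inter> space M = {\<omega>\<in>space M. \<xi> \<omega> \<inter> A = {}}"
    by auto
  then show "measure (distr M config_algebra \<xi>) {C. C \<inter> A = {}} = void_prob (emeasure \<mu> A)"
    using assms(2,3) A by (simp add: measure_distr void_event_measurable)
qed simp

lemma poisson_lawD:
  assumes "poisson_law \<mu> P"
  shows "prob_space P" "sets P = sets config_algebra" "space P = UNIV"
    "A \<in> sets borel \<Longrightarrow> measure P {C. C \<inter> A = {}} = void_prob (emeasure \<mu> A)"
  using assms sets_eq_imp_space_eq[of P config_algebra] by (auto simp: poisson_law_def)

lemma measurable_image_config [measurable]:
  assumes "f \<in> borel_measurable borel"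
  shows "(\<lambda>C. f ` C) \<in> config_algebra \<rightarrow>\<^sub>M config_algebra"
proof (rule measurable_config_algebraI)
  fix A :: "'b set" assume "A \<in> sets borel"
  then have "f -` A \<in> sets borel"
    using measurable_sets[OF assms] by simp
  moreover have "{C. f ` C \<inter> A = {}} = {C. C \<inter> f -` A = {}}"
    by blast
  ultimately show "{C \<in> space config_algebra. f ` C \<inter> A = {}} \<in> sets config_algebra"
    by (simp add: void_event_measurable)
qed

lemma measurable_restrict_config:
  assumes "B \<in> sets borel"
  shows "(\<lambda>C. C \<inter> B) \<in> config_algebra \<rightarrow>\<^sub>M config_algebra"
proof (rule measurable_config_algebraI)
  fix A :: "'a set" assume "A \<in> sets borel"
  with assms show "{C \<in> space config_algebra. C \<inter> B \<inter> A = {}} \<in> sets config_algebra"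
    using void_event_measurable[of "B \<inter> A"] by (simp add: Int_assoc)
qed

lemma measurable_union_config:
  assumes "f \<in> M \<rightarrow>\<^sub>M config_algebra" "g \<in> M \<rightarrow>\<^sub>M config_algebra"
  shows "(\<lambda>\<omega>. f \<omega> \<union> g \<omega>) \<in> M \<rightarrow>\<^sub>M config_algebra"
proof (rule measurable_config_algebraI)
  fix A :: "'b set" assume A: "A \<in> sets borel"
  have [measurable]: "f -` {C. C \<inter> A = {}} \<inter> space M \<in> sets M" "g -` {C. C \<inter> A = {}} \<inter> space M \<in> sets M"
    using measurable_sets[OF assms(1) void_event_measurable[OF A]]
      measurable_sets[OF assms(2) void_event_measurable[OF A]] by simp_all
  have "{\<omega> \<in> space M. (f \<omega> \<union> g \<omega>) \<inter> A = {}}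
      = (f -` {C. C \<inter> A = {}} \<inter> space M) \<inter> (g -` {C. C \<inter> A = {}} \<inter> space M)"
    by auto
  then show "{\<omega> \<in> space M. (f \<omega> \<union> g \<omega>) \<inter> A = {}} \<in> sets M"
    by (metis (no_types, lifting) \<open>f -` {C. C \<inter> A = {}} \<inter> space M \<in> sets M\<close>
        \<open>g -` {C. C \<inter> A = {}} \<inter> space M \<in> sets M\<close> sets.Int)
qed

text \<open>Mapping theorem: the image of C avoids A exactly when C avoids the preimage of
  A.\<close>

lemma poisson_law_image:
  assumes "poisson_law \<mu> P" "f \<in> borel_measurable borel"
    and "\<And>A. A \<in> sets borel \<Longrightarrow> emeasure \<mu>' A = emeasure \<mu> (f -` A)"
  shows "poisson_law \<mu>' (distr P config_algebra (\<lambda>C. f ` C))"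
proof (rule poisson_law_distr)
  note P = poisson_lawD[OF assms(1)]
  show "prob_space P" by fact
  show "(\<lambda>C. f ` C) \<in> P \<rightarrow>\<^sub>M config_algebra"
    using measurable_image_config[OF assms(2)] P(2) by (simp cong: measurable_cong_sets)
  fix A :: "'b set" assume A: "A \<in> sets borel"
  then have "f -` A \<in> sets borel"
    using measurable_sets[OF assms(2)] by simp
  moreover have "{C. f ` C \<inter> A = {}} = {C. C \<inter> f -` A = {}}"
    by blast
  ultimately show "measure P {C \<in> space P. f ` C \<inter> A = {}} = void_prob (emeasure \<mu>' A)"
    using P assms(3)[OF A] by simp
qed

lemma poisson_law_restrict:
  assumes "poisson_law \<mu> P" "B \<in> sets borel"
    and "\<And>A. A \<in> sets borel \<Longrightarrow> emeasure \<mu>' A = emeasure \<mu> (A \<inter> B)"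
  shows "poisson_law \<mu>' (distr P config_algebra (\<lambda>C. C \<inter> B))"
proof (rule poisson_law_distr)
  note P = poisson_lawD[OF assms(1)]
  show "prob_space P" by fact
  show "(\<lambda>C. C \<inter> B) \<in> P \<rightarrow>\<^sub>M config_algebra"
    using measurable_restrict_config[OF assms(2)] P(2) by (simp cong: measurable_cong_sets)
  fix A :: "'a set" assume A: "A \<in> sets borel"
  then show "measure P {C \<in> space P. C \<inter> B \<inter> A = {}} = void_prob (emeasure \<mu>' A)"
    using P(3) P(4)[of "A \<inter> B"] assms(2,3) by (simp add: Int_assoc Int_commute[of B])
qed

text \<open>For independent configurations the void event of the union is a rectangle, and
  \<open>void_prob\<close> turns the sum of intensities into the product of the two
  probabilities.\<close>

lemma poisson_law_union:
  assumes "poisson_law \<mu>1 P" "poisson_law \<mu>2 Q"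
    and "\<And>A. A \<in> sets borel \<Longrightarrow> emeasure \<mu> A = emeasure \<mu>1 A + emeasure \<mu>2 A"
  shows "poisson_law \<mu> (distr (P \<Otimes>\<^sub>M Q) config_algebra (\<lambda>(C, D). C \<union> D))"
proof (rule poisson_law_distr)
  note P = poisson_lawD[OF assms(1)] and Q = poisson_lawD[OF assms(2)]
  interpret P: prob_space P by fact
  interpret Q: prob_space Q by fact
  interpret PQ: pair_prob_space P Q ..
  show "prob_space (P \<Otimes>\<^sub>M Q)" by (rule PQ.prob_space_axioms)
  have "fst \<in> P \<Otimes>\<^sub>M Q \<rightarrow>\<^sub>M config_algebra" "snd \<in> P \<Otimes>\<^sub>M Q \<rightarrow>\<^sub>M config_algebra"
    using P(2) Q(2) measurable_fst[of P Q] measurable_snd[of P Q] by (simp_all cong: measurable_cong_sets)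
  then show "(\<lambda>(C, D). C \<union> D) \<in> P \<Otimes>\<^sub>M Q \<rightarrow>\<^sub>M config_algebra"
    by (simp add: case_prod_beta' measurable_union_config)
  fix A :: "'a set" assume A: "A \<in> sets borel"
  have "{\<omega> \<in> space (P \<Otimes>\<^sub>M Q). (case \<omega> of (C, D) \<Rightarrow> C \<union> D) \<inter> A = {}}
      = {C. C \<inter> A = {}} \<times> {C. C \<inter> A = {}}"
    using P(3) Q(3) by (auto simp: space_pair_measure)
  then show "measure (P \<Otimes>\<^sub>M Q) {\<omega> \<in> space (P \<Otimes>\<^sub>M Q). (case \<omega> of (C, D) \<Rightarrow> C \<union> D) \<inter> A = {}}
      = void_prob (emeasure \<mu> A)"
    using P Q A assms(3)[OF A] void_event_measurable[OF A]
    by (simp add: void_prob_add measure_def Q.emeasure_pair_measure_Times enn2real_mult)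
qed

text \<open>Independence may be tested on void events. Those of the disjoint sets \<open>B j\<close>
  combine into the void event of one union, whose intensity is the sum over the pieces, so that its
  probability factorises.\<close>

lemma poisson_law_indep:
  assumes P: "poisson_law \<mu> P" and \<mu>: "sets \<mu> = sets borel"
    and B: "\<And>i. i \<in> I \<Longrightarrow> B i \<in> sets borel" and disj: "disjoint_family_on B I" and fin: "finite I"
  shows "prob_space.indep_vars P (\<lambda>_. config_algebra) (\<lambda>i C. C \<inter> B i) I"
proof -
  note PD = poisson_lawD[OF P]
  interpret P: prob_space P by fact
  have rv: "(\<lambda>C. C \<inter> B i) \<in> P \<rightarrow>\<^sub>M config_algebra" if "i \<in> I" for i
    using measurable_restrict_config[OF B[OF that]] PD(2) by (simp cong: measurable_cong_sets)
  show ?thesis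
  proof (cases "I = {}")
    case True
    then show ?thesis
      by (simp add: P.indep_vars_def P.indep_sets_def)
  next
    case False
    have "P.indep_vars (\<lambda>_. config_algebra) (\<lambda>i C. C \<inter> B i) I \<longleftrightarrow>
      (\<forall>A\<in>(\<Pi> i\<in>I. {{C. C \<inter> A = {}} | A. A \<in> sets (borel :: 'a measure)}).
        P.prob (\<Inter>j\<in>I. (\<lambda>C. C \<inter> B j) -` A j \<inter> space P) = (\<Prod>j\<in>I. P.prob ((\<lambda>C. C \<inter> B j) -` A j \<inter> space P)))"
      using False fin rv
      by (intro P.indep_vars_finite Int_stable_void_events) (auto simp: sets_config_algebra intro!: exI[of _ "{}"])
    also have \<dots>
    proof
      fix A assume "A \<in> (\<Pi> i\<in>I. {{C. C \<inter> A = {}} | A. A \<in> sets (borel :: 'a measure)})"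
      then have "\<forall>i\<in>I. \<exists>D. D \<in> sets borel \<and> A i = {C. C \<inter> D = {}}"
        by (auto simp: Pi_iff)
      then obtain D where D: "\<And>i. i \<in> I \<Longrightarrow> D i \<in> sets borel" "\<And>i. i \<in> I \<Longrightarrow> A i = {C. C \<inter> D i = {}}"
        by metis
      have eq: "(\<lambda>C. C \<inter> B j) -` A j \<inter> space P = {C. C \<inter> (B j \<inter> D j) = {}}" if "j \<in> I" for j
        using D(2)[OF that] PD(3) by auto
      have "(\<Inter>j\<in>I. (\<lambda>C. C \<inter> B j) -` A j \<inter> space P) = {C. C \<inter> (\<Union>j\<in>I. B j \<inter> D j) = {}}"
        using False eq by auto
      moreover have "emeasure \<mu> (\<Union>j\<in>I. B j \<inter> D j) = (\<Sum>j\<in>I. emeasure \<mu> (B j \<inter> D j))"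
        using B D(1) fin disj \<mu> by (intro sum_emeasure[symmetric]) (auto simp: disjoint_family_on_def, blast)
      moreover have "(\<Union>j\<in>I. B j \<inter> D j) \<in> sets borel"
        using B D(1) fin by auto
      ultimately show "P.prob (\<Inter>j\<in>I. (\<lambda>C. C \<inter> B j) -` A j \<inter> space P)
          = (\<Prod>j\<in>I. P.prob ((\<lambda>C. C \<inter> B j) -` A j \<inter> space P))"
        using PD(4) eq B D(1) fin by (simp add: void_prob_sum)
    qed
    finally show ?thesis .
  qed
qed

section \<open>Existence of Poisson laws\<close>

text \<open>Treated apart because the sampling construction divides by the total mass.\<close>

lemma poisson_law_exists_zero:
  assumes "emeasure \<mu> UNIV = 0" "sets \<mu> = sets borel"
  shows "\<exists>P. poisson_law \<mu> P"
proof -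
  have "poisson_law \<mu> (distr (measure_pmf (return_pmf ())) config_algebra (\<lambda>_. {}))"
  proof (rule poisson_law_distr)
    fix A :: "'a set"
    have "emeasure \<mu> A \<le> emeasure \<mu> UNIV"
      using assms(2) by (intro emeasure_mono) auto
    then have "emeasure \<mu> A = 0"
      using assms by simp
    then show "measure (measure_pmf (return_pmf ())) {\<omega> \<in> space (measure_pmf (return_pmf ())). {} \<inter> A = {}}
        = void_prob (emeasure \<mu> A)"
      by simp
  qed (auto intro: prob_space_measure_pmf)
  then show ?thesis by blast
qed

text \<open>With q the probability that a single point misses A, this is the probability that a
  Poisson number of independent points all miss A.\<close>

lemma poisson_mixture_power:
  assumes "m > 0" "0 \<le> q"
  shows "(\<integral>\<^sup>+n. ennreal q ^ n \<partial>measure_pmf (poisson_pmf m)) = ennreal (exp (- (m * (1 - q))))"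
proof -
  have "(\<lambda>n. (m * q) ^ n / fact n * exp (- m)) sums (exp (m * q) * exp (- m))"
    using sums_mult2[OF exp_converges[of "m * q"], of "exp (- m)"] by (simp add: field_simps)
  then have s: "(\<lambda>n. m ^ n / fact n * exp (- m) * q ^ n) sums (exp (- (m * (1 - q))))"
    by (simp add: power_mult_distrib algebra_simps exp_add[symmetric] exp_diff exp_minus field_simps)
  have "(\<integral>\<^sup>+n. ennreal q ^ n \<partial>measure_pmf (poisson_pmf m)) = (\<Sum>n. ennreal (m ^ n / fact n * exp (- m) * q ^ n))"
    using assms by (simp add: nn_integral_measure_pmf nn_integral_count_space_nat ennreal_power ennreal_mult'[symmetric])
  also have "\<dots> = ennreal (exp (- (m * (1 - q))))"
    using s assms by (intro suminf_ennreal_eq) auto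
  finally show ?thesis .
qed

text \<open>The joint law of two coordinates is the product of D with itself, and by Fubini the
  diagonal is null when D has no atoms.\<close>

lemma iid_distinct:
  fixes D :: "'x::{second_countable_topology, t2_space} measure"
  assumes D: "prob_space D" "sets D = sets borel" and atomless: "\<And>x. emeasure D {x} = 0" and ij: "i \<noteq> j"
  shows "AE X in PiM UNIV (\<lambda>_::'i. D). X i \<noteq> X j"
proof -
  interpret D: prob_space D by fact
  interpret product_prob_space "\<lambda>_::'i. D" UNIV by standard
  have sp: "space D = UNIV"
    using sets_eq_imp_space_eq[OF D(2)] by simp
  let ?P = "PiM UNIV (\<lambda>_::'i. D)"
  have m: "(\<lambda>X. (X i, X j)) \<in> ?P \<rightarrow>\<^sub>M D \<Otimes>\<^sub>M D"
    by measurable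
  have eq: "D \<Otimes>\<^sub>M D = distr ?P (D \<Otimes>\<^sub>M D) (\<lambda>X. (X i, X j))"
  proof (rule pair_measure_eqI)
    fix A B assume A: "A \<in> sets D" and B: "B \<in> sets D"
    have "(\<lambda>X. (X i, X j)) -` (A \<times> B) \<inter> space ?P
        = {X \<in> space ?P. \<forall>k\<in>{i, j}. X k \<in> (if k = i then A else B)}"
      using ij by auto
    then show "emeasure D A * emeasure D B = emeasure (distr ?P (D \<Otimes>\<^sub>M D) (\<lambda>X. (X i, X j))) (A \<times> B)"
      using A B ij m emeasure_PiM_Collect[of "{i, j}" "\<lambda>k. if k = i then A else B"]
      by (simp add: emeasure_distr)
  qed (auto simp: D.sigma_finite_measure_axioms)
  \<comment> \<open>The Hausdorff property makes the diagonal closed, and second countability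
    identifies the product of the Borel sigma-algebras with the Borel one.\<close>
  have "closed {p :: 'x \<times> 'x. fst p = snd p}"
    by (intro closed_Collect_eq continuous_intros)
  then have diag: "{p. fst p = snd p} \<in> sets (D \<Otimes>\<^sub>M D)"
    using borel_closed D(2) by (metis borel_prod sets_pair_measure_cong)
  have "emeasure (D \<Otimes>\<^sub>M D) {p. fst p = snd p} = (\<integral>\<^sup>+x. emeasure D (Pair x -` {p. fst p = snd p}) \<partial>D)"
    using diag by (rule D.emeasure_pair_measure_alt)
  also have "\<dots> = 0"
    using atomless by (simp add: vimage_def)
  finally have "emeasure ?P ((\<lambda>X. (X i, X j)) -` {p. fst p = snd p} \<inter> space ?P) = 0"
    using m diag by (subst (asm) eq) (simp add: emeasure_distr)
  then show ?thesis
    using measurable_sets[OF m diag]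
    by (intro AE_I[of _ _ "(\<lambda>X. (X i, X j)) -` {p. fst p = snd p} \<inter> space ?P"]) auto
qed

text \<open>The classical construction: a Poisson number n with mean the total mass and,
  independently, a sequence of independent points of normalised law, of which the first n are kept.
  The number n is exported as well, because it counts the points whenever these are
  distinct.\<close>

lemma poisson_sample:
  fixes \<mu> :: "'x::{second_countable_topology, t2_space} measure"
  assumes fin: "finite_measure \<mu>" and sets: "sets \<mu> = sets borel" and pos: "measure \<mu> UNIV > 0"
  obtains M :: "(nat \<times> (nat \<Rightarrow> 'x)) measure"
  where "prob_space M" "fst \<in> M \<rightarrow>\<^sub>M count_space UNIV"
    "\<And>n. measure M {\<omega>\<in>space M. fst \<omega> = n} = measure \<mu> UNIV ^ n / fact n * exp (- measure \<mu> UNIV)"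
    "(\<lambda>(n, X). X ` {..<n}) \<in> M \<rightarrow>\<^sub>M config_algebra"
    "\<And>A. A \<in> sets borel \<Longrightarrow>
       measure M {\<omega>\<in>space M. (case \<omega> of (n, X) \<Rightarrow> X ` {..<n}) \<inter> A = {}} = void_prob (emeasure \<mu> A)"
    "(\<forall>x. emeasure \<mu> {x} = 0) \<Longrightarrow> AE (n, X) in M. inj_on X {..<n}"
proof -
  interpret finite_measure \<mu> by fact
  have sp: "space \<mu> = UNIV"
    using sets_eq_imp_space_eq[OF sets] by simp
  define m where "m = measure \<mu> UNIV"
  have m: "m > 0" using pos by (simp add: m_def)
  define D where "D = scale_measure (ennreal (1 / m)) \<mu>"
  have D_sets[simp, measurable_cong]: "sets D = sets borel" and D_sp[simp]: "space D = UNIV"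
    using sets sp by (simp_all add: D_def space_scale_measure)
  have eD: "emeasure D A = ennreal (measure \<mu> A / m)" for A
    using m by (simp add: D_def emeasure_eq_measure ennreal_mult[symmetric])
  interpret D: prob_space D
    by standard (use m in \<open>simp add: eD m_def\<close>)
  interpret product_prob_space "\<lambda>_::nat. D" UNIV by standard
  define Q where "Q = PiM UNIV (\<lambda>_::nat. D)"
  interpret Q: prob_space Q unfolding Q_def by (rule P.prob_space_axioms)
  have Q_sp[simp]: "space Q = UNIV"
    by (auto simp: Q_def space_PiM)
  define M where "M = measure_pmf (poisson_pmf m) \<Otimes>\<^sub>M Q"
  interpret pmf: prob_space "measure_pmf (poisson_pmf m)" by (rule prob_space_measure_pmf)
  interpret PQ: pair_prob_space "measure_pmf (poisson_pmf m)" Q ..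
  have M_sp[simp]: "space M = UNIV"
    by (simp add: M_def space_pair_measure)
  have M_sets: "sets M = sets (count_space UNIV \<Otimes>\<^sub>M Q)"
    unfolding M_def by (intro sets_pair_measure_cong) auto
  show thesis
  proof (rule that[of M])
    show "prob_space M"
      unfolding M_def by (rule PQ.prob_space_axioms)
    show f: "fst \<in> M \<rightarrow>\<^sub>M count_space UNIV"
      by (simp add: measurable_cong_sets[OF M_sets refl])
    show "measure M {\<omega> \<in> space M. fst \<omega> = n} = measure \<mu> UNIV ^ n / fact n * exp (- measure \<mu> UNIV)" for n
    proof -
      have "{\<omega> \<in> space M. fst \<omega> = n} = {n} \<times> space Q"
        by auto
      then have "emeasure M {\<omega> \<in> space M. fst \<omega> = n} = ennreal (pmf (poisson_pmf m) n)"
        using Q.emeasure_space_1 sets.top[of Q]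
        by (simp add: M_def Q.emeasure_pair_measure_Times emeasure_pmf_single)
      then show ?thesis
        using m by (simp add: measure_def m_def)
    qed
    have slice: "{X. X ` {..<n} \<inter> A = {}} \<in> sets Q"
      "emeasure Q {X. X ` {..<n} \<inter> A = {}} = ennreal (measure \<mu> (- A) / m) ^ n" if "A \<in> sets borel" for A n
    proof -
      have *: "{X. X ` {..<n} \<inter> A = {}} = {X\<in>space Q. \<forall>i\<in>{..<n}. X i \<in> - A}"
        by auto
      show "{X. X ` {..<n} \<inter> A = {}} \<in> sets Q"
        unfolding * unfolding Q_def using that by measurable
      show "emeasure Q {X. X ` {..<n} \<inter> A = {}} = ennreal (measure \<mu> (- A) / m) ^ n"
        unfolding * unfolding Q_def
        using that emeasure_PiM_Collect[of "{..<n}" "\<lambda>_. - A"] by (simp add: eD)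
    qed
    have ev: "{\<omega>. (case \<omega> of (n, X) \<Rightarrow> X ` {..<n}) \<inter> A = {}} \<in> sets M" if "A \<in> sets borel" for A
    proof -
      have "{\<omega>. (case \<omega> of (n, X) \<Rightarrow> X ` {..<n}) \<inter> A = {}} = (\<Union>n. {n} \<times> {X. X ` {..<n} \<inter> A = {}})"
        by auto
      also have "\<dots> \<in> sets M"
        using slice(1)[OF that] by (auto simp: M_def intro!: sets.countable_UN)
      finally show ?thesis .
    qed
    show "(\<lambda>(n, X). X ` {..<n}) \<in> M \<rightarrow>\<^sub>M config_algebra"
      using ev by (intro measurable_config_algebraI) simp
    fix A :: "'x set" assume A: "A \<in> sets borel"
    \<comment> \<open>Given n, what remains is the n-th power of the probability that one point
      misses A.\<close>
    have "emeasure M {\<omega>. (case \<omega> of (n, X) \<Rightarrow> X ` {..<n}) \<inter> A = {}}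
        = (\<integral>\<^sup>+n. emeasure Q (Pair n -` {\<omega>. (case \<omega> of (n, X) \<Rightarrow> X ` {..<n}) \<inter> A = {}}) \<partial>measure_pmf (poisson_pmf m))"
      using ev[OF A] unfolding M_def by (rule Q.emeasure_pair_measure_alt)
    also have "\<dots> = (\<integral>\<^sup>+n. ennreal (measure \<mu> (- A) / m) ^ n \<partial>measure_pmf (poisson_pmf m))"
      by (simp add: vimage_def slice(2)[OF A])
    also have "\<dots> = ennreal (exp (- (m * (1 - measure \<mu> (- A) / m))))"
      using m by (intro poisson_mixture_power) auto
    also have "m * (1 - measure \<mu> (- A) / m) = m - measure \<mu> (- A)"
      using m by (simp add: field_simps)
    also have "m - measure \<mu> (- A) = measure \<mu> A"
      using finite_measure.finite_measure_compl[OF fin, of A] A sp sets by (simp add: m_def Compl_eq_Diff_UNIV)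
    finally show "measure M {\<omega>\<in>space M. (case \<omega> of (n, X) \<Rightarrow> X ` {..<n}) \<inter> A = {}} = void_prob (emeasure \<mu> A)"
      by (simp add: measure_def[of M] finite_measure.emeasure_eq_measure[OF fin])
  next
    assume "\<forall>x. emeasure \<mu> {x} = 0"
    then have "emeasure D {x} = 0" for x
      by (simp add: eD measure_def)
    then have "AE X in Q. X i \<noteq> X j" if "i \<noteq> j" for i j
      unfolding Q_def using that D.prob_space_axioms by (intro iid_distinct) auto
    then have "AE X in Q. \<forall>i j. i \<noteq> j \<longrightarrow> X i \<noteq> X j"
      by (simp add: AE_all_countable)
    then have "AE X in Q. inj X"
      by eventually_elim (auto simp: inj_def)
    then obtain N where N: "{X\<in>space Q. \<not> inj X} \<subseteq> N" "N \<in> null_sets Q"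
      by (auto elim!: AE_E simp: null_sets_def)
    have "AE \<omega> in M. inj (snd \<omega>)"
    proof (rule AE_I')
      show "UNIV \<times> N \<in> null_sets M"
        unfolding M_def using N(2) by (intro Q.times_in_null_sets2) auto
      show "{\<omega> \<in> space M. \<not> inj (snd \<omega>)} \<subseteq> UNIV \<times> N"
        using N(1) by auto
    qed
    then show "AE (n, X) in M. inj_on X {..<n}"
      by eventually_elim (auto simp: split_beta intro: inj_on_subset)
  qed
qed

lemma poisson_law_exists_finite:
  fixes \<mu> :: "'x::{second_countable_topology, t2_space} measure"
  assumes "finite_measure \<mu>" "sets \<mu> = sets borel"
  shows "\<exists>P. poisson_law \<mu> P"
proof (cases "measure \<mu> UNIV > 0")
  case True
  show ?thesis
  proof (rule poisson_sample[OF assms True])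
    fix M :: "(nat \<times> (nat \<Rightarrow> 'x)) measure"
    assume "prob_space M" "(\<lambda>(n, X). X ` {..<n}) \<in> M \<rightarrow>\<^sub>M config_algebra"
      "\<And>A. A \<in> sets borel \<Longrightarrow>
       measure M {\<omega>\<in>space M. (case \<omega> of (n, X) \<Rightarrow> X ` {..<n}) \<inter> A = {}} = void_prob (emeasure \<mu> A)"
    from poisson_law_distr[OF this] show ?thesis
      by blast
  qed
next
  case False
  then have "emeasure \<mu> UNIV = 0"
    using assms(1) by (simp add: finite_measure.emeasure_eq_measure zero_less_measure_iff)
  then show ?thesis
    using assms(2) by (rule poisson_law_exists_zero)
qed

text \<open>The space is cut into countably many disjoint pieces of finite mass, and independent
  processes on the pieces are united.\<close>

lemma poisson_law_exists:
  fixes \<mu> :: "'x::{second_countable_topology, t2_space} measure"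
  assumes "sigma_finite_measure \<mu>" and sets: "sets \<mu> = sets borel"
  shows "\<exists>P. poisson_law \<mu> P"
proof -
  interpret sigma_finite_measure \<mu> by fact
  have sp: "space \<mu> = UNIV"
    using sets_eq_imp_space_eq[OF sets] by simp
  obtain S :: "nat \<Rightarrow> 'x set" where S: "range S \<subseteq> sets \<mu>" "(\<Union>i. S i) = UNIV"
    "\<And>i. emeasure \<mu> (S i) \<noteq> \<infinity>" "disjoint_family S"
    using sigma_finite_disjoint sp by metis
  have S_sets: "S i \<in> sets \<mu>" for i
    using S(1) by auto
  define R where "R i = density \<mu> (indicator (S i))" for i
  have eR: "emeasure (R i) A = emeasure \<mu> (A \<inter> S i)" if "A \<in> sets borel" for A i
    using that sets S_sets[of i] unfolding R_def
    by (subst emeasure_density) (auto simp: indicator_inter_arith[symmetric] mult.commute Int_commute)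
  have "\<exists>P. poisson_law (R i) P" for i
  proof (rule poisson_law_exists_finite)
    show "sets (R i) = sets borel"
      by (simp add: R_def sets)
    show "finite_measure (R i)"
      using eR[of UNIV i] S(3)[of i] by (intro finite_measureI) (simp add: R_def sp)
  qed
  then obtain P where P: "\<And>i. poisson_law (R i) (P i)"
    by metis
  note PD = poisson_lawD[OF P]
  interpret Pi: prob_space "P i" for i by fact
  interpret product_prob_space P UNIV by standard
  have comp: "(\<lambda>\<omega>. \<omega> i) \<in> PiM UNIV P \<rightarrow>\<^sub>M config_algebra" for i
    using measurable_component_singleton[of i UNIV P] PD(2)[of i] by (simp cong: measurable_cong_sets)
  have PiM_sp: "space (PiM UNIV P) = UNIV"
    using PD(3) by (auto simp: space_PiM)
  \<comment> \<open>Only the processes on the first n pieces are required to avoid A. These events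
    decrease to the void event of the union, whose probability is thus a limit of finite
    products.\<close>
  let ?E = "\<lambda>A n. {\<omega>\<in>space (PiM UNIV P). \<forall>i\<in>{..<n}. \<omega> i \<in> {C. C \<inter> A = {}}}"
  have E_sets: "?E A n \<in> sets (PiM UNIV P)" if A: "A \<in> sets borel" for A n
  proof -
    have "?E A n = (\<Inter>i\<in>{..<n}. (\<lambda>\<omega>. \<omega> i) -` {C. C \<inter> A = {}} \<inter> space (PiM UNIV P)) \<inter> space (PiM UNIV P)"
      by auto
    also have "\<dots> \<in> sets (PiM UNIV P)"
      using measurable_sets[OF comp void_event_measurable[OF A]]
      using sets.top[of "PiM UNIV P"]
      by (cases "n = 0") (auto simp: PiM_sp intro!: sets.Int sets.finite_INT)
    finally show ?thesis .
  qed
  have eq: "{\<omega>\<in>space (PiM UNIV P). (\<Union>i. \<omega> i) \<inter> A = {}} = (\<Inter>n. ?E A n)" for A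
    by (auto simp: PiM_sp)
  have "poisson_law \<mu> (distr (PiM UNIV P) config_algebra (\<lambda>\<omega>. \<Union>i. \<omega> i))"
  proof (rule poisson_law_distr)
    show "prob_space (PiM UNIV P)" by (rule P.prob_space_axioms)
    show "(\<lambda>\<omega>. \<Union>i. \<omega> i) \<in> PiM UNIV P \<rightarrow>\<^sub>M config_algebra"
      using E_sets by (intro measurable_config_algebraI) (auto simp: eq intro!: sets.countable_INT)
    fix A :: "'x set" assume A: "A \<in> sets borel"
    have m: "measure (PiM UNIV P) (?E A n) = void_prob (\<Sum>i<n. emeasure \<mu> (A \<inter> S i))" for n
    proof -
      have "emeasure (PiM UNIV P) (?E A n) = (\<Prod>i<n. emeasure (P i) {C. C \<inter> A = {}})"
        using PD(2) void_event_measurable[OF A] by (intro emeasure_PiM_Collect) auto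
      also have "\<dots> = (\<Prod>i<n. ennreal (void_prob (emeasure \<mu> (A \<inter> S i))))"
        using PD(4)[OF A] eR[OF A] by (simp add: Pi.emeasure_eq_measure)
      also have "\<dots> = ennreal (void_prob (\<Sum>i<n. emeasure \<mu> (A \<inter> S i)))"
        by (simp add: prod_ennreal void_prob_sum)
      finally show ?thesis
        by (simp add: measure_def)
    qed
    have "(\<lambda>n. measure (PiM UNIV P) (?E A n)) \<longlonglongrightarrow> measure (PiM UNIV P) (\<Inter>n. ?E A n)"
      using E_sets[OF A] by (intro P.finite_Lim_measure_decseq) (auto simp: decseq_def)
    moreover have "(\<lambda>n. void_prob (\<Sum>i<n. emeasure \<mu> (A \<inter> S i))) \<longlonglongrightarrow> void_prob (emeasure \<mu> A)"
    proof (rule tendsto_void_prob)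
      have "(\<lambda>i. emeasure \<mu> (A \<inter> S i)) sums (\<Sum>i. emeasure \<mu> (A \<inter> S i))"
        by (simp add: summable_sums)
      also have "(\<Sum>i. emeasure \<mu> (A \<inter> S i)) = emeasure \<mu> (\<Union>i. A \<inter> S i)"
        using S_sets A sets S(4) by (intro suminf_emeasure) (auto simp: disjoint_family_on_def, blast)
      also have "(\<Union>i. A \<inter> S i) = A"
        using S(2) by auto
      finally show "(\<lambda>n. \<Sum>i<n. emeasure \<mu> (A \<inter> S i)) \<longlonglongrightarrow> emeasure \<mu> A"
        by (simp add: sums_def)
    qed
    ultimately show "measure (PiM UNIV P) {\<omega> \<in> space (PiM UNIV P). (\<Union>i. \<omega> i) \<inter> A = {}} = void_prob (emeasure \<mu> A)"
      unfolding eq m using LIMSEQ_unique by blast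
  qed
  then show ?thesis by blast
qed

section \<open>Numbers of points\<close>

lemma ex_separating_key:
  fixes B :: "nat \<Rightarrow> 'a set"
  assumes sep: "\<And>x y. x \<noteq> y \<Longrightarrow> \<exists>i. (x \<in> B i) \<noteq> (y \<in> B i)" and "finite F"
  shows "\<exists>n. inj_on (\<lambda>x. {i. i < n \<and> x \<in> B i}) F"
proof -
  obtain k where k: "\<And>x y. x \<noteq> y \<Longrightarrow> (x \<in> B (k x y)) \<noteq> (y \<in> B (k x y))"
    using sep by metis
  define n where "n = Suc (Max ((\<lambda>(x, y). k x y) ` (F \<times> F)))"
  have kn: "k x y < n" if "x \<in> F" "y \<in> F" for x y
    using that \<open>finite F\<close> by (auto simp: n_def less_Suc_eq_le intro!: Max_ge)
  have "inj_on (\<lambda>x. {i. i < n \<and> x \<in> B i}) F"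
  proof (rule inj_onI, rule ccontr)
    fix x y assume "x \<in> F" "y \<in> F" "{i. i < n \<and> x \<in> B i} = {i. i < n \<and> y \<in> B i}" "x \<noteq> y"
    then show False
      using k[of x y] kn[of x y] by blast
  qed
  then show ?thesis by blast
qed

text \<open>A key records membership in the first n separating sets. Distinct keys never outnumber
  the points, and every finite set of points is resolved once n is large.\<close>

lemma count_eq_SUP_keys:
  fixes B :: "nat \<Rightarrow> 'a set"
  assumes sep: "\<And>x y. x \<noteq> y \<Longrightarrow> \<exists>i. (x \<in> B i) \<noteq> (y \<in> B i)"
  shows "emeasure (count_space UNIV) S = (SUP n. of_nat (card ((\<lambda>x. {i. i < n \<and> x \<in> B i}) ` S)) :: ennreal)"
    (is "_ = (SUP n. of_nat (card (?key n ` S)))")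
proof (rule antisym)
  have fin: "finite (?key n ` S)" for n
    by (rule finite_subset[of _ "Pow {..<n}"]) auto
  have *: "of_nat (card F) \<le> (SUP n. of_nat (card (?key n ` S)) :: ennreal)" if "finite F" "F \<subseteq> S" for F
  proof -
    obtain n where n: "inj_on (?key n) F"
      using ex_separating_key[OF sep \<open>finite F\<close>] by blast
    have "card F = card (?key n ` F)"
      using n by (rule card_image[symmetric])
    also have "\<dots> \<le> card (?key n ` S)"
      using that by (intro card_mono fin image_mono) auto
    finally have "card F \<le> card (?key n ` S)" .
    then show ?thesis
      by (intro SUP_upper2[of n]) auto
  qed
  show "emeasure (count_space UNIV) S \<le> (SUP n. of_nat (card (?key n ` S)))"
  proof (cases "finite S")
    case True
    then show ?thesis using *[of S] by simp
  next
    case False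
    have "of_nat k \<le> (SUP n. of_nat (card (?key n ` S)) :: ennreal)" for k
    proof -
      obtain F where "finite F" "card F = k" "F \<subseteq> S"
        using infinite_arbitrarily_large[OF False, of k] by blast
      then show ?thesis using *[of F] by simp
    qed
    then have "(SUP k. of_nat k :: ennreal) \<le> (SUP n. of_nat (card (?key n ` S)) :: ennreal)"
      by (intro SUP_least)
    then have "(SUP n. of_nat (card (?key n ` S)) :: ennreal) = \<top>"
      by (simp only: ennreal_SUP_of_nat_eq_top top_unique)
    then show ?thesis
      by (simp only: top_greatest)
  qed
  have "of_nat (card (?key n ` S)) \<le> emeasure (count_space UNIV) S" for n
    by (cases "finite S") (auto simp: card_image_le)
  then show "(SUP n. of_nat (card (?key n ` S))) \<le> emeasure (count_space UNIV) S"
    by (intro SUP_least) auto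
qed

text \<open>The sigma-algebra only tells whether a Borel set is hit. Splitting A into the cells with
  a given key and counting the cells that are hit recovers the number of points in the
  limit.\<close>

lemma count_measurable:
  fixes A :: "'x::{second_countable_topology, t2_space} set"
  assumes A: "A \<in> sets borel"
  shows "(\<lambda>C. emeasure (count_space UNIV) (C \<inter> A)) \<in> borel_measurable config_algebra"
proof -
  obtain \<B> :: "'x set set" where \<B>: "countable \<B>" "topological_basis \<B>"
    using ex_countable_basis by blast
  \<comment> \<open>The empty set is adjoined so that the enumeration ranges over a nonempty
    family.\<close>
  define B where "B = from_nat_into (insert {} \<B>)"
  have rB: "range B = insert {} \<B>"
    unfolding B_def using \<B>(1) by (intro range_from_nat_into) auto
  have B: "B i \<in> sets borel" for i
    using rB topological_basis_open[OF \<B>(2)] by (metis borel_open open_empty insert_iff rangeI)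
  have sep: "\<exists>i. (x \<in> B i) \<noteq> (y \<in> B i)" if xy: "x \<noteq> y" for x y
  proof -
    obtain U where "open U" "x \<in> U" "y \<notin> U"
      using t1_space[OF xy] by blast
    then obtain V where "V \<in> \<B>" "x \<in> V" "V \<subseteq> U"
      using topological_basisE[OF \<B>(2), of U x] by blast
    moreover then obtain i where "B i = V"
      using rB by (metis insertCI rangeE)
    ultimately show ?thesis
      using \<open>y \<notin> U\<close> by (intro exI[of _ i]) auto
  qed
  have key: "A \<inter> {x. {i. i < n \<and> x \<in> B i} = J} \<in> sets borel" for n J
  proof -
    have "A \<inter> {x. {i. i < n \<and> x \<in> B i} = J}
      = (if J \<subseteq> {..<n} then A \<inter> (\<Inter>i\<in>{..<n}. if i \<in> J then B i else - B i) else {})"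
      by (auto split: if_splits)
    also have "\<dots> \<in> sets borel"
    proof (cases "n = 0")
      case False
      have "(if i \<in> J then B i else - B i) \<in> sets borel" for i
        using B[of i] by auto
      then have "(\<Inter>i\<in>{..<n}. if i \<in> J then B i else - B i) \<in> sets borel"
        using False by (intro sets.finite_INT) auto
      then show ?thesis
        using A by (cases "J \<subseteq> {..<n}") (simp_all only: if_True if_False sets.Int sets.empty_sets)
    qed (use A in auto)
    finally show ?thesis .
  qed
  have hit: "(\<lambda>C. indicator {C. C \<inter> (A \<inter> {x. {i. i < n \<and> x \<in> B i} = J}) \<noteq> {}} C :: ennreal)
      \<in> borel_measurable config_algebra" for n J
    using hit_event_measurable[OF key] by (rule borel_measurable_indicator)
  have card_eq: "of_nat (card ((\<lambda>x. {i. i < n \<and> x \<in> B i}) ` (C \<inter> A)))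
      = (\<Sum>J\<in>Pow {..<n}. indicator {C. C \<inter> (A \<inter> {x. {i. i < n \<and> x \<in> B i} = J}) \<noteq> {}} C :: ennreal)" for C n
  proof -
    have "(\<Sum>J\<in>Pow {..<n}. indicator {C. C \<inter> (A \<inter> {x. {i. i < n \<and> x \<in> B i} = J}) \<noteq> {}} C :: ennreal)
      = (\<Sum>J\<in>Pow {..<n}. indicator ((\<lambda>x. {i. i < n \<and> x \<in> B i}) ` (C \<inter> A)) J)"
      by (intro sum.cong refl) (auto simp: indicator_def)
    also have "\<dots> = of_nat (card (Pow {..<n} \<inter> (\<lambda>x. {i. i < n \<and> x \<in> B i}) ` (C \<inter> A)))"
      by (simp add: indicator_def sum.If_cases Int_def)
    also have "Pow {..<n} \<inter> (\<lambda>x. {i. i < n \<and> x \<in> B i}) ` (C \<inter> A) = (\<lambda>x. {i. i < n \<and> x \<in> B i}) ` (C \<inter> A)"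
      by auto
    finally show ?thesis by simp
  qed
  have "(\<lambda>C. emeasure (count_space UNIV) (C \<inter> A)) = (\<lambda>C. SUP n. \<Sum>J\<in>Pow {..<n}.
      indicator {C. C \<inter> (A \<inter> {x. {i. i < n \<and> x \<in> B i} = J}) \<noteq> {}} C :: ennreal)"
    by (intro ext, subst count_eq_SUP_keys[of B]) (use sep card_eq in \<open>simp_all only:\<close>)
  also have "\<dots> \<in> borel_measurable config_algebra"
    by (intro borel_measurable_SUP borel_measurable_sum hit) auto
  finally show ?thesis .
qed

text \<open>Half of Renyi's theorem. The law is determined by its void probabilities, so the count may be computed in
  the explicit sample above, where it is the Poisson number of points since these are distinct.\<close>

lemma poisson_law_count:
  fixes \<mu> :: "'x::{second_countable_topology, t2_space} measure"
  assumes P: "poisson_law \<mu> P" and sets: "sets \<mu> = sets borel" and atomless: "\<And>x. emeasure \<mu> {x} = 0"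
    and A: "A \<in> sets borel" and fin: "emeasure \<mu> A < \<infinity>"
  shows "measure P {C. emeasure (count_space UNIV) (C \<inter> A) = of_nat n} = measure \<mu> A ^ n / fact n * exp (- measure \<mu> A)"
proof -
  note PD = poisson_lawD[OF P]
  interpret P: prob_space P by fact
  note count = count_measurable[OF A] and count1 = count_measurable[of "UNIV :: 'x set", simplified]
  have ev: "{C. emeasure (count_space UNIV) (C \<inter> A) = of_nat n} \<in> sets config_algebra" for n
    using measurable_sets[OF count, of "{of_nat n}"] by (simp add: vimage_def)
  have ev1: "{C :: 'x set. emeasure (count_space UNIV) C = of_nat n} \<in> sets config_algebra" for n
    using measurable_sets[OF count1, of "{of_nat n}"] by (simp add: vimage_def)
  show ?thesis
  \<comment> \<open>The explicit sample requires positive mass. On a null set there are almost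
    surely no points, and 0 ^ 0 = 1 supplies the value at n = 0.\<close>
  proof (cases "measure \<mu> A = 0")
    case True
    then have "emeasure \<mu> A = 0"
      using fin by (metis emeasure_eq_ennreal_measure ennreal_0 infinity_ennreal_def less_irrefl)
    then have "P.prob {C. C \<inter> A = {}} = 1"
      using PD(4)[OF A] by simp
    then have ae: "AE C in P. C \<inter> A = {}"
      using void_event_measurable[OF A] PD(2) by (subst (asm) P.prob_eq_1) auto
    have "P.prob {C. emeasure (count_space UNIV) (C \<inter> A) = of_nat n} = P.prob {C. n = 0}"
      using ae ev PD(2,3)
      by (intro P.finite_measure_eq_AE) (auto elim!: eventually_mono intro: sets.top[of config_algebra, simplified])
    then show ?thesis
      using True P.prob_space PD(3) by (cases "n = 0") auto
  next
    case False
    \<comment> \<open>Restriction to A is written as a density so that the measure stays on the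
      Borel sets of the whole space.\<close>
    define \<mu>A where "\<mu>A = density \<mu> (indicator A)"
    have e: "emeasure \<mu>A B = emeasure \<mu> (B \<inter> A)" if "B \<in> sets borel" for B
      using that A sets unfolding \<mu>A_def
      by (subst emeasure_density) (auto simp: indicator_inter_arith[symmetric] mult.commute Int_commute)
    have sp: "space \<mu> = UNIV"
      using sets_eq_imp_space_eq[OF sets] by simp
    have fin_A: "finite_measure \<mu>A"
      using e[of UNIV] fin sp by (intro finite_measureI) (simp add: \<mu>A_def)
    have sets_A: "sets \<mu>A = sets borel"
      by (simp add: \<mu>A_def sets)
    have mA: "measure \<mu>A UNIV = measure \<mu> A"
      using e[of UNIV] by (simp add: measure_def)
    have atomless_A: "\<forall>x. emeasure \<mu>A {x} = 0"
    proof
      fix x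
      have "emeasure \<mu> ({x} \<inter> A) \<le> emeasure \<mu> {x}"
        using sets by (intro emeasure_mono) auto
      then show "emeasure \<mu>A {x} = 0"
        using e[of "{x}"] atomless[of x] by simp
    qed
    have pos_A: "measure \<mu>A UNIV > 0"
      using False mA by (simp add: zero_less_measure_iff)
    show ?thesis
    proof (rule poisson_sample[OF fin_A sets_A pos_A])
      fix M :: "(nat \<times> (nat \<Rightarrow> 'x)) measure"
      assume M: "prob_space M" "fst \<in> M \<rightarrow>\<^sub>M count_space UNIV"
        "\<And>n. measure M {\<omega>\<in>space M. fst \<omega> = n} = measure \<mu>A UNIV ^ n / fact n * exp (- measure \<mu>A UNIV)"
        "(\<lambda>(n, X). X ` {..<n}) \<in> M \<rightarrow>\<^sub>M config_algebra"
        "\<And>A. A \<in> sets borel \<Longrightarrow>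
           measure M {\<omega>\<in>space M. (case \<omega> of (n, X) \<Rightarrow> X ` {..<n}) \<inter> A = {}} = void_prob (emeasure \<mu>A A)"
        "(\<forall>x. emeasure \<mu>A {x} = 0) \<Longrightarrow> AE (n, X) in M. inj_on X {..<n}"
      interpret M: prob_space M by fact
      have eq: "distr P config_algebra (\<lambda>C. C \<inter> A) = distr M config_algebra (\<lambda>(n, X). X ` {..<n})"
        using poisson_law_restrict[OF P A e] poisson_law_distr[OF M(1,4,5)] by (rule poisson_law_unique)
      have "(\<lambda>C. C \<inter> A) \<in> P \<rightarrow>\<^sub>M config_algebra"
        using measurable_restrict_config[OF A] PD(2) by (simp cong: measurable_cong_sets)
      then have "P.prob {C. emeasure (count_space UNIV) (C \<inter> A) = of_nat n}
          = measure (distr P config_algebra (\<lambda>C. C \<inter> A)) {C. emeasure (count_space UNIV) C = of_nat n}"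
        using ev1 PD(3) by (simp add: measure_distr vimage_def)
      also have "\<dots> = M.prob ((\<lambda>(n, X). X ` {..<n}) -` {C. emeasure (count_space UNIV) C = of_nat n} \<inter> space M)"
        unfolding eq using ev1 M(4) by (simp add: measure_distr)
      also have "\<dots> = M.prob {\<omega>\<in>space M. fst \<omega> = n}"
      proof (rule M.finite_measure_eq_AE)
        show "AE \<omega> in M. (\<omega> \<in> (\<lambda>(n, X). X ` {..<n}) -` {C. emeasure (count_space UNIV) C = of_nat n} \<inter> space M)
            \<longleftrightarrow> (\<omega> \<in> {\<omega>\<in>space M. fst \<omega> = n})"
          using M(6)[OF atomless_A] by eventually_elim (auto simp: card_image)
        show "(\<lambda>(n, X). X ` {..<n}) -` {C. emeasure (count_space UNIV) C = of_nat n} \<inter> space M \<in> M.events"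
          using M(4) ev1 by (rule measurable_sets)
        show "{\<omega> \<in> space M. fst \<omega> = n} \<in> M.events"
          using measurable_sets[OF M(2), of "{n}"] by (simp add: vimage_def Int_def conj_commute)
      qed
      finally show ?thesis
        using M(3) mA by simp
    qed
  qed
qed

text \<open>On sets of finite mass increasing to A the count is Poisson with mean tending to
  infinity. It exceeds every fixed n with probability tending to 1, and the count on A is at least
  as large.\<close>

lemma poisson_law_count_infinite:
  fixes \<mu> :: "'x::{second_countable_topology, t2_space} measure"
  assumes P: "poisson_law \<mu> P" and sets: "sets \<mu> = sets borel" and atomless: "\<And>x. emeasure \<mu> {x} = 0"
    and "sigma_finite_measure \<mu>" and A: "A \<in> sets borel" and inf: "emeasure \<mu> A = \<infinity>"
  shows "AE C in P. emeasure (count_space UNIV) (C \<inter> A) = \<infinity>"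
proof -
  note PD = poisson_lawD[OF P]
  interpret P: prob_space P by fact
  interpret sigma_finite_measure \<mu> by fact
  have ev: "{C. emeasure (count_space UNIV) (C \<inter> A) = of_nat n} \<in> P.events" if "A \<in> sets borel" for n and A :: "'x set"
    using measurable_sets[OF count_measurable[OF that], of "{of_nat n}"] PD(2) by (simp add: vimage_def)
  have sp: "space \<mu> = UNIV"
    using sets_eq_imp_space_eq[OF sets] by simp
  obtain S :: "nat \<Rightarrow> 'x set" where S: "range S \<subseteq> sets \<mu>" "(\<Union>i. S i) = space \<mu>"
    "\<And>i. emeasure \<mu> (S i) \<noteq> \<infinity>" "incseq S"
    by (rule sigma_finite_incseq) blast
  have SB: "A \<inter> S k \<in> sets borel" for k
    using S(1) A sets by auto
  have fin: "emeasure \<mu> (A \<inter> S k) < \<infinity>" for k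
  proof -
    have "emeasure \<mu> (A \<inter> S k) \<le> emeasure \<mu> (S k)"
      using S(1) by (intro emeasure_mono) auto
    then show ?thesis
      using S(3)[of k] by (metis infinity_ennreal_def le_less_trans less_top)
  qed
  have "(\<lambda>k. emeasure \<mu> (A \<inter> S k)) \<longlonglongrightarrow> emeasure \<mu> (\<Union>k. A \<inter> S k)"
    using SB S(4) sets by (intro Lim_emeasure_incseq) (auto simp: incseq_def)
  also have "(\<Union>k. A \<inter> S k) = A"
    using S(2) sp by auto
  finally have lim: "(\<lambda>k. emeasure \<mu> (A \<inter> S k)) \<longlonglongrightarrow> \<infinity>"
    using inf by simp
  have mlim: "filterlim (\<lambda>k. measure \<mu> (A \<inter> S k)) at_top sequentially"
    unfolding filterlim_at_top
  proof
    fix z :: real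
    have "\<forall>\<^sub>F k in sequentially. ennreal z < emeasure \<mu> (A \<inter> S k)"
      using order_tendstoD(1)[OF lim, of "ennreal z"] by simp
    then show "\<forall>\<^sub>F k in sequentially. z \<le> measure \<mu> (A \<inter> S k)"
    proof eventually_elim
      case (elim k)
      then have "ennreal z < ennreal (measure \<mu> (A \<inter> S k))"
        using fin[of k] by (subst emeasure_eq_ennreal_measure[symmetric]) auto
      then show ?case
        by (cases "z \<ge> 0") (auto simp: ennreal_less_iff intro: order.trans[OF _ measure_nonneg])
    qed
  qed
  have null: "P.prob {C. emeasure (count_space UNIV) (C \<inter> A) = of_nat n} = 0" for n
  proof -
    have "P.prob {C. emeasure (count_space UNIV) (C \<inter> A) = of_nat n}
        \<le> (\<Sum>j\<le>n. measure \<mu> (A \<inter> S k) ^ j / fact j * exp (- measure \<mu> (A \<inter> S k)))" for k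
    proof -
      have "P.prob {C. emeasure (count_space UNIV) (C \<inter> A) = of_nat n}
          \<le> P.prob (\<Union>j\<in>{..n}. {C. emeasure (count_space UNIV) (C \<inter> (A \<inter> S k)) = of_nat j})"
      proof (rule P.finite_measure_mono)
        show "{C. emeasure (count_space UNIV) (C \<inter> A) = of_nat n}
            \<subseteq> (\<Union>j\<in>{..n}. {C. emeasure (count_space UNIV) (C \<inter> (A \<inter> S k)) = of_nat j})"
        proof clarify
          fix C :: "'x set" assume C: "emeasure (count_space UNIV) (C \<inter> A) = of_nat n"
          then have "finite (C \<inter> A)" "card (C \<inter> A) = n"
            by (cases "finite (C \<inter> A)"; simp)+
          then have "finite (C \<inter> (A \<inter> S k))" "card (C \<inter> (A \<inter> S k)) \<le> n"
            by (auto intro!: card_mono intro: finite_subset[of _ "C \<inter> A"])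
          then show "C \<in> (\<Union>j\<in>{..n}. {C. emeasure (count_space UNIV) (C \<inter> (A \<inter> S k)) = of_nat j})"
            by (intro UN_I[of "card (C \<inter> (A \<inter> S k))"]) simp_all
        qed
      qed (use ev SB in auto)
      also have "\<dots> \<le> (\<Sum>j\<le>n. P.prob {C. emeasure (count_space UNIV) (C \<inter> (A \<inter> S k)) = of_nat j})"
        using ev[OF SB] by (intro P.finite_measure_subadditive_finite) auto
      also have "\<dots> = (\<Sum>j\<le>n. measure \<mu> (A \<inter> S k) ^ j / fact j * exp (- measure \<mu> (A \<inter> S k)))"
        using poisson_law_count[OF P sets atomless SB fin] by simp
      finally show ?thesis .
    qed
    moreover have "(\<lambda>k. \<Sum>j\<le>n. measure \<mu> (A \<inter> S k) ^ j / fact j * exp (- measure \<mu> (A \<inter> S k))) \<longlonglongrightarrow> (\<Sum>j\<le>n. 0 / fact j)"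
    proof (rule tendsto_sum)
      fix j
      have "(\<lambda>k. measure \<mu> (A \<inter> S k) ^ j / exp (measure \<mu> (A \<inter> S k)) / fact j) \<longlonglongrightarrow> 0 / fact j"
        by (intro tendsto_divide tendsto_const filterlim_compose[OF tendsto_power_div_exp_0 mlim]) auto
      then show "(\<lambda>k. measure \<mu> (A \<inter> S k) ^ j / fact j * exp (- measure \<mu> (A \<inter> S k))) \<longlonglongrightarrow> 0 / fact j"
        by (simp add: exp_minus field_simps)
    qed
    ultimately have "P.prob {C. emeasure (count_space UNIV) (C \<inter> A) = of_nat n} \<le> (\<Sum>j\<le>n. 0 / fact j)"
      by (intro LIMSEQ_le_const) auto
    then show ?thesis
      using measure_nonneg[of P "{C. emeasure (count_space UNIV) (C \<inter> A) = of_nat n}"] by simp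
  qed
  have "AE C in P. emeasure (count_space UNIV) (C \<inter> A) \<noteq> of_nat n" for n
    using null[of n] ev[OF A, of n] PD(3) by (subst (asm) P.prob_eq_0) auto
  then have "AE C in P. \<forall>n. emeasure (count_space UNIV) (C \<inter> A) \<noteq> of_nat n"
    by (simp add: AE_all_countable)
  then show ?thesis
  proof eventually_elim
    case (elim C)
    then have "infinite (C \<inter> A)"
      using elim[rule_format, of "card (C \<inter> A)"] by (cases "finite (C \<inter> A)") auto
    then show ?case by simp
  qed
qed

text \<open>Leads from void probabilities to the full definition. Intersecting with S serves
  measures that live on a part of the space, such as the half-space of positive radii: the
  definition demands the inclusion at every sample point, not just almost surely.\<close>

lemma poisson_law_imp_poisson_point_process:
  fixes \<mu> :: "'x::{second_countable_topology, t2_space} measure"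
  assumes P: "poisson_law \<mu> P" and sets: "sets \<mu> = sets borel" and atomless: "\<And>x. emeasure \<mu> {x} = 0"
    and sf: "sigma_finite_measure \<mu>" and S: "S \<in> sets borel"
    and \<mu>': "\<And>A. A \<in> sets \<mu>' \<Longrightarrow> A \<in> sets borel \<and> emeasure \<mu>' A = emeasure \<mu> A" and sp: "space \<mu>' = S"
  shows "poisson_point_process P \<mu>' (\<lambda>C. C \<inter> S)"
proof -
  note PD = poisson_lawD[OF P]
  interpret P: prob_space P by fact
  have eq: "point_count (\<lambda>C. C \<inter> S) A = (\<lambda>C. emeasure (count_space UNIV) (C \<inter> A))" if "A \<in> sets \<mu>'" for A
    using sets.sets_into_space[OF that] sp by (auto simp: point_count_def Int_assoc Int_absorb1)
  show ?thesis
    unfolding poisson_point_process_def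
  proof (intro conjI ballI allI impI)
    show "prob_space P" by fact
    show "C \<inter> S \<subseteq> space \<mu>'" for C
      using sp by auto
    fix A assume A: "A \<in> sets \<mu>'"
    have AB: "A \<in> sets borel" and e: "emeasure \<mu>' A = emeasure \<mu> A"
      using \<mu>'[OF A] by auto
    show "point_count (\<lambda>C. C \<inter> S) A \<in> borel_measurable P"
      unfolding eq[OF A] using count_measurable[OF AB] PD(2) by (simp cong: measurable_cong_sets)
    { assume "emeasure \<mu>' A < \<infinity>"
      then show "\<P>(C in P. point_count (\<lambda>C. C \<inter> S) A C = of_nat n) = measure \<mu>' A ^ n / fact n * exp (- measure \<mu>' A)" for n
        using poisson_law_count[OF P sets atomless AB, of n] e PD(3) by (simp add: eq[OF A] measure_def[of \<mu>'] measure_def[of \<mu>]) }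
    { assume "emeasure \<mu>' A = \<infinity>"
      then show "AE C in P. point_count (\<lambda>C. C \<inter> S) A C = \<infinity>"
        using poisson_law_count_infinite[OF P sets atomless sf AB] e by (simp add: eq[OF A]) }
  next
    fix n and A :: "nat \<Rightarrow> 'x set" assume A: "A ` {..<n} \<subseteq> sets \<mu>'" and disj: "disjoint_family_on A {..<n}"
    have AB: "A i \<in> sets borel" if "i < n" for i
      using that A \<mu>' by auto
    have "P.indep_vars (\<lambda>_. config_algebra) (\<lambda>i C. C \<inter> A i) {..<n}"
      using AB by (intro poisson_law_indep[OF P sets _ disj]) auto
    then have "P.indep_vars (\<lambda>_. borel) (\<lambda>i C. emeasure (count_space UNIV) (C \<inter> A i)) {..<n}"
      by (rule P.indep_vars_compose2[where Y="\<lambda>_ C. emeasure (count_space UNIV) C"])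
        (use count_measurable[of "UNIV :: 'x set"] in simp)
    then show "P.indep_vars (\<lambda>_. borel) (\<lambda>i. point_count (\<lambda>C. C \<inter> S) (A i)) {..<n}"
      by (rule P.indep_vars_cong[THEN iffD1, rotated 3]) (use A eq in auto)
  qed
qed

section \<open>Laws of Boolean models\<close>

text \<open>Radius measures are carried to the whole line: with Borel sets in both factors, the
  intensity of the model has the Borel sigma-algebra, on which \<open>config_algebra\<close>
  rests.\<close>

definition finite_borel :: "real measure \<Rightarrow> bool" where
  "finite_borel \<nu> \<longleftrightarrow> finite_measure \<nu> \<and> sets \<nu> = sets borel"

definition boolean_law :: "real measure \<Rightarrow> ((real ^ 'd) \<times> real) set measure \<Rightarrow> bool" where
  "boolean_law \<nu> P \<longleftrightarrow> poisson_law (lborel \<Otimes>\<^sub>M \<nu>) P"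

text \<open>For a \<open>finite_borel\<close> measure the law exists and is unique, so the choice
  selects it.\<close>

definition blaw :: "real measure \<Rightarrow> ((real ^ 'd::finite) \<times> real) set measure" where
  "blaw \<nu> = (SOME P. boolean_law \<nu> P)"

lemma finite_borelD:
  assumes "finite_borel \<nu>"
  shows "finite_measure \<nu>" "sets \<nu> = sets borel" "space \<nu> = UNIV" "sigma_finite_measure \<nu>"
  using assms sets_eq_imp_space_eq[of \<nu> borel]
  by (auto simp: finite_borel_def intro: finite_measure.sigma_finite_measure)

lemma finite_borel_scale:
  assumes "finite_borel \<nu>"
  shows "finite_borel (scale_measure (ennreal t) \<nu>)"
  using finite_borelD[OF assms] finite_measure.emeasure_finite[OF finite_borelD(1)[OF assms], of UNIV]
  unfolding finite_borel_def
  by (auto intro!: finite_measureI simp: space_scale_measure ennreal_mult_eq_top_iff)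

lemma finite_borel_distr:
  assumes "finite_borel \<nu>" "f \<in> borel_measurable borel"
  shows "finite_borel (distr \<nu> borel f)"
proof -
  have "f \<in> \<nu> \<rightarrow>\<^sub>M borel"
    using assms finite_borelD(2)[OF assms(1)] by (simp cong: measurable_cong_sets)
  then show ?thesis
    using finite_measure.finite_measure_distr[OF finite_borelD(1)[OF assms(1)]] by (simp add: finite_borel_def)
qed

lemma sets_boolean_measure:
  assumes "finite_borel \<nu>"
  shows "sets ((lborel :: (real ^ 'd) measure) \<Otimes>\<^sub>M \<nu>) = sets borel"
  using finite_borelD(2)[OF assms] by (metis borel_prod sets_lborel sets_pair_measure_cong)

lemma sigma_finite_boolean_measure:
  assumes "finite_borel \<nu>"
  shows "sigma_finite_measure ((lborel :: (real ^ 'd) measure) \<Otimes>\<^sub>M \<nu>)"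
proof -
  interpret \<nu>: sigma_finite_measure \<nu> using finite_borelD[OF assms] by simp
  interpret pair_sigma_finite "lborel :: (real ^ 'd) measure" \<nu> ..
  show ?thesis by (rule sigma_finite_measure_axioms)
qed

lemma emeasure_boolean_Times:
  fixes A :: "(real ^ 'd) set"
  assumes "finite_borel \<nu>" "A \<in> sets borel" "B \<in> sets borel"
  shows "emeasure (lborel \<Otimes>\<^sub>M \<nu>) (A \<times> B) = emeasure lborel A * emeasure \<nu> B"
  using assms finite_borelD[OF assms(1)]
  by (intro sigma_finite_measure.emeasure_pair_measure_Times) auto

lemma emeasure_boolean_alt:
  fixes A :: "((real ^ 'd) \<times> real) set"
  assumes "finite_borel \<nu>" "A \<in> sets borel"
  shows "emeasure (lborel \<Otimes>\<^sub>M \<nu>) A = (\<integral>\<^sup>+c. emeasure \<nu> (Pair c -` A) \<partial>lborel)"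
  using assms finite_borelD[OF assms(1)] sets_boolean_measure[OF assms(1), where 'd='d]
  by (intro sigma_finite_measure.emeasure_pair_measure_alt) auto

lemma boolean_measure_atomless:
  assumes "finite_borel \<nu>"
  shows "emeasure (lborel \<Otimes>\<^sub>M \<nu>) {p :: (real ^ 'd) \<times> real} = 0"
  using emeasure_boolean_Times[OF assms, of "{fst p}" "{snd p}"] by simp

lemma boolean_law_blaw:
  assumes "finite_borel \<nu>"
  shows "boolean_law \<nu> (blaw \<nu> :: ((real ^ 'd::finite) \<times> real) set measure)"
proof -
  have "\<exists>P :: ((real ^ 'd) \<times> real) set measure. boolean_law \<nu> P"
    unfolding boolean_law_def
    using sigma_finite_boolean_measure[OF assms] sets_boolean_measure[OF assms] by (rule poisson_law_exists)
  then show ?thesis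
    unfolding blaw_def by (rule someI_ex)
qed

lemma blaw_eqI: "finite_borel \<nu> \<Longrightarrow> boolean_law \<nu> P \<Longrightarrow> P = blaw \<nu>"
  using boolean_law_blaw[of \<nu>] unfolding boolean_law_def by (metis poisson_law_unique)

lemma
  assumes "finite_borel \<nu>"
  shows prob_space_blaw: "prob_space (blaw \<nu> :: ((real ^ 'd::finite) \<times> real) set measure)"
    and sets_blaw: "sets (blaw \<nu> :: ((real ^ 'd::finite) \<times> real) set measure) = sets config_algebra"
    and space_blaw: "space (blaw \<nu> :: ((real ^ 'd::finite) \<times> real) set measure) = UNIV"
  using poisson_lawD(1-3)[OF boolean_law_blaw[OF assms, unfolded boolean_law_def]] by auto

lemma void_blaw:
  fixes A :: "((real ^ 'd::finite) \<times> real) set"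
  assumes "finite_borel \<nu>" "A \<in> sets borel"
  shows "measure (blaw \<nu>) {C. C \<inter> A = {}} = void_prob (emeasure (lborel \<Otimes>\<^sub>M \<nu>) A)"
  using poisson_lawD(4)[OF boolean_law_blaw[OF assms(1), unfolded boolean_law_def] assms(2)] .

lemma hit_blaw:
  fixes A :: "((real ^ 'd::finite) \<times> real) set"
  assumes "finite_borel \<nu>" "A \<in> sets borel"
  shows "measure (blaw \<nu>) {C. C \<inter> A \<noteq> {}} = 1 - void_prob (emeasure (lborel \<Otimes>\<^sub>M \<nu>) A)"
proof -
  interpret prob_space "blaw \<nu> :: ((real ^ 'd) \<times> real) set measure" by (rule prob_space_blaw[OF assms(1)])
  have "{C. C \<inter> A \<noteq> {}} = space (blaw \<nu>) - {C. C \<inter> A = {}}"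
    using space_blaw[OF assms(1), where 'd='d] by auto
  then show ?thesis
    using prob_compl[of "{C. C \<inter> A = {}}"] void_event_measurable[OF assms(2)] sets_blaw[OF assms(1), where 'd='d]
      void_blaw[OF assms] by (simp only:)
qed

lemma void_prob_ge: "1 - void_prob (ennreal x) \<le> x" if "0 \<le> x"
  using that exp_ge_add_one_self[of "-x"] by simp

text \<open>First-moment bound: a set is hit with probability at most the mean number of points in
  it.\<close>

lemma hit_blaw_le:
  fixes A :: "((real ^ 'd::finite) \<times> real) set"
  assumes "finite_borel \<nu>" "A \<in> sets borel" "emeasure (lborel \<Otimes>\<^sub>M \<nu>) A \<le> ennreal x" "0 \<le> x"
  shows "measure (blaw \<nu>) {C. C \<inter> A \<noteq> {}} \<le> x"
  using hit_blaw[OF assms(1,2)] void_prob_antimono[OF assms(3)] void_prob_ge[OF assms(4)] by linarith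

section \<open>Crossing events\<close>

lemma joined_in_mono: "joined_in S A B \<Longrightarrow> S \<subseteq> T \<Longrightarrow> joined_in T A B"
  unfolding joined_in_def by blast

lemma covered_region_mono: "C \<subseteq> D \<Longrightarrow> covered_region C \<subseteq> covered_region D"
  unfolding covered_region_def by blast

lemma joined_in_translate_scale:
  fixes S :: "'a::real_normed_vector set"
  assumes "joined_in S A B"
  shows "joined_in ((\<lambda>x. v + k *\<^sub>R x) ` S) ((\<lambda>x. v + k *\<^sub>R x) ` A) ((\<lambda>x. v + k *\<^sub>R x) ` B)"
proof -
  obtain g where g: "path g" "path_image g \<subseteq> S" "pathstart g \<in> A" "pathfinish g \<in> B"
    using assms unfolding joined_in_def by blast
  have "path ((\<lambda>x. v + k *\<^sub>R x) \<circ> g)"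
    using g(1) by (intro path_continuous_image continuous_intros)
  moreover have "path_image ((\<lambda>x. v + k *\<^sub>R x) \<circ> g) \<subseteq> (\<lambda>x. v + k *\<^sub>R x) ` S"
    unfolding path_image_compose using g(2) by blast
  ultimately show ?thesis
    unfolding joined_in_def using g(3,4)
    by (intro exI[of _ "(\<lambda>x. v + k *\<^sub>R x) \<circ> g"]) (auto simp: pathstart_compose pathfinish_compose)
qed

lemma image_sphere:
  fixes x v :: "'a::real_normed_vector"
  assumes "k > 0"
  shows "(\<lambda>x. v + k *\<^sub>R x) ` sphere x s = sphere (v + k *\<^sub>R x) (k * s)"
proof -
  have "y \<in> (\<lambda>x. v + k *\<^sub>R x) ` sphere x s" if "y \<in> sphere (v + k *\<^sub>R x) (k * s)" for y
  proof (rule image_eqI)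
    show "y = v + k *\<^sub>R ((y - v) /\<^sub>R k)"
      using assms by simp
    have "x - (y - v) /\<^sub>R k = ((v + k *\<^sub>R x) - y) /\<^sub>R k"
      using assms by (simp add: algebra_simps)
    then show "(y - v) /\<^sub>R k \<in> sphere x s"
      using that assms by (simp add: dist_norm)
  qed
  moreover have "dist (v + k *\<^sub>R x) (v + k *\<^sub>R y) = k * dist x y" for y
    using assms by (simp add: dist_norm real_vector.scale_right_diff_distrib[symmetric])
  ultimately show ?thesis
    by auto
qed

lemma covered_region_image:
  fixes v :: "real ^ 'd"
  assumes "k > 0"
  shows "covered_region ((\<lambda>(c, r). (v + k *\<^sub>R c, k * r)) ` C) = (\<lambda>x. v + k *\<^sub>R x) ` covered_region C"
proof -
  have "ball (v + k *\<^sub>R c) (k * r) = (\<lambda>x. v + k *\<^sub>R x) ` ball c r" for c :: "real ^ 'd" and r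
  proof -
    have "ball (v + k *\<^sub>R c) (k * r) = (\<lambda>x. v + x) ` ((\<lambda>x. k *\<^sub>R x) ` ball c r)"
      using assms by (simp add: ball_translation add.commute ball_scale)
    then show ?thesis by (simp add: image_image)
  qed
  then show ?thesis
    by (simp add: covered_region_def image_UN split_beta)
qed

text \<open>Every ball of \<open>C\<close> is the union of the rational balls lying strictly inside it, and a path meets
  only finitely many of these. Hence a crossing only depends on whether \<open>C\<close> meets some of countably many
  open cones.\<close>

lemma joined_in_measurable:
  "{C. joined_in (covered_region C) A (B :: (real ^ 'd) set)} \<in> sets config_algebra"
proof -
  obtain D :: "(real ^ 'd) set" where D: "countable D" "\<And>U. open U \<Longrightarrow> U \<noteq> {} \<Longrightarrow> \<exists>d\<in>D. d \<in> U"
    using countable_dense_setE by blast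
  define Q where "Q = D \<times> (\<rat> :: real set)"
  have "countable Q"
    unfolding Q_def using D(1) countable_rat by auto
  \<comment> \<open>The open cone of pairs (c, r) whose ball contains the ball coded by b with a
    positive margin.\<close>
  define K :: "(real ^ 'd) \<times> real \<Rightarrow> ((real ^ 'd) \<times> real) set"
    where "K = (\<lambda>(c', r'). {(c, r). dist c c' < r - r'})"
  have K: "K b \<in> sets borel" for b
  proof -
    have "open {p :: (real ^ 'd) \<times> real. dist (fst p) (fst b) < snd p - snd b}"
      by (intro open_Collect_less continuous_intros)
    moreover have "{p. dist (fst p) (fst b) < snd p - snd b} = K b"
      by (auto simp: K_def split_beta)
    ultimately show ?thesis by auto
  qed
  have region: "covered_region C = (\<Union>b\<in>{b\<in>Q. C \<inter> K b \<noteq> {}}. ball (fst b) (snd b))" for C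
  proof (intro set_eqI iffI)
    fix x assume "x \<in> covered_region C"
    then obtain c r where cr: "(c, r) \<in> C" "dist c x < r"
      by (auto simp: covered_region_def)
    \<comment> \<open>A third of the room around x: the rational ball has its centre within e of x
      and a radius between e and 2 e, so it contains x and keeps a margin inside the ball about
      c.\<close>
    define e where "e = (r - dist c x) / 3"
    have "e > 0" using cr by (simp add: e_def)
    then obtain c' where c': "c' \<in> D" "dist x c' < e"
      using D(2)[of "ball x e"] by auto
    obtain r' where r': "r' \<in> \<rat>" "e < r'" "r' < 2 * e"
      using Rats_dense_in_real[of e "2 * e"] \<open>e > 0\<close> by auto
    have "dist c c' \<le> dist c x + dist x c'"
      by (rule dist_triangle)
    then have "dist c c' < r - r'"
      using c'(2) r'(3) by (simp add: e_def)
    then have "(c, r) \<in> C \<inter> K (c', r')"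
      using cr by (simp add: K_def)
    moreover have "x \<in> ball c' r'"
      using c'(2) r'(2) by (simp add: dist_commute)
    ultimately show "x \<in> (\<Union>b\<in>{b\<in>Q. C \<inter> K b \<noteq> {}}. ball (fst b) (snd b))"
      using c'(1) r'(1) by (intro UN_I[of "(c', r')"]) (auto simp: Q_def)
  next
    fix x assume "x \<in> (\<Union>b\<in>{b\<in>Q. C \<inter> K b \<noteq> {}}. ball (fst b) (snd b))"
    then obtain b c r where b: "(c, r) \<in> C" "(c, r) \<in> K b" "x \<in> ball (fst b) (snd b)"
      by auto
    then have "dist c (fst b) < r - snd b" "dist (fst b) x < snd b"
      by (auto simp: K_def split_beta)
    then have "dist c x < r"
      using dist_triangle[of c x "fst b"] by linarith
    then show "x \<in> covered_region C"
      using b(1) by (force simp: covered_region_def)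
  qed
  have "{C. joined_in (covered_region C) A B}
      = (\<Union>F\<in>{F. finite F \<and> F \<subseteq> Q \<and> joined_in (covered_region F) A B}. {C. \<forall>b\<in>F. C \<inter> K b \<noteq> {}})"
  proof (intro set_eqI iffI)
    fix C assume "C \<in> {C. joined_in (covered_region C) A B}"
    then obtain g where g: "path g" "path_image g \<subseteq> covered_region C" "pathstart g \<in> A" "pathfinish g \<in> B"
      unfolding joined_in_def by blast
    \<comment> \<open>Compactness reduces the choice of rational balls to finite subsets of the
      countable set Q, which keeps the union countable.\<close>
    have "compact (path_image g)"
      using g(1) by (rule compact_path_image)
    then obtain F where F: "F \<subseteq> {b\<in>Q. C \<inter> K b \<noteq> {}}" "finite F" "path_image g \<subseteq> (\<Union>b\<in>F. ball (fst b) (snd b))"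
      by (rule compactE_image[of _ "{b\<in>Q. C \<inter> K b \<noteq> {}}" "\<lambda>b. ball (fst b) (snd b)"])
        (use g(2) region in auto)
    have "joined_in (covered_region F) A B"
      unfolding joined_in_def covered_region_def using g F(3) by (auto simp: split_beta)
    then show "C \<in> (\<Union>F\<in>{F. finite F \<and> F \<subseteq> Q \<and> joined_in (covered_region F) A B}. {C. \<forall>b\<in>F. C \<inter> K b \<noteq> {}})"
      using F by auto
  next
    fix C assume "C \<in> (\<Union>F\<in>{F. finite F \<and> F \<subseteq> Q \<and> joined_in (covered_region F) A B}. {C. \<forall>b\<in>F. C \<inter> K b \<noteq> {}})"
    then obtain F where F: "F \<subseteq> Q" "joined_in (covered_region F) A B" "\<forall>b\<in>F. C \<inter> K b \<noteq> {}"
      by auto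
    have "covered_region F = (\<Union>b\<in>F. ball (fst b) (snd b))"
      by (auto simp: covered_region_def split_beta)
    also have "\<dots> \<subseteq> covered_region C"
      unfolding region using F by auto
    finally show "C \<in> {C. joined_in (covered_region C) A B}"
      using joined_in_mono[OF F(2)] by simp
  qed
  also have "\<dots> \<in> sets config_algebra"
  proof (rule sets.countable_UN'')
    show "countable {F. finite F \<and> F \<subseteq> Q \<and> joined_in (covered_region F) A B}"
      using countable_Collect_finite_subset[OF \<open>countable Q\<close>] by (rule countable_subset[rotated]) auto
    fix F assume "F \<in> {F. finite F \<and> F \<subseteq> Q \<and> joined_in (covered_region F) A B}"
    then have "finite F" by simp
    have "{C. \<forall>b\<in>F. C \<inter> K b \<noteq> {}} = (\<Inter>b\<in>F. {C. C \<inter> K b \<noteq> {}})"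
      by auto
    also have "\<dots> \<in> sets config_algebra"
      using sets.top[of config_algebra] \<open>finite F\<close> hit_event_measurable[OF K]
      by (cases "F = {}") (auto intro!: sets.finite_INT)
    finally show "{C. \<forall>b\<in>F. C \<inter> K b \<noteq> {}} \<in> sets config_algebra" .
  qed
  finally show ?thesis .
qed

text \<open>The centre x is free so that crossings can be considered around all points of a
  net.\<close>

definition crossing :: "real ^ 'd \<Rightarrow> real \<Rightarrow> ((real ^ 'd) \<times> real) set set" where
  "crossing x s = {C. joined_in (covered_region C) (sphere x (s / 2)) (sphere x s)}"

definition annulus_prob :: "'d::finite itself \<Rightarrow> real measure \<Rightarrow> real \<Rightarrow> real" where
  "annulus_prob _ \<nu> s = measure (blaw \<nu>) (crossing (0 :: real ^ 'd) s)"

lemma crossing_measurable: "crossing x s \<in> sets config_algebra"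
  unfolding crossing_def by (rule joined_in_measurable)

section \<open>Affine images, superposition and monotonicity\<close>

lemma measurable_affine_pair:
  "(\<lambda>(c, r). (v + k *\<^sub>R c, l * r)) \<in> borel \<rightarrow>\<^sub>M (borel :: ((real ^ 'd) \<times> real) measure)"
  unfolding split_beta by (intro borel_measurable_continuous_onI continuous_intros)

text \<open>Fubini over the centres, where the affine substitution contributes the factor
  \<open>k ^ CARD('d)\<close>. Centres and radii have separate factors k and l: l = k is a
  homothety, while k = 1 changes the radii alone.\<close>

lemma emeasure_boolean_affine:
  fixes v :: "real ^ 'd"
  assumes \<nu>: "finite_borel \<nu>" and k: "k > 0" and A: "A \<in> sets borel"
  shows "emeasure (lborel \<Otimes>\<^sub>M distr \<nu> borel ((*) l)) A
    = ennreal (k ^ CARD('d)) * emeasure (lborel \<Otimes>\<^sub>M \<nu>) ((\<lambda>(c, r). (v + k *\<^sub>R c, l * r)) -` A)"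
proof -
  have \<nu>': "finite_borel (distr \<nu> borel ((*) l))"
    using \<nu> by (intro finite_borel_distr) auto
  have slice: "Pair c -` A \<in> sets borel" for c
    using A by (rule sets_Pair1[of A borel borel, unfolded borel_prod])
  have A': "(\<lambda>(c, r). (v + k *\<^sub>R c, l * r)) -` A \<in> sets borel"
    using A measurable_sets[OF measurable_affine_pair[of v k l], of A] by simp
  have m: "(*) l \<in> \<nu> \<rightarrow>\<^sub>M borel"
    using finite_borelD(2)[OF \<nu>] by (simp cong: measurable_cong_sets)
  have "A \<in> sets ((lborel :: (real ^ 'd) measure) \<Otimes>\<^sub>M distr \<nu> borel ((*) l))"
    using A sets_boolean_measure[OF \<nu>', where 'd='d] by simp
  then have meas: "(\<lambda>c. emeasure (distr \<nu> borel ((*) l)) (Pair c -` A)) \<in> borel_measurable lborel"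
    using finite_borelD(4)[OF \<nu>'] by (intro sigma_finite_measure.measurable_emeasure_Pair)
  have "emeasure (lborel \<Otimes>\<^sub>M distr \<nu> borel ((*) l)) A
      = (\<integral>\<^sup>+c. emeasure (distr \<nu> borel ((*) l)) (Pair c -` A) \<partial>lborel)"
    using \<nu>' A by (rule emeasure_boolean_alt)
  also have "\<dots> = (\<integral>\<^sup>+c. emeasure (distr \<nu> borel ((*) l)) (Pair c -` A)
      \<partial>density (distr lborel borel (\<lambda>x. v + k *\<^sub>R x)) (\<lambda>_. ennreal (\<bar>k\<bar> ^ DIM(real ^ 'd))))"
    using k by (subst lborel_affine[of k v]) auto
  also have "\<dots> = ennreal (k ^ CARD('d)) * (\<integral>\<^sup>+c. emeasure (distr \<nu> borel ((*) l)) (Pair (v + k *\<^sub>R c) -` A) \<partial>lborel)"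
    using meas k by (simp add: nn_integral_density nn_integral_distr nn_integral_cmult)
  also have "(\<integral>\<^sup>+c. emeasure (distr \<nu> borel ((*) l)) (Pair (v + k *\<^sub>R c) -` A) \<partial>lborel)
      = (\<integral>\<^sup>+c. emeasure \<nu> (Pair c -` ((\<lambda>(c, r). (v + k *\<^sub>R c, l * r)) -` A)) \<partial>lborel)"
    using m slice finite_borelD(3)[OF \<nu>] by (simp add: emeasure_distr vimage_def)
  also have "\<dots> = emeasure (lborel \<Otimes>\<^sub>M \<nu>) ((\<lambda>(c, r). (v + k *\<^sub>R c, l * r)) -` A)"
    using \<nu> A' by (rule emeasure_boolean_alt[symmetric])
  finally show ?thesis .
qed

lemma emeasure_boolean_scale:
  fixes A :: "((real ^ 'd) \<times> real) set"
  assumes \<nu>: "finite_borel \<nu>" and A: "A \<in> sets borel"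
  shows "emeasure (lborel \<Otimes>\<^sub>M scale_measure (ennreal t) \<nu>) A = ennreal t * emeasure (lborel \<Otimes>\<^sub>M \<nu>) A"
proof -
  have "A \<in> sets ((lborel :: (real ^ 'd) measure) \<Otimes>\<^sub>M \<nu>)"
    using A sets_boolean_measure[OF \<nu>, where 'd='d] by simp
  then have "(\<lambda>c. emeasure \<nu> (Pair c -` A)) \<in> borel_measurable lborel"
    using finite_borelD(4)[OF \<nu>] by (intro sigma_finite_measure.measurable_emeasure_Pair)
  then show ?thesis
    using \<nu> A finite_borel_scale[OF \<nu>] by (simp add: emeasure_boolean_alt nn_integral_cmult)
qed

lemma distr_blaw_affine:
  fixes v :: "real ^ 'd"
  assumes \<nu>: "finite_borel \<nu>" and \<nu>': "finite_borel \<nu>'" and k: "k > 0"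
    and eq: "scale_measure (ennreal (k ^ CARD('d))) \<nu>' = distr \<nu> borel ((*) l)"
  shows "distr (blaw \<nu>) config_algebra (\<lambda>C. (\<lambda>(c, r). (v + k *\<^sub>R c, l * r)) ` C) = blaw \<nu>'"
proof (rule blaw_eqI[OF \<nu>'])
  show "boolean_law \<nu>' (distr (blaw \<nu>) config_algebra (\<lambda>C. (\<lambda>(c, r). (v + k *\<^sub>R c, l * r)) ` C))"
    unfolding boolean_law_def
  proof (rule poisson_law_image[OF boolean_law_blaw[OF \<nu>, unfolded boolean_law_def]])
    show "(\<lambda>(c, r). (v + k *\<^sub>R c, l * r)) \<in> borel \<rightarrow>\<^sub>M (borel :: ((real ^ 'd) \<times> real) measure)"
      by (rule measurable_affine_pair)
    fix A :: "((real ^ 'd) \<times> real) set" assume A: "A \<in> sets borel"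
    have "ennreal (k ^ CARD('d)) * emeasure (lborel \<Otimes>\<^sub>M \<nu>') A
      = ennreal (k ^ CARD('d)) * emeasure (lborel \<Otimes>\<^sub>M \<nu>) ((\<lambda>(c, r). (v + k *\<^sub>R c, l * r)) -` A)"
      using emeasure_boolean_affine[OF \<nu> k A, of l v] emeasure_boolean_scale[OF \<nu>' A, of "k ^ CARD('d)"] eq
      by simp
    then show "emeasure (lborel \<Otimes>\<^sub>M \<nu>') A = emeasure (lborel \<Otimes>\<^sub>M \<nu>) ((\<lambda>(c, r). (v + k *\<^sub>R c, l * r)) -` A)"
      using k by (subst (asm) ennreal_mult_cancel_left) auto
  qed
qed

lemma measure_blaw_image:
  fixes f :: "(real ^ 'd) \<times> real \<Rightarrow> (real ^ 'd) \<times> real"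
  assumes "finite_borel \<nu>" "distr (blaw \<nu>) config_algebra (\<lambda>C. f ` C) = blaw \<nu>'" "f \<in> borel \<rightarrow>\<^sub>M borel"
    "E \<in> sets config_algebra"
  shows "measure (blaw \<nu>') E = measure (blaw \<nu>) {C. f ` C \<in> E}"
proof -
  have "(\<lambda>C. f ` C) \<in> blaw \<nu> \<rightarrow>\<^sub>M config_algebra"
    using measurable_image_config[OF assms(3)] sets_blaw[OF assms(1), where 'd='d] by (simp cong: measurable_cong_sets)
  then show ?thesis
    using assms(4) space_blaw[OF assms(1), where 'd='d]
    by (simp add: assms(2)[symmetric] measure_distr vimage_def)
qed

text \<open>An affine map with k > 0 has an affine inverse, so paths can be transported in both
  directions.\<close>

lemma crossing_image:
  assumes "k > 0"
  shows "(\<lambda>(c, r). (v + k *\<^sub>R c, k * r)) ` C \<in> crossing (v + k *\<^sub>R x) (k * s) \<longleftrightarrow> C \<in> crossing x s"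
proof -
  let ?f = "\<lambda>x. v + k *\<^sub>R x" and ?h = "\<lambda>x. (- (inverse k *\<^sub>R v)) + inverse k *\<^sub>R x"
  have hf: "?h (?f x) = x" for x
    using assms by (simp add: algebra_simps)
  have "joined_in (?f ` S) (?f ` A) (?f ` B) \<longleftrightarrow> joined_in S A B" for S A B
  proof
    assume "joined_in (?f ` S) (?f ` A) (?f ` B)"
    then have "joined_in (?h ` ?f ` S) (?h ` ?f ` A) (?h ` ?f ` B)"
      by (rule joined_in_translate_scale)
    then show "joined_in S A B"
      unfolding image_image hf by simp
  qed (rule joined_in_translate_scale)
  from this[of "covered_region C" "sphere x (s / 2)" "sphere x s"] show ?thesis
    using assms by (simp add: crossing_def covered_region_image image_sphere)
qed

lemma distr_id_borel: "sets \<nu> = sets borel \<Longrightarrow> distr \<nu> borel ((*) (1 :: real)) = \<nu>"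
  using distr_id2[of borel \<nu>] by (metis (no_types, lifting) distr_cong mult_1)

lemma crossing_prob_translate:
  fixes x :: "real ^ 'd"
  assumes \<nu>: "finite_borel \<nu>"
  shows "measure (blaw \<nu>) (crossing x s) = annulus_prob TYPE('d) \<nu> s"
proof -
  let ?f = "\<lambda>(c, r). (x + 1 *\<^sub>R c, 1 * r) :: (real ^ 'd) \<times> real"
  have "distr (blaw \<nu>) config_algebra (\<lambda>C. ?f ` C) = blaw \<nu>"
    using \<nu> finite_borelD(2)[OF \<nu>] by (intro distr_blaw_affine) (auto simp: distr_id_borel scale_measure_1)
  from measure_blaw_image[OF \<nu> this measurable_affine_pair crossing_measurable]
  have "measure (blaw \<nu>) (crossing x s) = measure (blaw \<nu>) {C. ?f ` C \<in> crossing x s}" .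
  also have "{C. ?f ` C \<in> crossing x s} = crossing 0 s"
    using crossing_image[of 1 x _ 0 s] by simp
  finally show ?thesis
    by (simp add: annulus_prob_def)
qed

text \<open>A homothety of ratio k carries the model driven by \<open>\<nu>\<close> to the one
  driven by \<open>\<nu>'\<close>: radii are multiplied by k and the density of centres is divided
  by k^d. Crossings at scale s / k become crossings at scale s.\<close>

lemma annulus_prob_scale:
  assumes \<nu>: "finite_borel \<nu>" and \<nu>': "finite_borel \<nu>'" and k: "k > 0"
    and eq: "scale_measure (ennreal (k ^ CARD('d::finite))) \<nu>' = distr \<nu> borel ((*) k)"
  shows "annulus_prob TYPE('d) \<nu>' s = annulus_prob TYPE('d) \<nu> (s / k)"
proof -
  let ?f = "\<lambda>(c, r). (0 + k *\<^sub>R c, k * r) :: (real ^ 'd) \<times> real"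
  have "distr (blaw \<nu>) config_algebra (\<lambda>C. ?f ` C) = blaw \<nu>'"
    using assms by (intro distr_blaw_affine)
  from measure_blaw_image[OF \<nu> this measurable_affine_pair crossing_measurable]
  have "measure (blaw \<nu>') (crossing (0 :: real ^ 'd) s) = measure (blaw \<nu>) {C. ?f ` C \<in> crossing 0 s}" .
  also have "{C. ?f ` C \<in> crossing 0 s} = crossing (0 :: real ^ 'd) (s / k)"
    using crossing_image[of k 0 _ 0 "s / k"] k by auto
  finally show ?thesis
    by (simp add: annulus_prob_def)
qed

lemma blaw_union:
  assumes \<nu>1: "finite_borel \<nu>1" and \<nu>2: "finite_borel \<nu>2" and \<nu>: "finite_borel \<nu>"
    and eq: "\<And>A. A \<in> sets borel \<Longrightarrow> emeasure \<nu> A = emeasure \<nu>1 A + emeasure \<nu>2 A"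
  shows "blaw \<nu> = distr (blaw \<nu>1 \<Otimes>\<^sub>M blaw \<nu>2) config_algebra (\<lambda>(C, D). C \<union> (D :: ((real ^ 'd::finite) \<times> real) set))"
proof (rule blaw_eqI[OF \<nu>, symmetric])
  show "boolean_law \<nu> (distr (blaw \<nu>1 \<Otimes>\<^sub>M blaw \<nu>2) config_algebra (\<lambda>(C, D). C \<union> (D :: ((real ^ 'd) \<times> real) set)))"
    unfolding boolean_law_def
  proof (rule poisson_law_union[OF boolean_law_blaw[OF \<nu>1, unfolded boolean_law_def]
        boolean_law_blaw[OF \<nu>2, unfolded boolean_law_def]])
    fix A :: "((real ^ 'd) \<times> real) set" assume A: "A \<in> sets borel"
    then have m: "A \<in> sets (lborel \<Otimes>\<^sub>M \<nu>1)" "A \<in> sets (lborel \<Otimes>\<^sub>M \<nu>2)"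
      using sets_boolean_measure[OF \<nu>1, where 'd='d] sets_boolean_measure[OF \<nu>2, where 'd='d] by simp_all
    have "Pair c -` A \<in> sets borel" for c
      using A by (rule sets_Pair1[of A borel borel, unfolded borel_prod])
    then show "emeasure (lborel \<Otimes>\<^sub>M \<nu>) A = emeasure (lborel \<Otimes>\<^sub>M \<nu>1) A + emeasure (lborel \<Otimes>\<^sub>M \<nu>2) A"
      using \<nu>1 \<nu>2 \<nu> A eq m finite_borelD(4)[OF \<nu>1] finite_borelD(4)[OF \<nu>2]
      by (simp add: emeasure_boolean_alt nn_integral_add sigma_finite_measure.measurable_emeasure_Pair)
  qed
qed

lemma
  assumes "finite_borel \<nu>1" "finite_borel \<nu>2"
  shows measurable_fst_blaw: "fst \<in> blaw \<nu>1 \<Otimes>\<^sub>M blaw \<nu>2 \<rightarrow>\<^sub>M (config_algebra :: ((real ^ 'd::finite) \<times> real) set measure)"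
    and measurable_snd_blaw: "snd \<in> blaw \<nu>1 \<Otimes>\<^sub>M blaw \<nu>2 \<rightarrow>\<^sub>M (config_algebra :: ((real ^ 'd::finite) \<times> real) set measure)"
proof -
  note [measurable_cong] = sets_blaw[OF assms(1), where 'd='d] sets_blaw[OF assms(2), where 'd='d]
  show "fst \<in> blaw \<nu>1 \<Otimes>\<^sub>M blaw \<nu>2 \<rightarrow>\<^sub>M (config_algebra :: ((real ^ 'd) \<times> real) set measure)"
    "snd \<in> blaw \<nu>1 \<Otimes>\<^sub>M blaw \<nu>2 \<rightarrow>\<^sub>M (config_algebra :: ((real ^ 'd) \<times> real) set measure)"
    by measurable
qed

lemma
  assumes "finite_borel \<nu>1" "finite_borel \<nu>2" "E \<in> sets (config_algebra :: ((real ^ 'd::finite) \<times> real) set measure)"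
  shows measure_blaw_fst: "measure (blaw \<nu>1 \<Otimes>\<^sub>M blaw \<nu>2) {\<omega> :: _ \<times> ((real ^ 'd) \<times> real) set. fst \<omega> \<in> E} = measure (blaw \<nu>1) E"
    and measure_blaw_snd: "measure (blaw \<nu>1 \<Otimes>\<^sub>M blaw \<nu>2) {\<omega> :: ((real ^ 'd) \<times> real) set \<times> _. snd \<omega> \<in> E} = measure (blaw \<nu>2) E"
    and fst_event_measurable: "{\<omega> :: _ \<times> ((real ^ 'd) \<times> real) set. fst \<omega> \<in> E} \<in> sets (blaw \<nu>1 \<Otimes>\<^sub>M blaw \<nu>2)"
    and snd_event_measurable: "{\<omega> :: ((real ^ 'd) \<times> real) set \<times> _. snd \<omega> \<in> E} \<in> sets (blaw \<nu>1 \<Otimes>\<^sub>M blaw \<nu>2)"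
proof -
  let ?P = "blaw \<nu>1 :: ((real ^ 'd) \<times> real) set measure" and ?Q = "blaw \<nu>2 :: ((real ^ 'd) \<times> real) set measure"
  interpret P: prob_space ?P using assms by (simp add: prob_space_blaw)
  interpret Q: prob_space ?Q using assms by (simp add: prob_space_blaw)
  have f: "{\<omega>. fst \<omega> \<in> E} = E \<times> space ?Q" and s: "{\<omega>. snd \<omega> \<in> E} = space ?P \<times> E"
    using assms by (auto simp: space_blaw)
  have E: "E \<in> sets ?P" "E \<in> sets ?Q"
    using assms by (simp_all add: sets_blaw)
  show "measure (?P \<Otimes>\<^sub>M ?Q) {\<omega>. fst \<omega> \<in> E} = measure ?P E" "{\<omega>. fst \<omega> \<in> E} \<in> sets (?P \<Otimes>\<^sub>M ?Q)"
    unfolding f using E P.emeasure_space_1 Q.emeasure_space_1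
    by (simp_all add: measure_def Q.emeasure_pair_measure_Times)
  show "measure (?P \<Otimes>\<^sub>M ?Q) {\<omega>. snd \<omega> \<in> E} = measure ?Q E" "{\<omega>. snd \<omega> \<in> E} \<in> sets (?P \<Otimes>\<^sub>M ?Q)"
    unfolding s using E P.emeasure_space_1 Q.emeasure_space_1
    by (simp_all add: measure_def Q.emeasure_pair_measure_Times)
qed

lemma measure_blaw_union:
  assumes "finite_borel \<nu>1" "finite_borel \<nu>2" "finite_borel \<nu>" "E \<in> sets config_algebra"
    and "\<And>A. A \<in> sets borel \<Longrightarrow> emeasure \<nu> A = emeasure \<nu>1 A + emeasure \<nu>2 A"
  shows "measure (blaw \<nu>) E = measure (blaw \<nu>1 \<Otimes>\<^sub>M blaw \<nu>2) {(C, D :: ((real ^ 'd::finite) \<times> real) set). C \<union> D \<in> E}"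
    and "{(C, D :: ((real ^ 'd::finite) \<times> real) set). C \<union> D \<in> E} \<in> sets (blaw \<nu>1 \<Otimes>\<^sub>M blaw \<nu>2)"
proof -
  have m: "(\<lambda>(C, D). C \<union> D) \<in> blaw \<nu>1 \<Otimes>\<^sub>M blaw \<nu>2 \<rightarrow>\<^sub>M (config_algebra :: ((real ^ 'd) \<times> real) set measure)"
    unfolding case_prod_beta'
    by (intro measurable_union_config measurable_fst_blaw measurable_snd_blaw assms)
  have "space (blaw \<nu>1 \<Otimes>\<^sub>M blaw \<nu>2) = (UNIV :: (((real ^ 'd) \<times> real) set \<times> ((real ^ 'd) \<times> real) set) set)"
    by (simp add: space_pair_measure space_blaw[OF assms(1)] space_blaw[OF assms(2)])
  then have eq: "(\<lambda>(C, D :: ((real ^ 'd) \<times> real) set). C \<union> D) -` E \<inter> space (blaw \<nu>1 \<Otimes>\<^sub>M blaw \<nu>2) = {(C, D). C \<union> D \<in> E}"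
    by (simp add: vimage_def case_prod_beta')
  show "{(C, D). C \<union> D \<in> E} \<in> sets (blaw \<nu>1 \<Otimes>\<^sub>M blaw \<nu>2)"
    using measurable_sets[OF m assms(4)] eq by simp
  have "measure (blaw \<nu>) E = measure (distr (blaw \<nu>1 \<Otimes>\<^sub>M blaw \<nu>2) config_algebra (\<lambda>(C, D). C \<union> D)) E"
    using blaw_union[OF assms(1-3,5)] by (rule arg_cong[of _ _ "\<lambda>M. measure M E"])
  also have "\<dots> = measure (blaw \<nu>1 \<Otimes>\<^sub>M blaw \<nu>2) {(C, D). C \<union> D \<in> E}"
    unfolding eq[symmetric] by (rule measure_distr[OF m assms(4)])
  finally show "measure (blaw \<nu>) E = measure (blaw \<nu>1 \<Otimes>\<^sub>M blaw \<nu>2) {(C, D). C \<union> D \<in> E}" .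
qed

text \<open>Coupling: the model of \<open>\<nu>\<close> arises by adding to the process of
  \<open>\<nu>1\<close> an independent one for \<open>\<nu>2\<close>. This is why domination of
  measures is expressed throughout by exhibiting a complement.\<close>

lemma annulus_prob_mono:
  assumes "finite_borel \<nu>1" "finite_borel \<nu>2" "finite_borel \<nu>"
    and "\<And>A. A \<in> sets borel \<Longrightarrow> emeasure \<nu> A = emeasure \<nu>1 A + emeasure \<nu>2 A"
  shows "annulus_prob TYPE('d::finite) \<nu>1 s \<le> annulus_prob TYPE('d) \<nu> s"
proof -
  let ?P = "blaw \<nu>1 :: ((real ^ 'd) \<times> real) set measure" and ?Q = "blaw \<nu>2 :: ((real ^ 'd) \<times> real) set measure"
  interpret P: prob_space ?P using assms by (simp add: prob_space_blaw)
  interpret Q: prob_space ?Q using assms by (simp add: prob_space_blaw)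
  interpret PQ: pair_prob_space ?P ?Q ..
  have "measure ?P (crossing 0 s) = measure (?P \<Otimes>\<^sub>M ?Q) {\<omega>. fst \<omega> \<in> crossing 0 s}"
    using assms crossing_measurable by (intro measure_blaw_fst[symmetric]) auto
  also have "\<dots> \<le> measure (?P \<Otimes>\<^sub>M ?Q) {(C, D). C \<union> D \<in> crossing 0 s}"
  proof (rule PQ.finite_measure_mono)
    show "{\<omega>. fst \<omega> \<in> crossing 0 s} \<subseteq> {(C, D). C \<union> D \<in> crossing (0 :: real ^ 'd) s}"
      by (auto simp: crossing_def intro: joined_in_mono[OF _ covered_region_mono])
    show "{(C, D). C \<union> D \<in> crossing (0 :: real ^ 'd) s} \<in> PQ.events"
      using assms(1-3) crossing_measurable assms(4) by (rule measure_blaw_union(2))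
  qed
  also have "\<dots> = measure (blaw \<nu>) (crossing (0 :: real ^ 'd) s)"
    using assms(1-3) crossing_measurable assms(4) by (rule measure_blaw_union(1)[symmetric])
  finally show ?thesis
    by (simp add: annulus_prob_def)
qed

section \<open>Passage between the open half-line and the real line\<close>

definition extend_to_reals :: "real measure \<Rightarrow> real measure" where
  "extend_to_reals \<nu> = distr \<nu> borel (\<lambda>r. r)"

lemma radius_measureD:
  assumes "radius_measure \<nu>"
  shows "sets \<nu> = sets (restrict_space borel {0<..})" "space \<nu> = {0<..}" "finite_measure \<nu>"
    "(\<lambda>r. r) \<in> \<nu> \<rightarrow>\<^sub>M borel"
proof -
  show s: "sets \<nu> = sets (restrict_space borel {0<..})" and "finite_measure \<nu>"
    using assms by (simp_all add: radius_measure_def)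
  show "space \<nu> = {0<..}"
    using sets_eq_imp_space_eq[OF s] by (simp add: space_restrict_space)
  show "(\<lambda>r. r) \<in> \<nu> \<rightarrow>\<^sub>M borel"
    using s by (simp cong: measurable_cong_sets add: measurable_restrict_space1)
qed

lemma finite_borel_extend:
  assumes "radius_measure \<nu>"
  shows "finite_borel (extend_to_reals \<nu>)"
  unfolding finite_borel_def extend_to_reals_def
  using finite_measure.finite_measure_distr[OF radius_measureD(3,4)[OF assms]] by simp

lemma emeasure_extend:
  assumes "radius_measure \<nu>" "A \<in> sets borel"
  shows "emeasure (extend_to_reals \<nu>) A = emeasure \<nu> (A \<inter> {0<..})"
  unfolding extend_to_reals_def
  using radius_measureD(2,4)[OF assms(1)] assms(2) by (simp add: emeasure_distr)

lemma boolean_intensity_sets: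
  assumes \<nu>: "radius_measure \<nu>" and A: "A \<in> sets (boolean_intensity \<nu> :: ((real ^ 'd::finite) \<times> real) measure)"
  shows "A \<in> sets borel"
proof -
  have sub: "B \<in> sets borel" if "B \<in> sets \<nu>" for B
    using that unfolding radius_measureD(1)[OF \<nu>] by (auto simp: sets_restrict_space)
  have sp: "UNIV \<times> {0<..} \<in> sets (borel :: ((real ^ 'd) \<times> real) measure)"
    unfolding borel_prod[symmetric] by simp
  have "A \<in> sigma_sets (UNIV \<times> {0<..}) {a \<times> b | a b. a \<in> sets (borel :: (real ^ 'd) measure) \<and> b \<in> sets \<nu>}"
    using A radius_measureD(2)[OF \<nu>] by (simp add: boolean_intensity_def sets_pair_measure)
  then show ?thesis
  proof (induction rule: sigma_sets.induct)
    case (Basic a)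
    then show ?case
      using sub by (auto simp: borel_prod[symmetric])
  next
    case (Compl a)
    then show ?case using sp by blast
  next
    case (Union a)
    then show ?case by blast
  qed auto
qed

lemma emeasure_extend_boolean:
  fixes A :: "((real ^ 'd::finite) \<times> real) set"
  assumes \<nu>: "radius_measure \<nu>" and A: "A \<in> sets borel"
  shows "A \<inter> (UNIV \<times> {0<..}) \<in> sets (boolean_intensity \<nu>)"
    and "emeasure (lborel \<Otimes>\<^sub>M extend_to_reals \<nu>) A = emeasure (boolean_intensity \<nu>) (A \<inter> (UNIV \<times> {0<..}))"
proof -
  have sp: "space (boolean_intensity \<nu>) = (UNIV :: (real ^ 'd) set) \<times> {0<..}"
    using radius_measureD(2)[OF \<nu>] by (simp add: boolean_intensity_def space_pair_measure)
  have "snd \<in> (lborel :: (real ^ 'd) measure) \<Otimes>\<^sub>M \<nu> \<rightarrow>\<^sub>M borel"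
    by (rule measurable_compose[OF measurable_snd radius_measureD(4)[OF \<nu>]])
  then have "(\<lambda>p. (fst p, snd p)) \<in> (lborel :: (real ^ 'd) measure) \<Otimes>\<^sub>M \<nu> \<rightarrow>\<^sub>M borel \<Otimes>\<^sub>M borel"
    by (intro measurable_Pair) auto
  then have "(\<lambda>p. p) \<in> (boolean_intensity \<nu> :: ((real ^ 'd) \<times> real) measure) \<rightarrow>\<^sub>M borel"
    by (simp add: boolean_intensity_def borel_prod)
  from measurable_sets[OF this A] show m: "A \<inter> (UNIV \<times> {0<..}) \<in> sets (boolean_intensity \<nu>)"
    using sp by simp
  have slice: "Pair c -` A \<in> sets borel" for c
    using A by (rule sets_Pair1[of A borel borel, unfolded borel_prod])
  have "emeasure (lborel \<Otimes>\<^sub>M extend_to_reals \<nu>) A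
      = (\<integral>\<^sup>+c. emeasure (extend_to_reals \<nu>) (Pair c -` A) \<partial>lborel)"
    using finite_borel_extend[OF \<nu>] A by (rule emeasure_boolean_alt)
  also have "\<dots> = (\<integral>\<^sup>+c. emeasure \<nu> (Pair c -` (A \<inter> (UNIV \<times> {0<..}))) \<partial>lborel)"
    by (simp add: emeasure_extend[OF \<nu> slice] vimage_Int)
  also have "\<dots> = emeasure (boolean_intensity \<nu>) (A \<inter> (UNIV \<times> {0<..}))"
    using m finite_measure.sigma_finite_measure[OF radius_measureD(3)[OF \<nu>]] unfolding boolean_intensity_def
    by (intro sigma_finite_measure.emeasure_pair_measure_alt[symmetric])
  finally show "emeasure (lborel \<Otimes>\<^sub>M extend_to_reals \<nu>) A
    = emeasure (boolean_intensity \<nu>) (A \<inter> (UNIV \<times> {0<..}))" .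
qed

text \<open>Every Poisson process in the sense of the definition has the prescribed void
  probabilities, hence the law \<open>blaw\<close>. The realisation selected in
  \<open>subcritical\<close> is therefore immaterial.\<close>

lemma crossing_prob_eq_annulus_prob:
  fixes \<xi> :: "'w \<Rightarrow> ((real ^ 'd::finite) \<times> real) set"
  assumes \<nu>: "radius_measure \<nu>" and ppp: "poisson_point_process M (boolean_intensity \<nu>) \<xi>"
  shows "crossing_prob M \<xi> r = annulus_prob TYPE('d) (extend_to_reals \<nu>) r"
proof -
  let ?\<mu> = "boolean_intensity \<nu> :: ((real ^ 'd) \<times> real) measure"
  let ?S = "(UNIV :: (real ^ 'd) set) \<times> {0<..} :: ((real ^ 'd) \<times> real) set"
  interpret M: prob_space M
    using ppp by (simp add: poisson_point_process_def)
  have sp: "space ?\<mu> = ?S"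
    using radius_measureD(2)[OF \<nu>] by (simp add: boolean_intensity_def space_pair_measure)
  have sub: "\<xi> \<omega> \<subseteq> ?S" if "\<omega> \<in> space M" for \<omega>
    using ppp that sp by (simp add: poisson_point_process_def)
  \<comment> \<open>All points have positive radius, so A may be replaced by its part in the
    half-space, where counts are defined.\<close>
  have void: "{\<omega>\<in>space M. \<xi> \<omega> \<inter> A = {}} = {\<omega>\<in>space M. point_count \<xi> (A \<inter> ?S) \<omega> = of_nat 0}" for A
  proof (rule Collect_cong, rule conj_cong[OF refl])
    fix \<omega> assume "\<omega> \<in> space M"
    then have "\<xi> \<omega> \<inter> A = \<xi> \<omega> \<inter> (A \<inter> ?S)"
      using sub by blast
    then show "\<xi> \<omega> \<inter> A = {} \<longleftrightarrow> point_count \<xi> (A \<inter> ?S) \<omega> = of_nat 0"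
      by (simp only: point_count_def of_nat_0 emeasure_count_space_eq_0 top_greatest subset_UNIV)
        (simp add: emeasure_count_space_eq_0)
  qed
  have meas: "point_count \<xi> (A \<inter> ?S) \<in> borel_measurable M" if "A \<in> sets borel" for A
    using ppp emeasure_extend_boolean(1)[OF \<nu> that] by (simp add: poisson_point_process_def)
  have \<xi>: "\<xi> \<in> M \<rightarrow>\<^sub>M config_algebra"
  proof (rule measurable_config_algebraI)
    fix A :: "((real ^ 'd) \<times> real) set" assume "A \<in> sets borel"
    from measurable_sets[OF meas[OF this], of "{of_nat 0}"]
    show "{\<omega> \<in> space M. \<xi> \<omega> \<inter> A = {}} \<in> M.events"
      unfolding void by (simp add: vimage_def Int_def conj_commute)
  qed
  have "boolean_law (extend_to_reals \<nu>) (distr M config_algebra \<xi>)"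
    unfolding boolean_law_def
  proof (rule poisson_law_distr[OF M.prob_space_axioms \<xi>])
    fix A :: "((real ^ 'd) \<times> real) set" assume A: "A \<in> sets borel"
    note AS = emeasure_extend_boolean[OF \<nu> A]
    show "measure M {\<omega> \<in> space M. \<xi> \<omega> \<inter> A = {}} = void_prob (emeasure (lborel \<Otimes>\<^sub>M extend_to_reals \<nu>) A)"
    proof (cases "emeasure ?\<mu> (A \<inter> ?S) < \<infinity>")
      case True
      then have "\<P>(\<omega> in M. point_count \<xi> (A \<inter> ?S) \<omega> = of_nat 0)
          = measure ?\<mu> (A \<inter> ?S) ^ 0 / fact 0 * exp (- measure ?\<mu> (A \<inter> ?S))"
        using ppp AS(1) unfolding poisson_point_process_def by blast
      then show ?thesis
        unfolding void AS(2) using True by (simp add: void_prob_def measure_def)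
    next
      case False
      then have inf: "emeasure ?\<mu> (A \<inter> ?S) = \<infinity>"
        by (simp add: less_top[symmetric])
      \<comment> \<open>An infinite count is nonzero, in agreement with \<open>void_prob\<close>
        being 0 at infinity.\<close>
      then have "AE \<omega> in M. point_count \<xi> (A \<inter> ?S) \<omega> = \<infinity>"
        using ppp AS(1) unfolding poisson_point_process_def by blast
      then have "AE \<omega> in M. \<not> point_count \<xi> (A \<inter> ?S) \<omega> = of_nat 0"
        by eventually_elim simp
      then have "\<P>(\<omega> in M. point_count \<xi> (A \<inter> ?S) \<omega> = of_nat 0) = 0"
        using meas[OF A] by (subst M.prob_eq_0) auto
      then show ?thesis
        unfolding void AS(2) inf by (simp add: void_prob_def)
    qed
  qed
  then have "distr M config_algebra \<xi> = blaw (extend_to_reals \<nu>)"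
    using blaw_eqI[OF finite_borel_extend[OF \<nu>]] by blast
  then have "annulus_prob TYPE('d) (extend_to_reals \<nu>) r = measure (distr M config_algebra \<xi>) (crossing 0 r)"
    by (simp add: annulus_prob_def)
  also have "\<dots> = measure M (\<xi> -` crossing 0 r \<inter> space M)"
    using \<xi> crossing_measurable by (rule measure_distr)
  also have "\<xi> -` crossing 0 r \<inter> space M
      = {\<omega> \<in> space M. joined_in (covered_region (\<xi> \<omega>)) (sphere 0 (r / 2)) (sphere 0 r)}"
    by (auto simp: crossing_def)
  finally show ?thesis
    by (simp add: crossing_prob_def)
qed

lemma subcritical_iff:
  assumes \<nu>: "radius_measure \<nu>"
  shows "subcritical TYPE('d::finite) \<nu> \<longleftrightarrow> (annulus_prob TYPE('d) (extend_to_reals \<nu>) \<longlongrightarrow> 0) at_top"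
proof
  assume "subcritical TYPE('d) \<nu>"
  then obtain M and \<xi> :: "_ \<Rightarrow> ((real ^ 'd) \<times> real) set" where ppp: "poisson_point_process M (boolean_intensity \<nu>) \<xi>"
    and lim: "(crossing_prob (M :: ((real ^ 'd) \<times> real) set measure) \<xi> \<longlongrightarrow> 0) at_top"
    unfolding subcritical_def by blast
  have "crossing_prob M \<xi> = annulus_prob TYPE('d) (extend_to_reals \<nu>)"
    using crossing_prob_eq_annulus_prob[OF \<nu> ppp] by blast
  then show "(annulus_prob TYPE('d) (extend_to_reals \<nu>) \<longlongrightarrow> 0) at_top"
    using lim by simp
next
  assume lim: "(annulus_prob TYPE('d) (extend_to_reals \<nu>) \<longlongrightarrow> 0) at_top"
  note fb = finite_borel_extend[OF \<nu>]
  let ?S = "(UNIV :: (real ^ 'd) set) \<times> {0<..} :: ((real ^ 'd) \<times> real) set"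
  \<comment> \<open>The canonical realisation on the space of configurations. Points of nonpositive
    radius, almost surely absent, are removed to meet the inclusion demanded at every sample
    point.\<close>
  have ppp: "poisson_point_process (blaw (extend_to_reals \<nu>)) (boolean_intensity \<nu>) (\<lambda>C. C \<inter> ?S)"
  proof (rule poisson_law_imp_poisson_point_process[OF boolean_law_blaw[OF fb, unfolded boolean_law_def]
        sets_boolean_measure[OF fb] boolean_measure_atomless[OF fb] sigma_finite_boolean_measure[OF fb]])
    show "?S \<in> sets borel"
      unfolding borel_prod[symmetric] by simp
    show sp: "space (boolean_intensity \<nu>) = ?S"
      using radius_measureD(2)[OF \<nu>] by (simp add: boolean_intensity_def space_pair_measure)
    fix A :: "((real ^ 'd) \<times> real) set" assume A: "A \<in> sets (boolean_intensity \<nu>)"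
    then have "A \<inter> ?S = A"
      using sets.sets_into_space[OF A] sp by auto
    then show "A \<in> sets borel \<and> emeasure (boolean_intensity \<nu>) A = emeasure (lborel \<Otimes>\<^sub>M extend_to_reals \<nu>) A"
      using boolean_intensity_sets[OF \<nu> A] emeasure_extend_boolean(2)[OF \<nu>, of A]
      by (simp only: simp_thms)
  qed
  have "crossing_prob (blaw (extend_to_reals \<nu>)) (\<lambda>C. C \<inter> ?S) = annulus_prob TYPE('d) (extend_to_reals \<nu>)"
    using crossing_prob_eq_annulus_prob[OF \<nu> ppp] by blast
  then show "subcritical TYPE('d) \<nu>"
    unfolding subcritical_def using ppp lim by metis
qed

section \<open>Cutting paths and localising crossings\<close>

text \<open>The intermediate value theorem twice: it yields a time at distance a, and then a later
  one at distance b.\<close>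

lemma joined_in_spheres:
  fixes x :: "'a::real_normed_vector"
  assumes g: "path g" "path_image g \<subseteq> S" and start: "dist x (pathstart g) \<le> a" and fin: "b \<le> dist x (pathfinish g)"
    and ab: "a \<le> b"
  shows "joined_in S (sphere x a) (sphere x b)"
proof -
  have cont: "continuous_on {0..1} (\<lambda>t. dist x (g t))"
    using g(1) unfolding path_def by (intro continuous_intros)
  obtain t1 where t1: "0 \<le> t1" "t1 \<le> 1" "dist x (g t1) = a"
    using IVT'[of "\<lambda>t. dist x (g t)" 0 a 1] cont start fin ab by (auto simp: pathstart_def pathfinish_def)
  have "continuous_on {t1..1} (\<lambda>t. dist x (g t))"
    by (rule continuous_on_subset[OF cont]) (use t1 in auto)
  then obtain t2 where t2: "t1 \<le> t2" "t2 \<le> 1" "dist x (g t2) = b"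
    using IVT'[of "\<lambda>t. dist x (g t)" t1 b 1] t1 fin ab by (auto simp: pathfinish_def)
  show ?thesis
    unfolding joined_in_def
  proof (intro exI conjI)
    show "path (subpath t1 t2 g)"
      using g(1) t1 t2 by (intro path_subpath) auto
    show "path_image (subpath t1 t2 g) \<subseteq> S"
      using path_image_subpath_subset[of t1 t2 g] t1 t2 g(2) by auto
  qed (use t1 t2 in \<open>auto simp: pathstart_subpath pathfinish_subpath\<close>)
qed

lemma path_truncate_ball:
  fixes x :: "'a::euclidean_space"
  assumes g: "path g" and start: "dist x (pathstart g) < s" and fin: "s \<le> dist x (pathfinish g)"
  obtains h where "path h" "path_image h \<subseteq> path_image g \<inter> cball x s" "pathstart h = pathstart g"
    "dist x (pathfinish h) = s"
proof -
  have s: "0 < s"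
    using start zero_le_dist[of x "pathstart g"] by linarith
  have "pathstart g \<in> closure (ball x s)" "pathfinish g \<notin> ball x s"
    using start fin closure_subset[of "ball x s"] by auto
  then obtain h where h: "path h" "path_image h \<subseteq> path_image g" "pathstart h = pathstart g"
    "path_image h - {pathfinish h} \<subseteq> interior (ball x s)" "pathfinish h \<in> frontier (ball x s)"
    using exists_path_subpath_to_frontier[OF g] by metis
  have "dist x (pathfinish h) = s"
    using h(5) s by simp
  moreover have "path_image h \<subseteq> cball x s"
    using h(4) \<open>dist x (pathfinish h) = s\<close> by force
  ultimately show thesis
    using that h by blast
qed

text \<open>Stopping the path when it reaches distance s keeps the crossing in a closed ball, so
  that only the balls of the model that meet it matter.\<close>

lemma joined_in_annulus:
  fixes x :: "'a::euclidean_space"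
  assumes g: "path g" "path_image g \<subseteq> S" and start: "dist x (pathstart g) \<le> s / 2" and fin: "s \<le> dist x (pathfinish g)"
    and s: "0 < s"
  shows "joined_in (S \<inter> cball x s) (sphere x (s / 2)) (sphere x s)"
proof -
  have "dist x (pathstart g) < s"
    using start s by linarith
  then obtain h where "path h" "path_image h \<subseteq> path_image g \<inter> cball x s" "pathstart h = pathstart g"
    "dist x (pathfinish h) = s"
    using path_truncate_ball[OF g(1) _ fin] by blast
  then show ?thesis
    using g(2) start s by (intro joined_in_spheres[of h]) auto
qed

text \<open>A fixed ball of radius K is covered once and the net is rescaled by s, so its
  cardinality is the same for all s.\<close>

lemma finite_net:
  obtains X :: "'a::euclidean_space set" where "finite X"
    "\<And>s y. 0 < s \<Longrightarrow> norm y \<le> K * s \<Longrightarrow> \<exists>x\<in>X. dist (s *\<^sub>R x) y < s / 2"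
proof -
  have "compact (cball (0 :: 'a) K)" by simp
  then obtain X :: "'a set" where X: "finite X" "cball 0 K \<subseteq> (\<Union>x\<in>X. ball x (1 / 2))"
    by (rule compactE_image[of _ "cball 0 K" "\<lambda>x. ball x (1 / 2)"]) auto
  have "\<exists>x\<in>X. dist (s *\<^sub>R x) y < s / 2" if "0 < s" "norm y \<le> K * s" for s y
  proof -
    have "y /\<^sub>R s \<in> cball 0 K"
      using that by (simp add: field_simps)
    then have "y /\<^sub>R s \<in> (\<Union>x\<in>X. ball x (1 / 2))"
      using X(2) by blast
    then obtain x where x: "x \<in> X" "dist x (y /\<^sub>R s) < 1 / 2"
      by auto
    have "s *\<^sub>R x - y = s *\<^sub>R (x - y /\<^sub>R s)"
      using that by (simp add: algebra_simps)
    then have "dist (s *\<^sub>R x) y = s * dist x (y /\<^sub>R s)"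
      using that by (simp add: dist_norm)
    also have "\<dots> < s * (1 / 2)"
      using x(2) that by (intro mult_strict_left_mono)
    finally show ?thesis
      using x(1) by auto
  qed
  then show thesis
    using that X(1) by blast
qed

lemma crossing_mono: "C \<in> crossing x s \<Longrightarrow> C \<subseteq> D \<Longrightarrow> D \<in> crossing x s"
  unfolding crossing_def using joined_in_mono covered_region_mono by blast

lemma annulus_prob_nonneg [simp]: "0 \<le> annulus_prob TYPE('d::finite) \<nu> s"
  by (simp add: annulus_prob_def)

text \<open>A crossing at scale r starts near a net point s x and ends at distance at least r / 2
  \<ge> 3 s / 2 from its start, so it crosses at scale s around that point; N is the size of the
  net. The bound fills the gaps between the geometric scales of the renormalisation.\<close>

lemma annulus_prob_compare:
  "\<exists>N. \<forall>\<nu> s r. finite_borel \<nu> \<and> 0 < s \<and> 3 * s \<le> r \<and> r \<le> K * s \<longrightarrow>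
     annulus_prob TYPE('d::finite) \<nu> r \<le> N * annulus_prob TYPE('d) \<nu> s"
proof -
  obtain X :: "(real ^ 'd) set" where X: "finite X"
    "\<And>s y. 0 < s \<Longrightarrow> norm y \<le> K * s \<Longrightarrow> \<exists>x\<in>X. dist (s *\<^sub>R x) y < s / 2"
    using finite_net[of K] by blast
  have "annulus_prob TYPE('d) \<nu> r \<le> card X * annulus_prob TYPE('d) \<nu> s"
    if \<nu>: "finite_borel \<nu>" and s: "0 < s" and r: "3 * s \<le> r" "r \<le> K * s" for \<nu> s r
  proof -
    interpret P: prob_space "blaw \<nu> :: ((real ^ 'd) \<times> real) set measure"
      by (rule prob_space_blaw[OF \<nu>])
    have ev: "crossing x s \<in> P.events" for x s
      using crossing_measurable sets_blaw[OF \<nu>, where 'd='d] by simp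
    have "crossing 0 r \<subseteq> (\<Union>x\<in>X. crossing (s *\<^sub>R x) s)"
    proof
      fix C assume "C \<in> crossing (0 :: real ^ 'd) r"
      then obtain g where g: "path g" "path_image g \<subseteq> covered_region C" "norm (pathstart g) = r / 2" "norm (pathfinish g) = r"
        by (auto simp: crossing_def joined_in_def)
      have "r / 2 \<le> K * s"
        using r s by linarith
      then obtain x where x: "x \<in> X" "dist (s *\<^sub>R x) (pathstart g) < s / 2"
        using X(2)[OF s, of "pathstart g"] g(3) by auto
      have "r / 2 \<le> dist (pathstart g) (pathfinish g)"
        using g(3,4) norm_triangle_ineq2[of "pathfinish g" "pathstart g"] by (simp add: dist_norm norm_minus_commute)
      then have "s \<le> dist (s *\<^sub>R x) (pathfinish g)"
        using x(2) r dist_triangle[of "pathstart g" "pathfinish g" "s *\<^sub>R x"] by (simp add: dist_commute)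
      then have "C \<in> crossing (s *\<^sub>R x) s"
        unfolding crossing_def using g(1,2) x(2) s by (auto intro!: joined_in_spheres[of g])
      then show "C \<in> (\<Union>x\<in>X. crossing (s *\<^sub>R x) s)"
        using x(1) by blast
    qed
    then have "P.prob (crossing 0 r) \<le> P.prob (\<Union>x\<in>X. crossing (s *\<^sub>R x) s)"
      using ev X(1) by (intro P.finite_measure_mono) auto
    also have "\<dots> \<le> (\<Sum>x\<in>X. P.prob (crossing (s *\<^sub>R x) s))"
      using ev X(1) by (intro P.finite_measure_subadditive_finite) auto
    also have "\<dots> = card X * annulus_prob TYPE('d) \<nu> s"
      by (simp add: crossing_prob_translate[OF \<nu>])
    finally show ?thesis
      by (simp add: annulus_prob_def)
  qed
  then show ?thesis by blast
qed

section \<open>Large balls\<close>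

text \<open>For s > 0 this is, up to factors depending only on d, the mean number of balls of radius
  at least s that meet the ball of radius s about the origin.\<close>

definition moment_tail :: "nat \<Rightarrow> real measure \<Rightarrow> real \<Rightarrow> ennreal" where
  "moment_tail d \<nu> s = (\<integral>\<^sup>+r. ennreal (r ^ d) * indicator {s..} r \<partial>\<nu>)"

lemma emeasure_boolean_alt2:
  fixes A :: "((real ^ 'd) \<times> real) set"
  assumes "finite_borel \<nu>" "A \<in> sets borel"
  shows "emeasure (lborel \<Otimes>\<^sub>M \<nu>) A = (\<integral>\<^sup>+r. emeasure lborel {c. (c, r) \<in> A} \<partial>\<nu>)"
proof -
  interpret \<nu>: sigma_finite_measure \<nu> using finite_borelD[OF assms(1)] by simp
  interpret pair_sigma_finite "lborel :: (real ^ 'd) measure" \<nu> ..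
  show ?thesis
    using emeasure_pair_measure_alt2[of A] assms(2) sets_boolean_measure[OF assms(1), where 'd='d]
    by (simp add: vimage_def)
qed

lemma ball_volume:
  "0 \<le> r \<Longrightarrow> emeasure lborel (ball (c :: real ^ 'd) r) = ennreal (unit_ball_vol (real CARD('d)) * r ^ CARD('d))"
  using emeasure_ball[of r c] by simp

lemma open_ball_family:
  "open {(c, r). norm (c :: real ^ 'd) < a + k * r}"
proof -
  have "{(c, r). norm (c :: real ^ 'd) < a + k * r} = {p. norm (fst p) < a + k * snd p}"
    by auto
  also have "open \<dots>"
    by (intro open_Collect_less continuous_intros)
  finally show ?thesis .
qed

lemma measurable_ball_family:
  assumes "B \<in> sets borel"
  shows "{(c, r). norm (c :: real ^ 'd) < a + k * r \<and> r \<in> B} \<in> sets borel"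
proof -
  have "{(c, r). norm (c :: real ^ 'd) < a + k * r \<and> r \<in> B} = {(c, r). norm (c :: real ^ 'd) < a + k * r} \<inter> (UNIV \<times> B)"
    by auto
  also have "\<dots> \<in> sets borel"
  proof (rule sets.Int)
    show "{(c, r). norm (c :: real ^ 'd) < a + k * r} \<in> sets borel"
      using open_ball_family by (rule borel_open)
    show "(UNIV :: (real ^ 'd) set) \<times> B \<in> sets borel"
      using assms unfolding borel_prod[symmetric] by (intro pair_measureI) auto
  qed
  finally show ?thesis .
qed

text \<open>For r \<ge> s the admissible centres lie within (a + 1) r of the origin; integrating
  this volume over r gives the moment.\<close>

lemma emeasure_big_balls:
  assumes \<nu>: "finite_borel \<nu>" and s: "0 < s" and a: "0 \<le> a"
  shows "emeasure (lborel \<Otimes>\<^sub>M \<nu>) {(c, r). norm (c :: real ^ 'd) < a * s + 1 * r \<and> r \<in> {s..}}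
    \<le> ennreal (unit_ball_vol (real CARD('d)) * (a + 1) ^ CARD('d)) * moment_tail CARD('d) \<nu> s"
proof -
  let ?V = "unit_ball_vol (real CARD('d))"
  have "emeasure (lborel \<Otimes>\<^sub>M \<nu>) {(c, r). norm (c :: real ^ 'd) < a * s + 1 * r \<and> r \<in> {s..}}
      = (\<integral>\<^sup>+r. emeasure lborel {c :: real ^ 'd. norm c < a * s + r \<and> r \<in> {s..}} \<partial>\<nu>)"
    using emeasure_boolean_alt2[OF \<nu> measurable_ball_family[of "{s..}" "a * s" 1]] by simp
  also have "\<dots> \<le> (\<integral>\<^sup>+r. ennreal (?V * (a + 1) ^ CARD('d)) * (ennreal (r ^ CARD('d)) * indicator {s..} r) \<partial>\<nu>)"
  proof (rule nn_integral_mono)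
    fix r
    show "emeasure lborel {c :: real ^ 'd. norm c < a * s + r \<and> r \<in> {s..}}
        \<le> ennreal (?V * (a + 1) ^ CARD('d)) * (ennreal (r ^ CARD('d)) * indicator {s..} r)"
    proof (cases "s \<le> r")
      case True
      then have r: "0 \<le> r" and le: "a * s + r \<le> (a + 1) * r"
        using s a mult_left_mono[of s r a] by (auto simp: algebra_simps)
      have "{c :: real ^ 'd. norm c < a * s + r \<and> r \<in> {s..}} \<subseteq> ball 0 ((a + 1) * r)"
        using le by auto
      then have "emeasure lborel {c :: real ^ 'd. norm c < a * s + r \<and> r \<in> {s..}} \<le> emeasure lborel (ball (0 :: real ^ 'd) ((a + 1) * r))"
        by (intro emeasure_mono) auto
      also have "\<dots> = ennreal (?V * (a + 1) ^ CARD('d)) * ennreal (r ^ CARD('d))"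
        using r a by (simp add: ball_volume power_mult_distrib ennreal_mult[symmetric] mult.assoc)
      finally show ?thesis
        using True by simp
    qed simp
  qed
  also have "\<dots> = ennreal (?V * (a + 1) ^ CARD('d)) * moment_tail CARD('d) \<nu> s"
    unfolding moment_tail_def using finite_borelD(2)[OF \<nu>]
    by (intro nn_integral_cmult) (simp cong: measurable_cong_sets)
  finally show ?thesis .
qed

text \<open>One step of renormalisation. A crossing at scale \<open>16 s\<close> produces two crossings at scale \<open>s\<close>, near the
  inner and near the outer sphere; unless a ball of radius at least \<open>s\<close> intervenes, these are
  witnessed by disjoint, hence independent, parts of the process.\<close>

lemma annulus_prob_renormalise:
  "\<exists>K\<ge>1. \<forall>\<nu> s t. finite_borel \<nu> \<and> 0 < s \<and> 0 \<le> t \<and> moment_tail CARD('d::finite) \<nu> s \<le> ennreal t \<longrightarrow>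
     annulus_prob TYPE('d) \<nu> (16 * s) \<le> K * (annulus_prob TYPE('d) \<nu> s)\<^sup>2 + K * t"
proof -
  obtain X :: "(real ^ 'd) set" where X: "finite X"
    "\<And>s y. 0 < s \<Longrightarrow> norm y \<le> 16 * s \<Longrightarrow> \<exists>x\<in>X. dist (s *\<^sub>R x) y < s / 2"
    using finite_net[of 16] by blast
  \<comment> \<open>The net points used have norm at most 17 s, so a ball of radius r that meets the
    closed ball of radius s about one of them has its centre within 18 s + r of the origin.\<close>
  define V where "V = unit_ball_vol (real CARD('d)) * (18 + 1) ^ CARD('d)"
  have V: "0 \<le> V" by (simp add: V_def)
  define K where "K = max 1 (max ((real (card X))\<^sup>2) V)"
  have "annulus_prob TYPE('d) \<nu> (16 * s) \<le> K * (annulus_prob TYPE('d) \<nu> s)\<^sup>2 + K * t"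
    if \<nu>: "finite_borel \<nu>" and s: "0 < s" and t: "0 \<le> t" "moment_tail CARD('d) \<nu> s \<le> ennreal t" for \<nu> s t
  proof -
    interpret P: prob_space "blaw \<nu> :: ((real ^ 'd) \<times> real) set measure"
      by (rule prob_space_blaw[OF \<nu>])
    have sets_P: "P.events = sets config_algebra"
      by (rule sets_blaw[OF \<nu>])
    let ?\<pi> = "annulus_prob TYPE('d) \<nu> s"
    define B :: "((real ^ 'd) \<times> real) set" where "B = {(c, r). norm c < 18 * s + 1 * r \<and> r \<in> {s..}}"
    have B: "B \<in> sets borel"
      unfolding B_def by (rule measurable_ball_family) simp
    \<comment> \<open>A ball of radius below s that meets the closed ball of radius s about x has
      its centre within 2 s of x.\<close>
    define L :: "real ^ 'd \<Rightarrow> ((real ^ 'd) \<times> real) set" where "L x = ball x (2 * s) \<times> {..<s}" for x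
    have L: "L x \<in> sets borel" for x
      unfolding L_def borel_prod[symmetric] by simp
    define E where "E x = {C. C \<inter> L x \<in> crossing x s}" for x
    have E: "E x \<in> P.events" for x
      using measurable_sets[OF measurable_restrict_config[OF L] crossing_measurable, of x x s]
      by (simp add: E_def sets_P vimage_def)
    define X1 where "X1 = {x\<in>X. \<exists>y. norm y = 8 * s \<and> dist (s *\<^sub>R x) y < s / 2}"
    define X2 where "X2 = {x\<in>X. \<exists>y. norm y = 16 * s \<and> dist (s *\<^sub>R x) y < s / 2}"
    have fin: "finite X1" "finite X2" and X12: "X1 \<subseteq> X" "X2 \<subseteq> X"
      using X(1) by (auto simp: X1_def X2_def)
    have E_le: "P.prob (E x) \<le> ?\<pi>" for x
    proof -
      have "P.prob (E x) \<le> P.prob (crossing x s)"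
        using crossing_measurable sets_P by (intro P.finite_measure_mono) (auto simp: E_def intro: crossing_mono)
      then show ?thesis
        by (simp add: crossing_prob_translate[OF \<nu>])
    qed
    have E_indep: "P.prob (E (s *\<^sub>R x1) \<inter> E (s *\<^sub>R x2)) \<le> ?\<pi>\<^sup>2" if mem: "x1 \<in> X1" "x2 \<in> X2" for x1 x2
    proof -
      obtain y1 y2 where y: "norm y1 = 8 * s" "dist (s *\<^sub>R x1) y1 < s / 2" "norm y2 = 16 * s" "dist (s *\<^sub>R x2) y2 < s / 2"
        using mem unfolding X1_def X2_def by blast
      have "8 * s \<le> dist y1 y2"
        using y(1,3) norm_triangle_ineq2[of y2 y1] by (simp add: dist_norm norm_minus_commute)
      \<comment> \<open>From 8 s two errors of s / 2 are lost, which leaves 7 s; already 4 s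
        separates two open balls of radius 2 s.\<close>
      then have far: "4 * s \<le> dist (s *\<^sub>R x1) (s *\<^sub>R x2)"
        using y(2,4) dist_triangle[of y1 y2 "s *\<^sub>R x1"] dist_triangle[of "s *\<^sub>R x1" y2 "s *\<^sub>R x2"] s
        by (simp add: dist_commute)
      have disj: "L (s *\<^sub>R x1) \<inter> L (s *\<^sub>R x2) = {}"
      proof (rule ccontr)
        assume "L (s *\<^sub>R x1) \<inter> L (s *\<^sub>R x2) \<noteq> {}"
        then obtain c where "dist (s *\<^sub>R x1) c < 2 * s" "dist (s *\<^sub>R x2) c < 2 * s"
          by (auto simp: L_def)
        then show False
          using far dist_triangle[of "s *\<^sub>R x1" "s *\<^sub>R x2" c] by (simp add: dist_commute)
      qed
      have x12: "s *\<^sub>R x1 \<noteq> s *\<^sub>R x2"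
        using far s by auto
      have "P.indep_vars (\<lambda>_. config_algebra) (\<lambda>x C. C \<inter> L x) {s *\<^sub>R x1, s *\<^sub>R x2}"
        using disj x12 L sets_boolean_measure[OF \<nu>]
        by (intro poisson_law_indep[OF boolean_law_blaw[OF \<nu>, unfolded boolean_law_def]])
          (auto simp: disjoint_family_on_def)
      from P.indep_varsD_finite[OF this, of "\<lambda>x. crossing x s"]
      have "P.prob (\<Inter>x\<in>{s *\<^sub>R x1, s *\<^sub>R x2}. (\<lambda>C. C \<inter> L x) -` crossing x s \<inter> space (blaw \<nu>))
          = (\<Prod>x\<in>{s *\<^sub>R x1, s *\<^sub>R x2}. P.prob ((\<lambda>C. C \<inter> L x) -` crossing x s \<inter> space (blaw \<nu>)))"
        by (simp add: crossing_measurable)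
      then have "P.prob (E (s *\<^sub>R x1) \<inter> E (s *\<^sub>R x2)) = P.prob (E (s *\<^sub>R x1)) * P.prob (E (s *\<^sub>R x2))"
        using x12 by (simp add: E_def vimage_def space_blaw[OF \<nu>])
      also have "\<dots> \<le> ?\<pi> * ?\<pi>"
        using E_le by (intro mult_mono) auto
      finally show ?thesis
        by (simp add: power2_eq_square)
    qed
    have incl: "crossing 0 (16 * s) \<subseteq> {C. C \<inter> B \<noteq> {}} \<union> (\<Union>(x1, x2)\<in>X1 \<times> X2. E (s *\<^sub>R x1) \<inter> E (s *\<^sub>R x2))"
    proof
      fix C assume "C \<in> crossing (0 :: real ^ 'd) (16 * s)"
      then obtain g where g: "path g" "path_image g \<subseteq> covered_region C" "norm (pathstart g) = 8 * s"
        "norm (pathfinish g) = 16 * s"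
        by (auto simp: crossing_def joined_in_def)
      have far: "8 * s \<le> dist (pathstart g) (pathfinish g)"
        using g(3,4) norm_triangle_ineq2[of "pathfinish g" "pathstart g"] by (simp add: dist_norm norm_minus_commute)
      show "C \<in> {C. C \<inter> B \<noteq> {}} \<union> (\<Union>(x1, x2)\<in>X1 \<times> X2. E (s *\<^sub>R x1) \<inter> E (s *\<^sub>R x2))"
      proof (cases "C \<inter> B = {}")
        case True
        \<comment> \<open>Stated for any path h, so as to serve g near the inner sphere and the
          reversed path near the outer one.\<close>
        have local: "C \<in> E (s *\<^sub>R x)"
          if h: "path h" "path_image h \<subseteq> covered_region C" "dist (s *\<^sub>R x) (pathstart h) < s / 2"
            "norm (pathstart h) \<le> 16 * s" "8 * s \<le> dist (pathstart h) (pathfinish h)" for x h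
        proof -
          have "s \<le> dist (s *\<^sub>R x) (pathfinish h)"
            using h(3,5) s dist_triangle[of "pathstart h" "pathfinish h" "s *\<^sub>R x"] by (simp add: dist_commute)
          then have j: "joined_in (covered_region C \<inter> cball (s *\<^sub>R x) s) (sphere (s *\<^sub>R x) (s / 2)) (sphere (s *\<^sub>R x) s)"
            using h s by (intro joined_in_annulus[of h]) auto
          have nx: "norm (s *\<^sub>R x) \<le> 17 * s"
            using h(3,4) s norm_triangle_sub[of "s *\<^sub>R x" "pathstart h"] unfolding dist_norm by linarith
          have "covered_region C \<inter> cball (s *\<^sub>R x) s \<subseteq> covered_region (C \<inter> L (s *\<^sub>R x))"
          proof
            fix p assume "p \<in> covered_region C \<inter> cball (s *\<^sub>R x) s"
            then obtain c r where cr: "(c, r) \<in> C" "dist c p < r" "dist (s *\<^sub>R x) p \<le> s"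
              by (auto simp: covered_region_def)
            have cx: "dist (s *\<^sub>R x) c < s + r"
              using cr dist_triangle[of "s *\<^sub>R x" c p] by (simp add: dist_commute)
            have "norm c \<le> norm (s *\<^sub>R x) + dist (s *\<^sub>R x) c"
              using norm_triangle_sub[of c "s *\<^sub>R x"] by (simp add: dist_norm norm_minus_commute)
            then have "norm c < 18 * s + r"
              using cx nx by linarith
            then have "r < s"
              using True cr(1) by (auto simp: B_def)
            then have "(c, r) \<in> C \<inter> L (s *\<^sub>R x)"
              using cr cx by (auto simp: L_def)
            then show "p \<in> covered_region (C \<inter> L (s *\<^sub>R x))"
              using cr(2) unfolding covered_region_def by force
          qed
          then show ?thesis
            using joined_in_mono[OF j] by (simp add: E_def crossing_def)
        qed
        obtain x1 where x1: "x1 \<in> X" "dist (s *\<^sub>R x1) (pathstart g) < s / 2"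
          using X(2)[OF s, of "pathstart g"] g(3) s by auto
        obtain x2 where x2: "x2 \<in> X" "dist (s *\<^sub>R x2) (pathfinish g) < s / 2"
          using X(2)[OF s, of "pathfinish g"] g(4) s by auto
        have "C \<in> E (s *\<^sub>R x1)"
          using g x1 far s by (intro local[of g]) auto
        moreover have "C \<in> E (s *\<^sub>R x2)"
          using g x2 far s by (intro local[of "reversepath g"]) (auto simp: dist_commute)
        moreover have "x1 \<in> X1" "x2 \<in> X2"
          using x1 x2 g by (auto simp: X1_def X2_def)
        ultimately show ?thesis
          by blast
      qed simp
    qed
    have hit: "{C. C \<inter> B \<noteq> {}} \<in> P.events"
      using hit_event_measurable[OF B] sets_P by simp
    have "P.prob (crossing 0 (16 * s))
        \<le> P.prob ({C. C \<inter> B \<noteq> {}} \<union> (\<Union>(x1, x2)\<in>X1 \<times> X2. E (s *\<^sub>R x1) \<inter> E (s *\<^sub>R x2)))"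
      using incl hit E fin by (intro P.finite_measure_mono) (auto intro!: sets.Un sets.finite_UN)
    also have "\<dots> \<le> P.prob {C. C \<inter> B \<noteq> {}} + P.prob (\<Union>(x1, x2)\<in>X1 \<times> X2. E (s *\<^sub>R x1) \<inter> E (s *\<^sub>R x2))"
      using hit E fin by (intro measure_Un_le) (auto intro!: sets.finite_UN)
    also have "P.prob (\<Union>(x1, x2)\<in>X1 \<times> X2. E (s *\<^sub>R x1) \<inter> E (s *\<^sub>R x2))
        \<le> (\<Sum>(x1, x2)\<in>X1 \<times> X2. P.prob (E (s *\<^sub>R x1) \<inter> E (s *\<^sub>R x2)))"
      unfolding split_beta using E fin by (intro P.finite_measure_subadditive_finite) auto
    also have "\<dots> \<le> (\<Sum>(x1, x2)\<in>X1 \<times> X2. ?\<pi>\<^sup>2)"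
      using E_indep by (intro sum_mono) auto
    also have "\<dots> = real (card X1 * card X2) * ?\<pi>\<^sup>2"
      by (simp add: card_cartesian_product)
    also have "\<dots> \<le> real (card X * card X) * ?\<pi>\<^sup>2"
      using X(1) X12 by (intro mult_right_mono of_nat_mono mult_mono card_mono) auto
    also have "\<dots> \<le> K * ?\<pi>\<^sup>2"
      by (intro mult_right_mono) (auto simp: K_def power2_eq_square)
    also have "P.prob {C. C \<inter> B \<noteq> {}} \<le> V * t"
    proof (rule hit_blaw_le[OF \<nu> B])
      have "emeasure (lborel \<Otimes>\<^sub>M \<nu>) B \<le> ennreal V * moment_tail CARD('d) \<nu> s"
        unfolding B_def V_def by (rule emeasure_big_balls[OF \<nu> s]) simp
      also have "\<dots> \<le> ennreal V * ennreal t"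
        using t by (intro mult_left_mono) auto
      finally show "emeasure (lborel \<Otimes>\<^sub>M \<nu>) B \<le> ennreal (V * t)"
        using V t by (simp add: ennreal_mult)
    qed (use V t in auto)
    also have "V * t \<le> K * t"
      using t by (intro mult_right_mono) (auto simp: K_def)
    finally show ?thesis
      by (simp add: annulus_prob_def)
  qed
  then show ?thesis
    by (intro exI[of _ K]) (auto simp: K_def)
qed

section \<open>Iterating the renormalisation: a criterion at one scale\<close>

lemma moment_tail_antimono: "s \<le> s' \<Longrightarrow> moment_tail d \<nu> s' \<le> moment_tail d \<nu> s"
  unfolding moment_tail_def by (intro nn_integral_mono) (auto simp: indicator_def)

lemma moment_tail_finite_shift:
  assumes \<nu>: "finite_borel \<nu>" and fin: "moment_tail d \<nu> s' < \<infinity>"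
  shows "moment_tail d \<nu> s < \<infinity>"
proof -
  have [measurable_cong]: "sets \<nu> = sets borel"
    using finite_borelD[OF \<nu>] by simp
  have "moment_tail d \<nu> s \<le> (\<integral>\<^sup>+r. ennreal (r ^ d) * indicator {s'..} r + ennreal (max \<bar>s\<bar> \<bar>s'\<bar> ^ d) \<partial>\<nu>)"
    unfolding moment_tail_def
  proof (rule nn_integral_mono)
    fix r
    show "ennreal (r ^ d) * indicator {s..} r \<le> ennreal (r ^ d) * indicator {s'..} r + ennreal (max \<bar>s\<bar> \<bar>s'\<bar> ^ d)"
    proof (cases "s \<le> r \<and> r < s'")
      case True
      then have "\<bar>r\<bar> \<le> max \<bar>s\<bar> \<bar>s'\<bar>" by linarith
      then have "\<bar>r\<bar> ^ d \<le> max \<bar>s\<bar> \<bar>s'\<bar> ^ d" by (intro power_mono) auto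
      moreover have "r ^ d \<le> \<bar>r\<bar> ^ d" by (metis abs_ge_self power_abs)
      ultimately show ?thesis
        using True by (auto simp: intro!: ennreal_leI)
    qed (auto simp: indicator_def)
  qed
  also have "\<dots> = moment_tail d \<nu> s' + ennreal (max \<bar>s\<bar> \<bar>s'\<bar> ^ d) * emeasure \<nu> (space \<nu>)"
    unfolding moment_tail_def by (subst nn_integral_add) auto
  also have "\<dots> < \<infinity>"
    using fin finite_measure.emeasure_finite[OF finite_borelD(1)[OF \<nu>], of "space \<nu>"]
    by (auto simp: ennreal_mult_eq_top_iff less_top[symmetric])
  finally show ?thesis .
qed

lemma moment_tail_tendsto_0:
  assumes \<nu>: "finite_borel \<nu>" and fin: "moment_tail d \<nu> s < \<infinity>"
  shows "(\<lambda>n. moment_tail d \<nu> (real n)) \<longlonglongrightarrow> 0"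
proof -
  have [measurable_cong]: "sets \<nu> = sets borel"
    using finite_borelD[OF \<nu>] by simp
  have "(\<lambda>n. \<integral>\<^sup>+r. ennreal (r ^ d) * indicator {real n..} r \<partial>\<nu>) \<longlonglongrightarrow> (\<integral>\<^sup>+r. 0 \<partial>\<nu>)"
  proof (rule nn_integral_dominated_convergence[where w="\<lambda>r. ennreal (r ^ d) * indicator {0..} r"])
    show "(\<integral>\<^sup>+r. ennreal (r ^ d) * indicator {0..} r \<partial>\<nu>) < \<infinity>"
      using moment_tail_finite_shift[OF \<nu> fin, of 0] by (simp add: moment_tail_def)
    show "AE r in \<nu>. (\<lambda>n. ennreal (r ^ d) * indicator {real n..} r) \<longlonglongrightarrow> 0"
    proof (rule AE_I2)
      fix r :: real
      obtain N where N: "r < real N" using reals_Archimedean2 by blast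
      have "\<forall>\<^sub>F n in sequentially. ennreal (r ^ d) * indicator {real n..} r = 0"
        unfolding eventually_sequentially
        using N by (intro exI[of _ N]) (auto simp: indicator_def)
      then show "(\<lambda>n. ennreal (r ^ d) * indicator {real n..} r) \<longlonglongrightarrow> 0"
        by (rule tendsto_eventually)
    qed
  qed (auto simp: indicator_def)
  then show ?thesis
    by (simp add: moment_tail_def)
qed

text \<open>Once the errors are below \<epsilon> / 4, the recursion contracts towards \<epsilon> /
  2, the fixed point of v / 2 + \<epsilon> / 4.\<close>

lemma contraction_tendsto_0:
  fixes v e :: "nat \<Rightarrow> real"
  assumes rec: "\<And>n. v (Suc n) \<le> v n / 2 + e n" and nonneg: "\<And>n. 0 \<le> v n" and e: "e \<longlonglongrightarrow> 0"
  shows "v \<longlonglongrightarrow> 0"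
proof (rule LIMSEQ_I)
  fix \<epsilon> :: real assume \<epsilon>: "0 < \<epsilon>"
  then obtain N where N: "\<And>n. n \<ge> N \<Longrightarrow> \<bar>e n\<bar> < \<epsilon> / 4"
    using LIMSEQ_D[OF e, of "\<epsilon> / 4"] by auto
  have bound: "v (N + k) \<le> v N / 2 ^ k + \<epsilon> / 2" for k
  proof (induction k)
    case (Suc k)
    have "v (N + Suc k) \<le> v (N + k) / 2 + e (N + k)"
      using rec[of "N + k"] by simp
    also have "\<dots> \<le> (v N / 2 ^ k + \<epsilon> / 2) / 2 + \<epsilon> / 4"
      using Suc N[of "N + k"] by (intro add_mono divide_right_mono) auto
    finally show ?case
      by (simp add: field_simps)
  qed (use \<epsilon> in simp)
  have "(\<lambda>k. v N * (1 / 2) ^ k) \<longlonglongrightarrow> v N * 0"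
    by (intro tendsto_intros) auto
  then obtain k0 where k0: "\<And>k. k \<ge> k0 \<Longrightarrow> \<bar>v N * (1 / 2) ^ k\<bar> < \<epsilon> / 2"
    using LIMSEQ_D[of "\<lambda>k. v N * (1 / 2) ^ k" 0 "\<epsilon> / 2"] \<epsilon> by auto
  show "\<exists>n0. \<forall>n\<ge>n0. norm (v n - 0) < \<epsilon>"
  proof (intro exI allI impI)
    fix n assume n: "N + k0 \<le> n"
    then have "v n \<le> v N * (1 / 2) ^ (n - N) + \<epsilon> / 2"
      using bound[of "n - N"] by (simp add: power_divide)
    also have "\<dots> < \<epsilon>"
    proof -
      have "\<bar>v N * (1 / 2) ^ (n - N)\<bar> < \<epsilon> / 2"
        using n by (intro k0) auto
      then show ?thesis by linarith
    qed
    finally show "norm (v n - 0) < \<epsilon>"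
      using nonneg[of n] by simp
  qed
qed

text \<open>If v n denotes K times the crossing probability at scale 16^n R, the renormalisation
  reads v (n + 1) \<le> (v n)^2 + K^2 t n. As long as v n \<le> 1 / 2 the square is at most v n / 2,
  a contraction, and the error tends to 0 with the moment tail.\<close>

theorem finite_size_criterion:
  "\<exists>\<eta>>0. \<forall>\<nu> R. finite_borel \<nu> \<and> 0 < R \<and> annulus_prob TYPE('d::finite) \<nu> R \<le> \<eta>
      \<and> moment_tail CARD('d) \<nu> R \<le> ennreal \<eta> \<longrightarrow> (annulus_prob TYPE('d) \<nu> \<longlongrightarrow> 0) at_top"
proof -
  obtain K :: real where K: "K \<ge> 1" "\<And>\<nu> s t. finite_borel \<nu> \<Longrightarrow> 0 < s \<Longrightarrow> 0 \<le> t \<Longrightarrow> moment_tail CARD('d) \<nu> s \<le> ennreal t \<Longrightarrow>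
     annulus_prob TYPE('d) \<nu> (16 * s) \<le> K * (annulus_prob TYPE('d) \<nu> s)\<^sup>2 + K * t"
    using annulus_prob_renormalise[where 'd='d] by metis
  \<comment> \<open>Since 48 = 3 * 16, the windows from 3 s to 48 s with s = 16^n R are
    adjacent.\<close>
  obtain N :: real where N: "\<And>\<nu> s r. finite_borel \<nu> \<Longrightarrow> 0 < s \<Longrightarrow> 3 * s \<le> r \<Longrightarrow> r \<le> 48 * s \<Longrightarrow>
     annulus_prob TYPE('d) \<nu> r \<le> N * annulus_prob TYPE('d) \<nu> s"
    using annulus_prob_compare[of 48, where 'd='d] by metis
  \<comment> \<open>Makes K^2 \<eta> = 1 / 4, so that the bound 1 / 2 on v reproduces itself: (1 /
    2)^2 + 1 / 4 = 1 / 2.\<close>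
  define \<eta> where "\<eta> = 1 / (4 * K\<^sup>2)"
  have \<eta>: "\<eta> > 0" "K\<^sup>2 * \<eta> = 1 / 4"
    using K(1) by (auto simp: \<eta>_def)
  have "(annulus_prob TYPE('d) \<nu> \<longlongrightarrow> 0) at_top"
    if \<nu>: "finite_borel \<nu>" and R: "0 < R" and start: "annulus_prob TYPE('d) \<nu> R \<le> \<eta>"
      and tail: "moment_tail CARD('d) \<nu> R \<le> ennreal \<eta>" for \<nu> R
  proof -
    let ?\<pi> = "annulus_prob TYPE('d) \<nu>"
    define t where "t n = enn2real (moment_tail CARD('d) \<nu> (16 ^ n * R))" for n
    define v where "v n = K * ?\<pi> (16 ^ n * R)" for n
    have le: "moment_tail CARD('d) \<nu> (16 ^ n * R) \<le> ennreal \<eta>" for n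
    proof -
      have "1 * R \<le> 16 ^ n * R"
        using R by (intro mult_right_mono) auto
      then show ?thesis
        using moment_tail_antimono[of R "16 ^ n * R" "CARD('d)" \<nu>] tail by auto
    qed
    have t_eq: "moment_tail CARD('d) \<nu> (16 ^ n * R) = ennreal (t n)" for n
      using le[of n] unfolding t_def by (intro ennreal_enn2real[symmetric]) (auto intro: le_less_trans)
    have t: "0 \<le> t n" "t n \<le> \<eta>" for n
      using le[of n] \<eta>(1) unfolding t_eq by (auto simp: t_def ennreal_le_iff)
    have t_lim: "t \<longlonglongrightarrow> 0"
    proof -
      have "moment_tail CARD('d) \<nu> R < \<infinity>"
        using tail by (auto intro: le_less_trans)
      note lim = moment_tail_tendsto_0[OF \<nu> this]
      \<comment> \<open>The moment tail is known to vanish along the integers, hence the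
        floor.\<close>
      have "filterlim (\<lambda>n. nat \<lfloor>16 ^ n * R\<rfloor>) at_top sequentially"
      proof -
        have "filterlim (\<lambda>n. (16 :: real) ^ n) at_top sequentially"
          by (intro filterlim_at_infinity_imp_filterlim_at_top filterlim_realpow_sequentially_gt1 always_eventually) auto
        then have "filterlim (\<lambda>n. R * 16 ^ n) at_top sequentially"
          by (rule filterlim_tendsto_pos_mult_at_top[OF tendsto_const R])
        then show ?thesis
          by (intro filterlim_compose[OF filterlim_nat_sequentially] filterlim_compose[OF filterlim_floor_sequentially])
            (simp add: mult.commute)
      qed
      from filterlim_compose[OF lim this]
      have "(\<lambda>n. moment_tail CARD('d) \<nu> (real (nat \<lfloor>16 ^ n * R\<rfloor>))) \<longlonglongrightarrow> 0" .
      then have "(\<lambda>n. moment_tail CARD('d) \<nu> (16 ^ n * R)) \<longlonglongrightarrow> 0"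
      proof (rule tendsto_sandwich[OF _ _ tendsto_const, rotated 2])
        show "\<forall>\<^sub>F n in sequentially. moment_tail CARD('d) \<nu> (16 ^ n * R) \<le> moment_tail CARD('d) \<nu> (real (nat \<lfloor>16 ^ n * R\<rfloor>))"
          using R by (intro always_eventually allI moment_tail_antimono) (simp add: of_nat_nat)
      qed simp
      then show ?thesis
        unfolding t_eq using t by (simp add: tendsto_ennreal_iff[of _ _ 0, simplified])
    qed
    have rec: "v (Suc n) \<le> (v n)\<^sup>2 + K\<^sup>2 * t n" for n
    proof -
      have "?\<pi> (16 * (16 ^ n * R)) \<le> K * (?\<pi> (16 ^ n * R))\<^sup>2 + K * t n"
        using \<nu> R t t_eq by (intro K(2)) auto
      then have "K * ?\<pi> (16 * (16 ^ n * R)) \<le> K * (K * (?\<pi> (16 ^ n * R))\<^sup>2 + K * t n)"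
        using K(1) by (intro mult_left_mono) auto
      then show ?thesis
        by (simp add: v_def power2_eq_square algebra_simps)
    qed
    have v0: "0 \<le> v n" for n
      using K(1) by (simp add: v_def)
    have half: "v n \<le> 1 / 2" for n
    proof (induction n)
      case 0
      have "v 0 \<le> K * \<eta>"
        using start K(1) by (simp add: v_def mult_left_mono)
      also have "\<dots> \<le> K\<^sup>2 * \<eta>"
        using K(1) \<eta>(1) by (intro mult_right_mono) (auto simp: power2_eq_square)
      finally show ?case
        using \<eta>(2) by simp
    next
      case (Suc n)
      have "(v n)\<^sup>2 \<le> (1 / 2)\<^sup>2"
        using Suc v0[of n] by (intro power_mono) auto
      moreover have "K\<^sup>2 * t n \<le> K\<^sup>2 * \<eta>"
        using t by (intro mult_left_mono) auto
      ultimately show ?case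
        using rec[of n] \<eta>(2) by (simp add: power2_eq_square)
    qed
    have "v \<longlonglongrightarrow> 0"
    proof (rule contraction_tendsto_0)
      fix n
      have "(v n)\<^sup>2 \<le> v n * (1 / 2)"
        unfolding power2_eq_square using half v0 by (intro mult_left_mono) auto
      then show "v (Suc n) \<le> v n / 2 + K\<^sup>2 * t n"
        using rec[of n] by simp
    next
      show "(\<lambda>n. K\<^sup>2 * t n) \<longlonglongrightarrow> 0"
        using tendsto_mult_left[OF t_lim, of "K\<^sup>2"] by simp
    qed (rule v0)
    then have "(\<lambda>n. v n / K) \<longlonglongrightarrow> 0 / K"
      using K(1) by (intro tendsto_intros) auto
    then have geo: "(\<lambda>n. ?\<pi> (16 ^ n * R)) \<longlonglongrightarrow> 0"
      using K(1) by (simp add: v_def)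
    show ?thesis
    proof (rule tendstoI)
      fix \<epsilon> :: real assume \<epsilon>: "0 < \<epsilon>"
      have "(\<lambda>n. N * ?\<pi> (16 ^ n * R)) \<longlonglongrightarrow> 0"
        using tendsto_mult_left[OF geo, of N] by simp
      then obtain n0 where n0: "\<And>n. n \<ge> n0 \<Longrightarrow> \<bar>N * ?\<pi> (16 ^ n * R)\<bar> < \<epsilon>"
        using LIMSEQ_D[of _ 0 \<epsilon>] \<epsilon> by fastforce
      have "dist (?\<pi> r) 0 < \<epsilon>" if r: "3 * (16 ^ n0 * R) \<le> r" for r
      proof -
        \<comment> \<open>The scale whose window contains r. Its lower end comes from minimality,
          except at n0, where it comes from the lower bound on r.\<close>
        define n where "n = (LEAST n. n0 \<le> n \<and> r < 3 * (16 ^ Suc n * R))"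
        have "\<exists>n. n0 \<le> n \<and> r < 3 * (16 ^ Suc n * R)"
        proof -
          obtain m where m: "r / (3 * R) < 16 ^ m"
            using real_arch_pow[of 16 "r / (3 * R)"] by auto
          have "(16 :: real) ^ m \<le> 16 ^ Suc (max m n0)"
            by (intro power_increasing) auto
          with m have "r / (3 * R) < 16 ^ Suc (max m n0)" by linarith
          then have "r < 3 * (16 ^ Suc (max m n0) * R)"
            using R by (simp add: field_simps)
          then show ?thesis by (intro exI[of _ "max m n0"]) auto
        qed
        then have n: "n0 \<le> n" "r < 3 * (16 ^ Suc n * R)"
          unfolding n_def by (metis (mono_tags, lifting) LeastI_ex)+
        have "3 * (16 ^ n * R) \<le> r"
        proof (cases "n = n0")
          case False
          then obtain m where m: "n = Suc m" "n0 \<le> m"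
            using n(1) by (cases n) auto
          then have "\<not> (n0 \<le> m \<and> r < 3 * (16 ^ Suc m * R))"
            using not_less_Least[of m "\<lambda>n. n0 \<le> n \<and> r < 3 * (16 ^ Suc n * R)"] unfolding n_def[symmetric] by auto
          then show ?thesis
            using m by auto
        qed (use r in simp)
        then have "?\<pi> r \<le> N * ?\<pi> (16 ^ n * R)"
          using \<nu> R n(2) by (intro N) auto
        then show ?thesis
          using n0[OF n(1)] by (simp add: dist_norm)
      qed
      then show "\<forall>\<^sub>F r in at_top. dist (?\<pi> r) 0 < \<epsilon>"
        unfolding eventually_at_top_linorder by blast
    qed
  qed
  then show ?thesis
    using \<eta>(1) by blast
qed

text \<open>If the \<open>d\<close>-th moment is infinite, then almost surely every bounded set is covered by a single ball.\<close>

lemma moment_finite_of_subcritical: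
  assumes \<nu>: "finite_borel \<nu>" and lim: "(annulus_prob TYPE('d::finite) \<nu> \<longlongrightarrow> 0) at_top"
  shows "moment_tail CARD('d) \<nu> s < \<infinity>"
proof (rule ccontr)
  assume "\<not> moment_tail CARD('d) \<nu> s < \<infinity>"
  then have inf: "moment_tail CARD('d) \<nu> s' = \<infinity>" for s'
    using moment_tail_finite_shift[OF \<nu>, of "CARD('d)" s' s] by (auto simp: less_top[symmetric])
  interpret P: prob_space "blaw \<nu> :: ((real ^ 'd) \<times> real) set measure"
    by (rule prob_space_blaw[OF \<nu>])
  have one: "annulus_prob TYPE('d) \<nu> R = 1" if R: "R > 0" for R
  proof -
    \<comment> \<open>The balls that contain the closed ball of radius R about the origin with a
      margin.\<close>
    define A :: "((real ^ 'd) \<times> real) set" where "A = {(c, r). norm c < - R + 1 * r \<and> r \<in> UNIV}"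
    have A: "A \<in> sets borel"
      unfolding A_def by (rule measurable_ball_family) simp
    \<comment> \<open>For r \<ge> 2 R the admissible centres fill a ball of radius r - R \<ge> r /
      2, whence the power of 1 / 2.\<close>
    let ?V = "unit_ball_vol (real CARD('d)) * (1 / 2) ^ CARD('d)"
    have "?V > 0" by simp
    then have "\<infinity> = ennreal ?V * moment_tail CARD('d) \<nu> (2 * R)"
      unfolding inf by (metis ennreal_mult_top ennreal_eq_0_iff infinity_ennreal_def not_less)
    also have "\<dots> = (\<integral>\<^sup>+r. ennreal ?V * (ennreal (r ^ CARD('d)) * indicator {2 * R..} r) \<partial>\<nu>)"
      unfolding moment_tail_def using finite_borelD(2)[OF \<nu>]
      by (intro nn_integral_cmult[symmetric]) (simp cong: measurable_cong_sets)
    also have "\<dots> \<le> (\<integral>\<^sup>+r. emeasure lborel {c. (c, r) \<in> A} \<partial>\<nu>)"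
    proof (rule nn_integral_mono)
      fix r
      show "ennreal ?V * (ennreal (r ^ CARD('d)) * indicator {2 * R..} r) \<le> emeasure lborel {c. (c, r) \<in> A}"
      proof (cases "2 * R \<le> r")
        case True
        then have r: "0 \<le> r / 2" "r / 2 \<le> r - R"
          using R by auto
        have "ennreal ?V * ennreal (r ^ CARD('d)) = emeasure lborel (ball (0 :: real ^ 'd) (r / 2))"
          using r by (simp add: ball_volume power_mult_distrib ennreal_mult[symmetric] mult.assoc power_divide)
        also have "\<dots> \<le> emeasure lborel (ball (0 :: real ^ 'd) (r - R))"
          using r by (intro emeasure_mono subset_ball) auto
        also have "ball (0 :: real ^ 'd) (r - R) = {c. (c, r) \<in> A}"
          by (auto simp: A_def)
        finally show ?thesis
          using True by simp
      qed simp
    qed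
    also have "\<dots> = emeasure (lborel \<Otimes>\<^sub>M \<nu>) A"
      using emeasure_boolean_alt2[OF \<nu> A] by simp
    finally have "emeasure (lborel \<Otimes>\<^sub>M \<nu>) A = \<infinity>"
      by (simp add: top_unique)
    then have hit: "P.prob {C. C \<inter> A \<noteq> {}} = 1"
      using hit_blaw[OF \<nu> A] by simp
    have "{C. C \<inter> A \<noteq> {}} \<subseteq> crossing 0 R"
    proof
      fix C assume "C \<in> {C. C \<inter> A \<noteq> {}}"
      then obtain c r where cr: "(c, r) \<in> C" "norm c < r - R"
        by (auto simp: A_def)
      obtain b :: "real ^ 'd" where b: "norm b = R"
        using vector_choose_size[of R] R by auto
      have sub: "cball 0 R \<subseteq> covered_region C"
      proof
        fix p :: "real ^ 'd" assume "p \<in> cball 0 R"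
        then have "dist c p < r"
          using cr(2) norm_triangle_ineq4[of c p] by (simp add: dist_norm)
        then show "p \<in> covered_region C"
          using cr(1) unfolding covered_region_def by force
      qed
      have "path_image (linepath ((1 / 2) *\<^sub>R b) b) \<subseteq> cball 0 R"
        unfolding path_image_linepath using b by (intro closed_segment_subset) auto
      then have "joined_in (covered_region C) (sphere 0 (R / 2)) (sphere 0 R)"
        unfolding joined_in_def using sub b R
        by (intro exI[of _ "linepath ((1 / 2) *\<^sub>R b) b"]) auto
      then show "C \<in> crossing 0 R"
        by (simp add: crossing_def)
    qed
    then have "1 \<le> P.prob (crossing 0 R)"
      unfolding hit[symmetric] using crossing_measurable sets_blaw[OF \<nu>, where 'd='d]
      by (intro P.finite_measure_mono) auto
    then show ?thesis
      using P.prob_le_1[of "crossing 0 R"] by (simp add: annulus_prob_def)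
  qed
  have "\<forall>\<^sub>F r in at_top. annulus_prob TYPE('d) \<nu> r = 1"
    using eventually_gt_at_top[of 0] by eventually_elim (rule one)
  then have "(annulus_prob TYPE('d) \<nu> \<longlongrightarrow> 1) at_top"
    by (rule tendsto_eventually)
  with lim show False
    using tendsto_unique[of at_top "annulus_prob TYPE('d) \<nu>" 0 1] by simp
qed

section \<open>Adding microscopic balls\<close>

text \<open>The counterpart of \<open>contract\<close> for measures on the whole line.\<close>

definition shrink :: "nat \<Rightarrow> real \<Rightarrow> real measure \<Rightarrow> real measure" where
  "shrink d \<rho> \<nu> = scale_measure (ennreal (\<rho> ^ d)) (distr \<nu> borel ((*) (1 / \<rho>)))"

lemma finite_borel_shrink: "finite_borel \<nu> \<Longrightarrow> finite_borel (shrink d \<rho> \<nu>)"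
  unfolding shrink_def by (intro finite_borel_scale finite_borel_distr) auto

lemma annulus_prob_shrink:
  assumes \<nu>: "finite_borel \<nu>" and \<rho>: "0 < \<rho>"
  shows "annulus_prob TYPE('d::finite) (shrink CARD('d) \<rho> \<nu>) s = annulus_prob TYPE('d) \<nu> (\<rho> * s)"
proof -
  have "ennreal ((1 / \<rho>) ^ CARD('d)) * ennreal (\<rho> ^ CARD('d)) = 1"
    using \<rho> by (simp add: ennreal_mult[symmetric] power_mult_distrib[symmetric])
  then have "scale_measure (ennreal ((1 / \<rho>) ^ CARD('d))) (shrink CARD('d) \<rho> \<nu>) = distr \<nu> borel ((*) (1 / \<rho>))"
    unfolding shrink_def by simp
  from annulus_prob_scale[OF \<nu> finite_borel_shrink[OF \<nu>] _ this, of s] show ?thesis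
    using \<rho> by (simp add: mult.commute)
qed

text \<open>The model with radii multiplied by \<kappa> is the homothetic image, with ratio
  \<kappa>, of the model driven by \<kappa>^d \<nu>. Its crossing at scale s is therefore a crossing
  of the latter at scale s / \<kappa>.\<close>

lemma annulus_prob_enlarge:
  assumes \<nu>: "finite_borel \<nu>" and \<kappa>: "0 < \<kappa>"
  shows "measure (blaw \<nu>) {C. (\<lambda>(c, r). (c, \<kappa> * r)) ` C \<in> crossing (0 :: real ^ 'd::finite) s}
    = annulus_prob TYPE('d) (scale_measure (ennreal (\<kappa> ^ CARD('d))) \<nu>) (s / \<kappa>)"
proof -
  let ?\<nu>' = "distr \<nu> borel ((*) \<kappa>)"
  have \<nu>': "finite_borel ?\<nu>'"
    using \<nu> by (intro finite_borel_distr) auto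
  have m: "(*) \<kappa> \<in> \<nu> \<rightarrow>\<^sub>M borel"
    using finite_borelD(2)[OF \<nu>] by (simp cong: measurable_cong_sets)
  let ?f = "\<lambda>(c, r). (0 + 1 *\<^sub>R c, \<kappa> * r) :: (real ^ 'd) \<times> real"
  have "distr (blaw \<nu>) config_algebra (\<lambda>C. ?f ` C) = blaw ?\<nu>'"
    using \<nu> \<nu>' by (intro distr_blaw_affine) (auto simp: scale_measure_1)
  from measure_blaw_image[OF \<nu> this measurable_affine_pair crossing_measurable]
  have "measure (blaw \<nu>) {C. ?f ` C \<in> crossing 0 s} = annulus_prob TYPE('d) ?\<nu>' s"
    by (simp add: annulus_prob_def)
  also have "\<dots> = annulus_prob TYPE('d) (scale_measure (ennreal (\<kappa> ^ CARD('d))) \<nu>) (s / \<kappa>)"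
  proof (rule annulus_prob_scale[OF finite_borel_scale[OF \<nu>] \<nu>' \<kappa>])
    show "scale_measure (ennreal (\<kappa> ^ CARD('d))) ?\<nu>' = distr (scale_measure (ennreal (\<kappa> ^ CARD('d))) \<nu>) borel ((*) \<kappa>)"
      using m by (intro measure_eqI) (auto simp: emeasure_distr space_scale_measure measurable_cong_sets[OF sets_scale_measure refl])
  qed
  finally show ?thesis by simp
qed

lemma moment_tail_scale:
  assumes "finite_borel \<nu>"
  shows "moment_tail d (scale_measure t \<nu>) s = t * moment_tail d \<nu> s"
  unfolding moment_tail_def using finite_borelD(2)[OF assms]
  by (intro nn_integral_scale_measure) (simp cong: measurable_cong_sets)

text \<open>The factor \<rho>^d in the mass cancels the d-th power of the contracted radii, and only
  the threshold moves: for \<rho> \<ge> 1 contraction does not increase a tail at positive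
  s.\<close>

lemma moment_tail_shrink:
  assumes \<nu>: "finite_borel \<nu>" and \<rho>: "0 < \<rho>"
  shows "moment_tail d (shrink d \<rho> \<nu>) s = moment_tail d \<nu> (\<rho> * s)"
proof -
  have [measurable_cong]: "sets \<nu> = sets borel"
    using finite_borelD(2)[OF \<nu>] .
  have "moment_tail d (distr \<nu> borel ((*) (1 / \<rho>))) s
      = (\<integral>\<^sup>+r. ennreal ((1 / \<rho> * r) ^ d) * indicator {s..} (1 / \<rho> * r) \<partial>\<nu>)"
    unfolding moment_tail_def by (rule nn_integral_distr) measurable
  also have "\<dots> = (\<integral>\<^sup>+r. ennreal ((1 / \<rho>) ^ d) * (ennreal (r ^ d) * indicator {\<rho> * s..} r) \<partial>\<nu>)"
  proof (rule nn_integral_cong)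
    fix r
    have "ennreal ((1 / \<rho> * r) ^ d) = ennreal ((1 / \<rho>) ^ d) * ennreal (r ^ d)"
      unfolding power_mult_distrib using \<rho> by (intro ennreal_mult') auto
    moreover have "indicator {s..} (1 / \<rho> * r) = (indicator {\<rho> * s..} r :: ennreal)"
      using \<rho> by (auto simp: indicator_def field_simps)
    ultimately show "ennreal ((1 / \<rho> * r) ^ d) * indicator {s..} (1 / \<rho> * r)
      = ennreal ((1 / \<rho>) ^ d) * (ennreal (r ^ d) * indicator {\<rho> * s..} r)"
      by (simp add: mult.assoc)
  qed
  also have "\<dots> = ennreal ((1 / \<rho>) ^ d) * moment_tail d \<nu> (\<rho> * s)"
    unfolding moment_tail_def by (rule nn_integral_cmult) measurable
  finally have "moment_tail d (shrink d \<rho> \<nu>) s = ennreal (\<rho> ^ d) * (ennreal ((1 / \<rho>) ^ d) * moment_tail d \<nu> (\<rho> * s))"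
    unfolding shrink_def using finite_borel_distr[OF \<nu>] by (simp add: moment_tail_scale)
  also have "\<dots> = (ennreal (\<rho> ^ d) * ennreal ((1 / \<rho>) ^ d)) * moment_tail d \<nu> (\<rho> * s)"
    by (simp add: mult.assoc)
  also have "ennreal (\<rho> ^ d) * ennreal ((1 / \<rho>) ^ d) = 1"
    using \<rho> by (simp add: ennreal_mult[symmetric] power_mult_distrib[symmetric])
  finally show ?thesis by simp
qed

lemma nn_integral_sum_measure:
  assumes sets: "sets M = sets N" "sets M1 = sets N" "sets M2 = sets N"
    and eq: "\<And>A. A \<in> sets N \<Longrightarrow> emeasure M A = emeasure M1 A + emeasure M2 A"
    and f: "f \<in> borel_measurable N"
  shows "(\<integral>\<^sup>+x. f x \<partial>M) = (\<integral>\<^sup>+x. f x \<partial>M1) + (\<integral>\<^sup>+x. f x \<partial>M2)"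
  using f
proof (induction rule: borel_measurable_induct)
  case (cong f g)
  have "\<And>L. sets L = sets N \<Longrightarrow> (\<integral>\<^sup>+x. f x \<partial>L) = (\<integral>\<^sup>+x. g x \<partial>L)"
    using cong(3) by (intro nn_integral_cong) (auto dest: sets_eq_imp_space_eq)
  then show ?case using cong sets by simp
next
  case (set A)
  then show ?case using sets eq by simp
next
  case (mult u c)
  have "u \<in> borel_measurable L" if "sets L = sets N" for L
    using mult that by (simp cong: measurable_cong_sets)
  then show ?case using mult sets by (simp add: nn_integral_cmult distrib_left)
next
  case (add u v)
  have "u \<in> borel_measurable L" "v \<in> borel_measurable L" if "sets L = sets N" for L
    using add that by (simp_all cong: measurable_cong_sets)
  then show ?case using add sets by (simp add: nn_integral_add ac_simps)
next
  case (seq U)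
  have U: "U i \<in> borel_measurable L" if "sets L = sets N" for L i
    using seq that by (simp cong: measurable_cong_sets)
  have *: "(\<integral>\<^sup>+x. (SUP i. U i) x \<partial>L) = (SUP i. \<integral>\<^sup>+x. U i x \<partial>L)" if "sets L = sets N" for L
    unfolding SUP_apply using U[OF that] seq(3) by (intro nn_integral_monotone_convergence_SUP) auto
  have "(SUP i. (\<integral>\<^sup>+x. U i x \<partial>M1) + (\<integral>\<^sup>+x. U i x \<partial>M2)) = (SUP i. \<integral>\<^sup>+x. U i x \<partial>M1) + (SUP i. \<integral>\<^sup>+x. U i x \<partial>M2)"
    using seq(3) by (intro ennreal_SUP_add) (auto simp: incseq_def le_fun_def intro!: nn_integral_mono)
  then show ?case
    using seq *[OF sets(1)] *[OF sets(2)] *[OF sets(3)] by simp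
qed

lemma moment_tail_add:
  assumes "finite_borel \<nu>1" "finite_borel \<nu>2" "finite_borel \<nu>"
    and "\<And>A. A \<in> sets borel \<Longrightarrow> emeasure \<nu> A = emeasure \<nu>1 A + emeasure \<nu>2 A"
  shows "moment_tail d \<nu> s = moment_tail d \<nu>1 s + moment_tail d \<nu>2 s"
  unfolding moment_tail_def
  using finite_borelD(2)[OF assms(1)] finite_borelD(2)[OF assms(2)] finite_borelD(2)[OF assms(3)] assms(4)
  by (intro nn_integral_sum_measure[of _ borel]) auto

text \<open>Continuity from above along intervals with empty intersection. The interval leaves out 0
  because \<open>finite_borel\<close> admits mass at nonpositive radii, whose balls are
  empty.\<close>

lemma small_interval_null:
  assumes \<nu>: "finite_borel \<nu>" and e: "0 < e"
  shows "\<exists>\<delta>. 0 < \<delta> \<and> \<delta> \<le> 1 \<and> measure \<nu> {0<..<\<delta>} < e"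
proof -
  interpret finite_measure \<nu> using finite_borelD[OF \<nu>] by simp
  have "(\<lambda>n. measure \<nu> {0<..<1 / real (Suc n)}) \<longlonglongrightarrow> measure \<nu> (\<Inter>n. {0<..<1 / real (Suc n)})"
  proof (rule finite_Lim_measure_decseq)
    show "range (\<lambda>n. {0<..<1 / real (Suc n)}) \<subseteq> sets \<nu>"
      unfolding finite_borelD(2)[OF \<nu>] by (intro image_subsetI) simp
    have "1 / real (Suc n) \<le> 1 / real (Suc m)" if "m \<le> n" for m n
      using that by (intro divide_left_mono) auto
    then show "decseq (\<lambda>n. {0<..<1 / real (Suc n)})"
      unfolding decseq_def by (intro allI impI) (simp only: greaterThanLessThan_subseteq_greaterThanLessThan order_refl simp_thms)
  qed
  also have "(\<Inter>n. {0<..<1 / real (Suc n)}) = {}"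
  proof -
    have False if x: "\<And>n. 0 < x \<and> x < 1 / real (Suc n)" for x :: real
    proof -
      obtain n where "1 / real (Suc n) < x"
        using reals_Archimedean[of x] x[of 0] by (auto simp: inverse_eq_divide)
      then show False
        using x[of n] by simp
    qed
    then have "x \<notin> (\<Inter>n. {0<..<1 / real (Suc n)})" for x
      by (metis INT_iff UNIV_I greaterThanLessThan_iff)
    then show ?thesis by blast
  qed
  finally have "(\<lambda>n. measure \<nu> {0<..<1 / real (Suc n)}) \<longlonglongrightarrow> 0" by simp
  then obtain n where "measure \<nu> {0<..<1 / real (Suc n)} < e"
    using order_tendstoD(2)[OF _ e] eventually_happens'[OF sequentially_bot] by blast
  then show ?thesis
    by (intro exI[of _ "1 / real (Suc n)"]) auto
qed

text \<open>If no path in the second region goes from scale \<open>s / 2\<close> to scale \<open>s\<close>, the second region only bridges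
  gaps of size \<open>\<epsilon>\<close> and the whole path stays \<open>\<epsilon>\<close>-close to the first region. When all relevant radii are at
  least \<open>\<delta>\<close>, multiplying them by \<open>1 + \<epsilon> / \<delta>\<close> therefore makes up for the loss of the second region.\<close>

lemma crossing_of_union:
  fixes C D :: "((real ^ 'd::finite) \<times> real) set"
  assumes cross: "C \<union> D \<in> crossing 0 R" and R: "0 < R"
    and \<delta>: "0 < \<delta>" "\<delta> \<le> 1" and \<kappa>: "1 < \<kappa>" and \<epsilon>: "\<epsilon> = (\<kappa> - 1) * \<delta>" "\<epsilon> \<le> R / 8" and s: "s = 2 / 3 * \<epsilon>"
    and net: "\<And>y. norm y \<le> R \<Longrightarrow> \<exists>x\<in>X. dist x y < s / 2"
    and noD: "\<And>x. x \<in> X \<Longrightarrow> D \<notin> crossing x s"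
    and small: "C \<inter> (ball 0 (R + 1) \<times> {0<..<\<delta>}) = {}"
  shows "(\<lambda>(c, r). (c, \<kappa> * r)) ` C \<in> crossing 0 R"
proof -
  have \<epsilon>_pos: "0 < \<epsilon>" using \<epsilon> \<delta> \<kappa> by simp
  then have s_pos: "0 < s" using s by simp
  obtain g0 where g0: "path g0" "path_image g0 \<subseteq> covered_region (C \<union> D)" "norm (pathstart g0) = R / 2" "norm (pathfinish g0) = R"
    using cross by (auto simp: crossing_def joined_in_def)
  \<comment> \<open>Stopping at distance R confines the centres of the relevant balls of radius at
    most 1 to the ball of radius R + 1.\<close>
  obtain g where g: "path g" "path_image g \<subseteq> path_image g0 \<inter> cball 0 R" "pathstart g = pathstart g0" "dist 0 (pathfinish g) = R"
    using path_truncate_ball[OF g0(1), of 0 R] g0(3,4) R by auto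
  have gU: "path_image g \<subseteq> covered_region C \<union> covered_region D"
    using g(2) g0(2) unfolding covered_region_def by blast
  \<comment> \<open>If the first region had no point within \<epsilon> of p, the path would run from
    p to distance \<epsilon> inside the second region alone, which \<open>noD\<close>
    forbids.\<close>
  have near: "\<exists>q\<in>covered_region C. norm q \<le> R \<and> dist p q \<le> \<epsilon>"
    if h: "path h" "path_image h \<subseteq> path_image g" "pathstart h = p" "R / 4 \<le> dist p (pathfinish h)" for h p
  proof (rule ccontr)
    assume none: "\<not> (\<exists>q\<in>covered_region C. norm q \<le> R \<and> dist p q \<le> \<epsilon>)"
    have "\<epsilon> \<le> dist p (pathfinish h)"
      using h(4) \<epsilon>(2) R by linarith
    then obtain h' where h': "path h'" "path_image h' \<subseteq> path_image h \<inter> cball p \<epsilon>" "pathstart h' = p" "dist p (pathfinish h') = \<epsilon>"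
      using path_truncate_ball[OF h(1), of p \<epsilon>] h(3) \<epsilon>_pos by auto
    have "path_image h' \<subseteq> covered_region D"
    proof
      fix q assume q: "q \<in> path_image h'"
      then have "q \<in> path_image g" "dist p q \<le> \<epsilon>"
        using h'(2) h(2) by auto
      moreover from this have "norm q \<le> R"
        using g(2) by (auto simp: subset_iff)
      ultimately show "q \<in> covered_region D"
        using gU none by blast
    qed
    moreover have "norm p \<le> R"
      using h(2,3) g(2) pathstart_in_path_image[of h] by auto
    then obtain x where x: "x \<in> X" "dist x p < s / 2"
      using net by blast
    \<comment> \<open>The origin of s = 2 / 3 * \<epsilon>: a net point lies within s / 2 of p, and
      \<epsilon> - s / 2 = s.\<close>
    moreover have "s \<le> dist x (pathfinish h')"
      using x(2) h'(4) s dist_triangle[of p "pathfinish h'" x] by (simp add: dist_commute)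
    ultimately have "D \<in> crossing x s"
      unfolding crossing_def using h' s_pos by (auto intro!: joined_in_spheres[of h'])
    then show False
      using noD[OF x(1)] by simp
  qed
  have "path_image g \<subseteq> covered_region ((\<lambda>(c, r). (c, \<kappa> * r)) ` C)"
  proof
    fix p assume "p \<in> path_image g"
    then obtain t where t: "0 \<le> t" "t \<le> 1" "p = g t"
      by (auto simp: path_image_def)
    \<comment> \<open>The two ends of g are at least R / 2 apart, so one of them is at distance at
      least R / 4 from p and g can be followed from p towards it.\<close>
    have "R / 2 \<le> dist (g 0) (g 1)"
      using g(3,4) g0(3) norm_triangle_ineq2[of "g 1" "g 0"]
      by (simp add: pathstart_def pathfinish_def dist_norm norm_minus_commute)
    then have "R / 4 \<le> dist p (g 0) \<or> R / 4 \<le> dist p (g 1)"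
      using dist_triangle[of "g 0" "g 1" p] by (auto simp: dist_commute)
    then obtain u where u: "u \<in> {0, 1}" "R / 4 \<le> dist p (g u)"
      by auto
    have "\<exists>q\<in>covered_region C. norm q \<le> R \<and> dist p q \<le> \<epsilon>"
    proof (rule near[of "subpath t u g"])
      show "path (subpath t u g)"
        using g(1) t u by (intro path_subpath) auto
      show "path_image (subpath t u g) \<subseteq> path_image g"
        using t u by (intro path_image_subpath_subset) auto
    qed (use t u in \<open>auto simp: pathstart_subpath pathfinish_subpath\<close>)
    then obtain q c r where q: "(c, r) \<in> C" "dist c q < r" "norm q \<le> R" "dist p q \<le> \<epsilon>"
      by (auto simp: covered_region_def)
    have r_pos: "0 < r"
      using q(2) zero_le_dist[of c q] by linarith
    have "norm c \<le> norm q + dist c q"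
      using norm_triangle_sub[of c q] by (simp add: dist_norm)
    then have "norm c < R + r"
      using q by linarith
    \<comment> \<open>Otherwise r < \<delta> \<le> 1 would put the centre in the ball of radius R +
      1, against \<open>small\<close>.\<close>
    then have "\<delta> \<le> r"
      using small q(1) r_pos \<delta>(2) by (force simp: not_le[symmetric])
    then have "\<epsilon> \<le> (\<kappa> - 1) * r"
      unfolding \<epsilon>(1) using \<kappa> by (intro mult_left_mono) auto
    then have "dist c p < \<kappa> * r"
      using q(2,4) dist_triangle[of c p q] by (simp add: dist_commute algebra_simps)
    then show "p \<in> covered_region ((\<lambda>(c, r). (c, \<kappa> * r)) ` C)"
      using q(1) unfolding covered_region_def by force
  qed
  then show ?thesis
    unfolding crossing_def joined_in_def using g g0(3) by (intro CollectI exI[of _ g]) auto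
qed

text \<open>The bad events are a ball of \<nu>1 of radius below \<delta> near the window and a
  crossing of the contracted process at scale s around the net; each is given \<eta> / 2. Outside
  them a crossing survives with enlarged radii. The parameter \<rho> enters only the second event,
  through the crossing probability of \<nu>2 at scale \<rho> s.\<close>

lemma mixture_start:
  assumes \<nu>1: "finite_borel \<nu>1" and \<nu>2: "finite_borel \<nu>2" and R: "0 < R" and \<kappa>: "1 < \<kappa>" and \<eta>: "0 < \<eta>"
    and lim2: "(annulus_prob TYPE('d::finite) \<nu>2 \<longlongrightarrow> 0) at_top"
  shows "\<exists>\<rho>0>0. \<forall>\<rho> \<nu>. \<rho>0 \<le> \<rho> \<and> finite_borel \<nu> \<and>
     (\<forall>A\<in>sets borel. emeasure \<nu> A = emeasure \<nu>1 A + emeasure (shrink CARD('d) \<rho> \<nu>2) A) \<longrightarrow>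
     annulus_prob TYPE('d) \<nu> R
       \<le> annulus_prob TYPE('d) (scale_measure (ennreal (\<kappa> ^ CARD('d))) \<nu>1) (R / \<kappa>) + \<eta>"
proof -
  define V where "V = unit_ball_vol (real CARD('d)) * (R + 1) ^ CARD('d)"
  have V: "0 \<le> V" using R by (simp add: V_def)
  have cancel: "(a + 1) * (\<eta> / 2 / (a + 1)) = \<eta> / 2" if "0 \<le> a" for a :: real
  proof -
    have "a + 1 \<noteq> 0" using that by simp
    then show ?thesis by (metis nonzero_mult_div_cancel_left times_divide_eq_right)
  qed
  obtain \<delta>0 where \<delta>0: "0 < \<delta>0" "\<delta>0 \<le> 1" "measure \<nu>1 {0<..<\<delta>0} < \<eta> / 2 / (V + 1)"
    using small_interval_null[OF \<nu>1, of "\<eta> / 2 / (V + 1)"] \<eta> V by auto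
  \<comment> \<open>The second bound provides \<epsilon> \<le> R / 8 for the gap argument.\<close>
  define \<delta> where "\<delta> = min \<delta>0 (R / 8 / (\<kappa> - 1))"
  have \<delta>: "0 < \<delta>" "\<delta> \<le> 1" "\<delta> \<le> \<delta>0" "(\<kappa> - 1) * \<delta> \<le> R / 8"
  proof -
    show "0 < \<delta>" "\<delta> \<le> 1" "\<delta> \<le> \<delta>0"
      using \<delta>0 R \<kappa> by (auto simp: \<delta>_def)
    have "(\<kappa> - 1) * \<delta> \<le> (\<kappa> - 1) * (R / 8 / (\<kappa> - 1))"
      using \<kappa> by (intro mult_left_mono) (auto simp: \<delta>_def)
    also have "\<dots> = R / 8"
      using \<kappa> by (intro nonzero_mult_div_cancel_left[of "\<kappa> - 1", unfolded times_divide_eq_right[symmetric]]) simp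
    finally show "(\<kappa> - 1) * \<delta> \<le> R / 8" .
  qed
  define \<epsilon> where "\<epsilon> = (\<kappa> - 1) * \<delta>"
  define s where "s = 2 / 3 * \<epsilon>"
  have s: "0 < s" using \<delta> \<kappa> by (simp add: s_def \<epsilon>_def)
  obtain X0 :: "(real ^ 'd) set" where X0: "finite X0"
    "\<And>s' y. 0 < s' \<Longrightarrow> norm y \<le> (R / s) * s' \<Longrightarrow> \<exists>x\<in>X0. dist (s' *\<^sub>R x) y < s' / 2"
    using finite_net[of "R / s"] by blast
  define X where "X = (\<lambda>x. s *\<^sub>R x) ` X0"
  have X: "finite X" "\<And>y. norm y \<le> R \<Longrightarrow> \<exists>x\<in>X. dist x y < s / 2"
    using X0(1) X0(2)[OF s] s by (auto simp: X_def)
  define N where "N = real (card X)"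
  have "\<forall>\<^sub>F r in at_top. annulus_prob TYPE('d) \<nu>2 r < \<eta> / 2 / (N + 1)"
    using \<eta> by (intro order_tendstoD(2)[OF lim2]) (auto simp: N_def)
  then obtain r0 where r0: "\<And>r. r0 \<le> r \<Longrightarrow> annulus_prob TYPE('d) \<nu>2 r < \<eta> / 2 / (N + 1)"
    by (auto simp: eventually_at_top_linorder)
  \<comment> \<open>From r0 / s on the scale \<rho> s is at least r0; the maximum with 1 keeps
    \<rho>0 positive.\<close>
  define \<rho>0 where "\<rho>0 = max 1 (r0 / s)"
  have "annulus_prob TYPE('d) \<nu> R \<le> annulus_prob TYPE('d) (scale_measure (ennreal (\<kappa> ^ CARD('d))) \<nu>1) (R / \<kappa>) + \<eta>"
    if \<rho>: "\<rho>0 \<le> \<rho>" and \<nu>: "finite_borel \<nu>"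
      and eq: "\<forall>A\<in>sets borel. emeasure \<nu> A = emeasure \<nu>1 A + emeasure (shrink CARD('d) \<rho> \<nu>2) A" for \<rho> \<nu>
  proof -
    have \<rho>_pos: "0 < \<rho>" "r0 \<le> \<rho> * s"
      using \<rho> s by (auto simp: \<rho>0_def field_simps)
    note \<nu>2' = finite_borel_shrink[OF \<nu>2, of "CARD('d)" \<rho>]
    let ?P = "blaw \<nu>1 :: ((real ^ 'd) \<times> real) set measure"
    let ?Q = "blaw (shrink CARD('d) \<rho> \<nu>2) :: ((real ^ 'd) \<times> real) set measure"
    interpret P: prob_space ?P using \<nu>1 by (rule prob_space_blaw)
    interpret Q: prob_space ?Q using \<nu>2' by (rule prob_space_blaw)
    interpret PQ: pair_prob_space ?P ?Q ..
    let ?S = "ball (0 :: real ^ 'd) (R + 1) \<times> {0<..<\<delta>} :: ((real ^ 'd) \<times> real) set"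
    have S: "?S \<in> sets borel"
      unfolding borel_prod[symmetric] by simp
    let ?E1 = "{C. C \<inter> ?S \<noteq> {}}" and ?E2 = "\<Union>x\<in>X. crossing x s"
      and ?E3 = "{C. (\<lambda>(c, r). (c, \<kappa> * r)) ` C \<in> crossing (0 :: real ^ 'd) R}"
    have E1: "?E1 \<in> sets config_algebra"
      by (rule hit_event_measurable[OF S])
    have E2: "?E2 \<in> sets config_algebra"
      using X(1) crossing_measurable by (intro sets.finite_UN) auto
    have E3: "?E3 \<in> sets config_algebra"
      using measurable_sets[OF measurable_image_config[OF measurable_affine_pair[of 0 1 \<kappa>]] crossing_measurable[of "0 :: real ^ 'd" R]]
      by (simp add: vimage_def)
    have "annulus_prob TYPE('d) \<nu> R = measure (?P \<Otimes>\<^sub>M ?Q) {(C, D). C \<union> D \<in> crossing 0 R}"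
      unfolding annulus_prob_def using \<nu>1 \<nu>2' \<nu> crossing_measurable eq by (intro measure_blaw_union(1)) auto
    also have "\<dots> \<le> measure (?P \<Otimes>\<^sub>M ?Q) (({\<omega>. fst \<omega> \<in> ?E1} \<union> {\<omega>. snd \<omega> \<in> ?E2}) \<union> {\<omega>. fst \<omega> \<in> ?E3})"
    proof (rule PQ.finite_measure_mono)
      show "{(C, D). C \<union> D \<in> crossing 0 R} \<subseteq> ({\<omega>. fst \<omega> \<in> ?E1} \<union> {\<omega>. snd \<omega> \<in> ?E2}) \<union> {\<omega>. fst \<omega> \<in> ?E3}"
      proof (rule subsetI, rule ccontr)
        fix \<omega> :: "((real ^ 'd) \<times> real) set \<times> ((real ^ 'd) \<times> real) set"
        assume \<omega>: "\<omega> \<in> {(C, D). C \<union> D \<in> crossing 0 R}"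
          "\<omega> \<notin> ({\<omega>. fst \<omega> \<in> ?E1} \<union> {\<omega>. snd \<omega> \<in> ?E2}) \<union> {\<omega>. fst \<omega> \<in> ?E3}"
        obtain C D where CD: "\<omega> = (C, D)"
          by (cases \<omega>)
        have "(\<lambda>(c, r). (c, \<kappa> * r)) ` C \<in> crossing 0 R"
        proof (rule crossing_of_union[OF _ R \<delta>(1,2) \<kappa> \<epsilon>_def _ s_def X(2)])
          show "C \<union> D \<in> crossing 0 R"
            using \<omega>(1) by (simp add: CD)
          show "\<epsilon> \<le> R / 8"
            using \<delta>(4) by (simp add: \<epsilon>_def)
          show "D \<notin> crossing x s" if "x \<in> X" for x
            using \<omega>(2) that by (auto simp: CD)
          show "C \<inter> ?S = {}"
            using \<omega>(2) by (simp add: CD)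
        qed
        then show False
          using \<omega>(2) by (simp add: CD)
      qed
      show "({\<omega>. fst \<omega> \<in> ?E1} \<union> {\<omega>. snd \<omega> \<in> ?E2}) \<union> {\<omega>. fst \<omega> \<in> ?E3} \<in> PQ.events"
        using \<nu>1 \<nu>2' E1 E2 E3 by (intro sets.Un fst_event_measurable snd_event_measurable)
    qed
    also have "\<dots> \<le> measure (?P \<Otimes>\<^sub>M ?Q) {\<omega>. fst \<omega> \<in> ?E1} + measure (?P \<Otimes>\<^sub>M ?Q) {\<omega>. snd \<omega> \<in> ?E2}
        + measure (?P \<Otimes>\<^sub>M ?Q) {\<omega>. fst \<omega> \<in> ?E3}"
      using \<nu>1 \<nu>2' E1 E2 E3
      by (intro order.trans[OF measure_Un_le] add_right_mono measure_Un_le sets.Un fst_event_measurable snd_event_measurable)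
    also have "\<dots> = P.prob ?E1 + Q.prob ?E2 + P.prob ?E3"
      using \<nu>1 \<nu>2' E1 E2 E3 by (simp only: measure_blaw_fst measure_blaw_snd)
    also have "P.prob ?E1 \<le> \<eta> / 2"
    proof (rule hit_blaw_le[OF \<nu>1 S])
      have "emeasure (lborel \<Otimes>\<^sub>M \<nu>1) ?S = emeasure lborel (ball (0 :: real ^ 'd) (R + 1)) * emeasure \<nu>1 {0<..<\<delta>}"
        using \<nu>1 by (intro emeasure_boolean_Times) auto
      also have "\<dots> = ennreal (V * measure \<nu>1 {0<..<\<delta>})"
        using R V by (simp add: ball_volume V_def ennreal_mult finite_measure.emeasure_eq_measure[OF finite_borelD(1)[OF \<nu>1]])
      also have "\<dots> \<le> ennreal (\<eta> / 2)"
      proof (rule ennreal_leI)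
        have "measure \<nu>1 {0<..<\<delta>} \<le> measure \<nu>1 {0<..<\<delta>0}"
          using \<delta>(3) finite_borelD(2)[OF \<nu>1]
          by (intro finite_measure.finite_measure_mono[OF finite_borelD(1)[OF \<nu>1]]) auto
        then have "V * measure \<nu>1 {0<..<\<delta>} \<le> (V + 1) * (\<eta> / 2 / (V + 1))"
          using \<delta>0(3) V by (intro mult_mono) auto
        also have "(V + 1) * (\<eta> / 2 / (V + 1)) = \<eta> / 2"
          by (rule cancel[OF V])
        finally show "V * measure \<nu>1 {0<..<\<delta>} \<le> \<eta> / 2" .
      qed
      finally show "emeasure (lborel \<Otimes>\<^sub>M \<nu>1) ?S \<le> ennreal (\<eta> / 2)" .
    qed (use \<eta> in simp)
    also have "Q.prob ?E2 \<le> \<eta> / 2"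
    proof -
      have "Q.prob ?E2 \<le> (\<Sum>x\<in>X. Q.prob (crossing x s))"
        using X(1) crossing_measurable sets_blaw[OF \<nu>2', where 'd='d]
        by (intro Q.finite_measure_subadditive_finite) auto
      also have "\<dots> = N * annulus_prob TYPE('d) \<nu>2 (\<rho> * s)"
        using \<rho>_pos by (simp add: crossing_prob_translate[OF \<nu>2'] annulus_prob_shrink[OF \<nu>2] N_def)
      also have "\<dots> \<le> (N + 1) * (\<eta> / 2 / (N + 1))"
        using r0[OF \<rho>_pos(2)] by (intro mult_mono) (auto simp: N_def)
      also have "\<dots> = \<eta> / 2"
        by (rule cancel) (simp add: N_def)
      finally show ?thesis .
    qed
    also have "P.prob ?E3 = annulus_prob TYPE('d) (scale_measure (ennreal (\<kappa> ^ CARD('d))) \<nu>1) (R / \<kappa>)"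
      using \<kappa> by (intro annulus_prob_enlarge[OF \<nu>1]) auto
    finally show ?thesis by simp
  qed
  then show ?thesis
    by (intro exI[of _ \<rho>0]) (auto simp: \<rho>0_def)
qed

text \<open>The scale R = n is fixed before \<rho>: for \<rho> \<ge> 1 the moment tail of the
  contracted measure at n is bounded by that of \<nu>2 at n, so only the crossing probability
  requires \<rho> to be large.\<close>

theorem mixture_subcritical:
  assumes \<nu>1: "finite_borel \<nu>1" and \<nu>2: "finite_borel \<nu>2" and \<kappa>: "1 < \<kappa>"
    and lim1: "(annulus_prob TYPE('d::finite) (scale_measure (ennreal (\<kappa> ^ CARD('d))) \<nu>1) \<longlongrightarrow> 0) at_top"
    and lim2: "(annulus_prob TYPE('d) \<nu>2 \<longlongrightarrow> 0) at_top"
  shows "\<exists>\<rho>0. \<forall>\<rho> \<nu>. \<rho>0 \<le> \<rho> \<and> finite_borel \<nu> \<and>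
     (\<forall>A\<in>sets borel. emeasure \<nu> A = emeasure \<nu>1 A + emeasure (shrink CARD('d) \<rho> \<nu>2) A) \<longrightarrow>
     (annulus_prob TYPE('d) \<nu> \<longlongrightarrow> 0) at_top"
proof -
  obtain \<eta> :: real where \<eta>: "0 < \<eta>" "\<And>\<nu> R. finite_borel \<nu> \<Longrightarrow> 0 < R \<Longrightarrow> annulus_prob TYPE('d) \<nu> R \<le> \<eta> \<Longrightarrow>
      moment_tail CARD('d) \<nu> R \<le> ennreal \<eta> \<Longrightarrow> (annulus_prob TYPE('d) \<nu> \<longlongrightarrow> 0) at_top"
    using finite_size_criterion[where 'd='d] by metis
  have "moment_tail CARD('d) (scale_measure (ennreal (\<kappa> ^ CARD('d))) \<nu>1) 0 < \<infinity>"
    by (rule moment_finite_of_subcritical[OF finite_borel_scale[OF \<nu>1] lim1])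
  then have "moment_tail CARD('d) \<nu>1 0 < \<infinity>"
    using \<kappa> by (auto simp: moment_tail_scale[OF \<nu>1] ennreal_mult_less_top)
  then have t1: "(\<lambda>n. moment_tail CARD('d) \<nu>1 (real n)) \<longlonglongrightarrow> 0"
    by (rule moment_tail_tendsto_0[OF \<nu>1])
  have t2: "(\<lambda>n. moment_tail CARD('d) \<nu>2 (real n)) \<longlonglongrightarrow> 0"
    by (rule moment_tail_tendsto_0[OF \<nu>2 moment_finite_of_subcritical[OF \<nu>2 lim2, of 0]])
  have "filterlim (\<lambda>n. real n / \<kappa>) at_top sequentially"
    using \<kappa> filterlim_tendsto_pos_mult_at_top[OF tendsto_const, of "1 / \<kappa>" real sequentially] filterlim_real_sequentially
    by simp
  from filterlim_compose[OF lim1 this]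
  have p1: "(\<lambda>n. annulus_prob TYPE('d) (scale_measure (ennreal (\<kappa> ^ CARD('d))) \<nu>1) (real n / \<kappa>)) \<longlonglongrightarrow> 0" .
  have "\<forall>\<^sub>F n in sequentially. moment_tail CARD('d) \<nu>1 (real n) < ennreal (\<eta> / 2)
      \<and> moment_tail CARD('d) \<nu>2 (real n) < ennreal (\<eta> / 2)
      \<and> annulus_prob TYPE('d) (scale_measure (ennreal (\<kappa> ^ CARD('d))) \<nu>1) (real n / \<kappa>) < \<eta> / 2 \<and> 0 < n"
    using order_tendstoD(2)[OF t1, of "ennreal (\<eta> / 2)"] order_tendstoD(2)[OF t2, of "ennreal (\<eta> / 2)"]
      order_tendstoD(2)[OF p1, of "\<eta> / 2"] \<eta>(1)
    by (intro eventually_conj eventually_gt_at_top) auto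
  then obtain n where n: "moment_tail CARD('d) \<nu>1 (real n) < ennreal (\<eta> / 2)"
    "moment_tail CARD('d) \<nu>2 (real n) < ennreal (\<eta> / 2)"
    "annulus_prob TYPE('d) (scale_measure (ennreal (\<kappa> ^ CARD('d))) \<nu>1) (real n / \<kappa>) < \<eta> / 2" "0 < n"
    using eventually_happens'[OF sequentially_bot] by blast
  obtain \<rho>0 where \<rho>0: "\<rho>0 > 0" "\<And>\<rho> \<nu>. \<rho>0 \<le> \<rho> \<Longrightarrow> finite_borel \<nu> \<Longrightarrow>
     (\<forall>A\<in>sets borel. emeasure \<nu> A = emeasure \<nu>1 A + emeasure (shrink CARD('d) \<rho> \<nu>2) A) \<Longrightarrow>
     annulus_prob TYPE('d) \<nu> (real n)
       \<le> annulus_prob TYPE('d) (scale_measure (ennreal (\<kappa> ^ CARD('d))) \<nu>1) (real n / \<kappa>) + \<eta> / 2"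
    using mixture_start[OF \<nu>1 \<nu>2 _ \<kappa> _ lim2, of "real n" "\<eta> / 2"] n(4) \<eta>(1) by auto
  show ?thesis
  proof (intro exI[of _ "max 1 \<rho>0"] allI impI)
    fix \<rho> \<nu>
    assume a: "max 1 \<rho>0 \<le> \<rho> \<and> finite_borel \<nu> \<and>
      (\<forall>A\<in>sets borel. emeasure \<nu> A = emeasure \<nu>1 A + emeasure (shrink CARD('d) \<rho> \<nu>2) A)"
    show "(annulus_prob TYPE('d) \<nu> \<longlongrightarrow> 0) at_top"
    proof (rule \<eta>(2)[of \<nu> "real n"])
      show "annulus_prob TYPE('d) \<nu> (real n) \<le> \<eta>"
        using \<rho>0(2)[of \<rho> \<nu>] a n(3) by auto
      have "real n \<le> \<rho> * real n"
        using a mult_right_mono[of 1 \<rho> "real n"] by auto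
      then have "moment_tail CARD('d) \<nu>2 (\<rho> * real n) \<le> ennreal (\<eta> / 2)"
        using moment_tail_antimono n(2) by (meson less_imp_le order.trans)
      moreover have "moment_tail CARD('d) \<nu> (real n) = moment_tail CARD('d) \<nu>1 (real n) + moment_tail CARD('d) \<nu>2 (\<rho> * real n)"
        using a moment_tail_add[OF \<nu>1 finite_borel_shrink[OF \<nu>2], of \<nu> "CARD('d)" \<rho> "CARD('d)" "real n"]
        by (simp add: moment_tail_shrink[OF \<nu>2])
      ultimately have "moment_tail CARD('d) \<nu> (real n) \<le> ennreal (\<eta> / 2) + ennreal (\<eta> / 2)"
        using n(1) by (simp add: add_mono)
      also have "\<dots> = ennreal \<eta>"
        using \<eta>(1) by (simp add: ennreal_plus[symmetric] del: ennreal_plus)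
      finally show "moment_tail CARD('d) \<nu> (real n) \<le> ennreal \<eta>" .
    qed (use a n in auto)
  qed
qed

section \<open>Planar crossings by open squares\<close>

text \<open>The squares are closed, so that those of neighbouring sites share an edge through which
  a path can pass.\<close>

definition squares :: "(int \<times> int) set \<Rightarrow> (real ^ 2) set" where
  "squares S = (\<Union>(x, y)\<in>S. 
    {p. real_of_int x \<le> p $ 1 \<and> p $ 1 \<le> real_of_int x + 1 \<and> real_of_int y \<le> p $ 2 \<and> p $ 2 \<le> real_of_int y + 1})"

definition rect :: "int \<Rightarrow> int \<Rightarrow> int \<Rightarrow> int \<Rightarrow> (int \<times> int) set" where
  "rect x y w h = {x..<x + w} \<times> {y..<y + h}"

definition hcross :: "(int \<times> int) set \<Rightarrow> int \<Rightarrow> int \<Rightarrow> int \<Rightarrow> int \<Rightarrow> bool" where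
  "hcross S x y w h \<longleftrightarrow> (\<exists>g. path g \<and> path_image g \<subseteq> squares (S \<inter> rect x y w h) \<and>
     pathstart g $ 1 = real_of_int x \<and> pathfinish g $ 1 = real_of_int x + real_of_int w)"

text \<open>Defined by transposition, so that statements about horizontal crossings of all fields
  cover vertical ones.\<close>

definition vcross :: "(int \<times> int) set \<Rightarrow> int \<Rightarrow> int \<Rightarrow> int \<Rightarrow> int \<Rightarrow> bool" where
  "vcross S x y w h \<longleftrightarrow> hcross (prod.swap ` S) y x h w"

lemma squares_mono: "S \<subseteq> T \<Longrightarrow> squares S \<subseteq> squares T"
  unfolding squares_def by blast

lemma squares_rect:
  assumes "p \<in> squares (S \<inter> rect x y w h)"
  shows "real_of_int x \<le> p $ 1" "p $ 1 \<le> real_of_int x + real_of_int w"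
    "real_of_int y \<le> p $ 2" "p $ 2 \<le> real_of_int y + real_of_int h"
proof -
  obtain a b :: int where ab: "real_of_int a \<le> p $ 1" "p $ 1 \<le> real_of_int a + 1"
    "real_of_int b \<le> p $ 2" "p $ 2 \<le> real_of_int b + 1"
    and "x \<le> a" "a < x + w" "y \<le> b" "b < y + h"
    using assms by (auto simp: squares_def rect_def)
  then have "real_of_int x \<le> a" "real_of_int (a + 1) \<le> real_of_int (x + w)" "real_of_int y \<le> b"
    "real_of_int (b + 1) \<le> real_of_int (y + h)"
    unfolding of_int_le_iff by auto
  then show "real_of_int x \<le> p $ 1" "p $ 1 \<le> real_of_int x + real_of_int w"
    "real_of_int y \<le> p $ 2" "p $ 2 \<le> real_of_int y + real_of_int h"
    using ab by auto
qed

lemma hcross_mono: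
  "hcross S x y w h \<Longrightarrow> S \<inter> rect x y w h \<subseteq> T \<Longrightarrow> rect x y w h \<subseteq> rect x y' w h' \<Longrightarrow> hcross T x y' w h'"
  unfolding hcross_def by (meson Int_greatest inf.coboundedI2 order.trans squares_mono)

text \<open>Reduces a crossing to finitely many sites, from which measurability and independence
  follow.\<close>

lemma hcross_restrict: "hcross S x y w h \<longleftrightarrow> hcross (S \<inter> Z) x y w h" if "rect x y w h \<subseteq> Z"
proof -
  have "S \<inter> Z \<inter> rect x y w h = S \<inter> rect x y w h"
    using that by blast
  then show ?thesis
    by (simp add: hcross_def)
qed

lemma vcross_path:
  assumes "vcross S x y w h"
  obtains g where "path g" "path_image g \<subseteq> squares (S \<inter> rect x y w h)" "pathstart g $ 2 = real_of_int y" "pathfinish g $ 2 = real_of_int y + real_of_int h"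
proof -
  obtain g where g: "path g" "path_image g \<subseteq> squares (prod.swap ` S \<inter> rect y x h w)"
    "pathstart g $ 1 = real_of_int y" "pathfinish g $ 1 = real_of_int y + real_of_int h"
    using assms by (auto simp: vcross_def hcross_def)
  define f :: "real ^ 2 \<Rightarrow> real ^ 2" where "f p = (\<chi> i. if i = 1 then p $ 2 else p $ 1)" for p
  have f: "f p $ 1 = p $ 2" "f p $ 2 = p $ 1" for p
    by (simp_all add: f_def)
  have "continuous_on UNIV f"
    unfolding f_def
  proof (rule continuous_on_vec_lambda)
    show "continuous_on UNIV (\<lambda>p :: real ^ 2. if i = 1 then p $ 2 else p $ 1)" for i :: 2
      by (cases "i = 1") (auto intro!: continuous_intros)
  qed
  then have "continuous_on (path_image g) f"
    by (rule continuous_on_subset) simp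
  then have "path (f \<circ> g)"
    by (rule path_continuous_image[OF g(1)])
  moreover have "path_image (f \<circ> g) \<subseteq> squares (S \<inter> rect x y w h)"
  proof -
    have "f p \<in> squares (S \<inter> rect x y w h)" if "p \<in> squares (prod.swap ` S \<inter> rect y x h w)" for p
      using that by (force simp: squares_def rect_def f)
    then show ?thesis
      using g(2) by (auto simp: path_image_compose)
  qed
  ultimately show thesis
    using that[of "f \<circ> g"] g(3,4) by (simp add: pathstart_compose pathfinish_compose f)
qed

text \<open>By Fashoda's theorem a vertical crossing of the common part meets both horizontal crossings.\<close>

lemma hcross_glue:
  assumes h1: "hcross S x y w1 h" and v: "vcross S x' y w' h" and h2: "hcross S x2 y w2 h"
    and order: "x \<le> x2" "x2 \<le> x'" "x' + w' \<le> x + w1" "x + w1 \<le> x2 + w2"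
  shows "hcross S x y (x2 + w2 - x) h"
proof -
  obtain g1 where g1: "path g1" "path_image g1 \<subseteq> squares (S \<inter> rect x y w1 h)" "pathstart g1 $ 1 = real_of_int x" "pathfinish g1 $ 1 = real_of_int x + real_of_int w1"
    using h1 by (auto simp: hcross_def)
  obtain g2 where g2: "path g2" "path_image g2 \<subseteq> squares (S \<inter> rect x2 y w2 h)" "pathstart g2 $ 1 = real_of_int x2" "pathfinish g2 $ 1 = real_of_int x2 + real_of_int w2"
    using h2 by (auto simp: hcross_def)
  obtain k where k: "path k" "path_image k \<subseteq> squares (S \<inter> rect x' y w' h)" "pathstart k $ 2 = real_of_int y" "pathfinish k $ 2 = real_of_int y + real_of_int h"
    using vcross_path[OF v] .
  \<comment> \<open>Proved once for any horizontal crossing of a rectangle whose horizontal range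
    includes that of k. Both paths then lie in one box, as Fashoda's theorem requires.\<close>
  have cross: "path_image g \<inter> path_image k \<noteq> {}"
    if g: "path g" "path_image g \<subseteq> squares (S \<inter> rect a y b h)" "pathstart g $ 1 = real_of_int a" "pathfinish g $ 1 = real_of_int a + real_of_int b"
      and ab: "a \<le> x'" "x' + w' \<le> a + b" for g a b
  proof -
    define lo hi :: "real ^ 2" where "lo = (\<chi> i. if i = 1 then real_of_int a else real_of_int y)"
      and "hi = (\<chi> i. if i = 1 then real_of_int a + real_of_int b else real_of_int y + real_of_int h)"
    have lohi: "lo $ 1 = real_of_int a" "lo $ 2 = real_of_int y" "hi $ 1 = real_of_int a + real_of_int b"
      "hi $ 2 = real_of_int y + real_of_int h"
      by (simp_all add: lo_def hi_def)
    have ab': "real_of_int a \<le> real_of_int x'" "real_of_int x' + real_of_int w' \<le> real_of_int a + real_of_int b"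
      using ab by linarith+
    have "path_image g \<subseteq> cbox lo hi"
      using squares_rect g(2) by (fastforce simp: mem_box_cart forall_2 lohi)
    moreover have "path_image k \<subseteq> cbox lo hi"
    proof
      fix p assume "p \<in> path_image k"
      then have "p \<in> squares (S \<inter> rect x' y w' h)"
        using k(2) by blast
      from squares_rect[OF this] ab' show "p \<in> cbox lo hi"
        by (simp add: mem_box_cart forall_2 lohi)
    qed
    ultimately obtain z where "z \<in> path_image g" "z \<in> path_image k"
      using fashoda[OF g(1) k(1), of lo hi] g(3,4) k(3,4) lohi by auto
    then show ?thesis by blast
  qed
  have c1: "path_image g1 \<inter> path_image k \<noteq> {}"
    using g1 order by (intro cross[of g1 x w1]) auto
  have c2: "path_image g2 \<inter> path_image k \<noteq> {}"
    using g2 order by (intro cross[of g2 x2 w2]) auto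
  have "path_connected ((path_image g1 \<union> path_image k) \<union> path_image g2)"
    using c1 c2 g1(1) g2(1) k(1) by (intro path_connected_Un path_connected_path_image) auto
  moreover have "pathstart g1 \<in> (path_image g1 \<union> path_image k) \<union> path_image g2"
    "pathfinish g2 \<in> (path_image g1 \<union> path_image k) \<union> path_image g2"
    by auto
  ultimately obtain g where g: "path g" "path_image g \<subseteq> (path_image g1 \<union> path_image k) \<union> path_image g2"
    "pathstart g = pathstart g1" "pathfinish g = pathfinish g2"
    unfolding path_connected_def by blast
  have "rect x y w1 h \<subseteq> rect x y (x2 + w2 - x) h" "rect x2 y w2 h \<subseteq> rect x y (x2 + w2 - x) h"
    "rect x' y w' h \<subseteq> rect x y (x2 + w2 - x) h"
    using order by (auto simp: rect_def)
  then have "squares (S \<inter> rect x y w1 h) \<subseteq> squares (S \<inter> rect x y (x2 + w2 - x) h)"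
    "squares (S \<inter> rect x2 y w2 h) \<subseteq> squares (S \<inter> rect x y (x2 + w2 - x) h)"
    "squares (S \<inter> rect x' y w' h) \<subseteq> squares (S \<inter> rect x y (x2 + w2 - x) h)"
    by (auto intro!: squares_mono)
  then have "path_image g \<subseteq> squares (S \<inter> rect x y (x2 + w2 - x) h)"
    using g(2) g1(2) g2(2) k(2) by blast
  then show ?thesis
    unfolding hcross_def using g g1(3) g2(4) by (intro exI[of _ g]) auto
qed

text \<open>Three rectangles of size 2 L by L are chained; consecutive ones overlap in a square of
  side L, whose vertical crossing links them.\<close>

lemma hcross_strip:
  assumes "hcross S x y (2 * L) L" "hcross S (x + L) y (2 * L) L" "hcross S (x + 2 * L) y (2 * L) L"
    "vcross S (x + L) y L L" "vcross S (x + 2 * L) y L L" "0 \<le> L"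
  shows "hcross S x y (4 * L) L"
proof -
  have "hcross S x y (x + L + 2 * L - x) L"
    using assms by (intro hcross_glue[OF assms(1,4,2)]) auto
  then have "hcross S x y (3 * L) L" by simp
  from hcross_glue[OF this assms(5,3)] assms(6) have "hcross S x y (x + 2 * L + 2 * L - x) L"
    by auto
  then show ?thesis by simp
qed

lemma hcross_row:
  assumes "{x..<x + w} \<times> {y} \<subseteq> S" "0 < w"
  shows "hcross S x y w 1"
proof -
  define a b :: "real ^ 2" where "a = (\<chi> i. if i = 1 then real_of_int x else real_of_int y)"
    and "b = (\<chi> i. if i = 1 then real_of_int x + real_of_int w else real_of_int y)"
  have ab: "a $ 1 = real_of_int x" "a $ 2 = real_of_int y" "b $ 1 = real_of_int x + real_of_int w" "b $ 2 = real_of_int y"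
    by (simp_all add: a_def b_def)
  have "p \<in> squares (S \<inter> rect x y w 1)" if p: "p \<in> closed_segment a b" for p
  proof -
    obtain u where u: "0 \<le> u" "u \<le> 1" "p = (1 - u) *\<^sub>R a + u *\<^sub>R b"
      using p by (auto simp: closed_segment_def)
    have p12: "p $ 1 = real_of_int x + u * real_of_int w" "p $ 2 = real_of_int y"
      unfolding u(3) by (simp_all add: ab algebra_simps)
    \<comment> \<open>At the right end of the segment the floor would be x + w, outside the
      rectangle; the minimum selects the last square, whose closed right side contains that
      point.\<close>
    define k where "k = min \<lfloor>p $ 1\<rfloor> (x + w - 1)"
    have "0 \<le> u * real_of_int w" "u * real_of_int w \<le> real_of_int w"
      using u assms(2) mult_right_mono[of u 1 "real_of_int w"] by auto
    then have px: "real_of_int x \<le> p $ 1" "p $ 1 \<le> real_of_int x + real_of_int w"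
      using p12(1) by auto
    then have "x \<le> \<lfloor>p $ 1\<rfloor>" by (simp add: le_floor_iff)
    then have k: "x \<le> k" "k < x + w"
      using assms(2) by (auto simp: k_def)
    have "real_of_int k \<le> p $ 1" "p $ 1 \<le> real_of_int k + 1"
      using px by (auto simp: k_def min_def) linarith+
    then show ?thesis
      using k assms(1) p12(2) unfolding squares_def rect_def by (intro UN_I[of "(k, y)"]) auto
  qed
  then show ?thesis
    unfolding hcross_def by (intro exI[of _ "linepath a b"]) (auto simp: ab)
qed

section \<open>Independent fields of open sites\<close>

text \<open>The families F are arbitrary because finitely many sites have only finitely many
  configurations: every event about them is a finite union of elementary ones.\<close>

definition site_field :: "'w measure \<Rightarrow> ('w \<Rightarrow> (int \<times> int) set) \<Rightarrow> real \<Rightarrow> bool" where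
  "site_field P X q \<longleftrightarrow> prob_space P \<and>
    (\<forall>Z F. finite Z \<longrightarrow> {\<omega>\<in>space P. X \<omega> \<inter> Z \<in> F} \<in> sets P) \<and>
    (\<forall>z. measure P {\<omega>\<in>space P. z \<notin> X \<omega>} \<le> q) \<and>
    (\<forall>Z1 Z2 F1 F2. finite Z1 \<longrightarrow> finite Z2 \<longrightarrow> Z1 \<inter> Z2 = {} \<longrightarrow>
       measure P {\<omega>\<in>space P. X \<omega> \<inter> Z1 \<in> F1 \<and> X \<omega> \<inter> Z2 \<in> F2}
         = measure P {\<omega>\<in>space P. X \<omega> \<inter> Z1 \<in> F1} * measure P {\<omega>\<in>space P. X \<omega> \<inter> Z2 \<in> F2})"

lemma site_fieldD:
  assumes "site_field P X q"
  shows "prob_space P" "finite Z \<Longrightarrow> {\<omega>\<in>space P. X \<omega> \<inter> Z \<in> F} \<in> sets P"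
    "measure P {\<omega>\<in>space P. z \<notin> X \<omega>} \<le> q"
    "finite Z1 \<Longrightarrow> finite Z2 \<Longrightarrow> Z1 \<inter> Z2 = {} \<Longrightarrow>
       measure P {\<omega>\<in>space P. X \<omega> \<inter> Z1 \<in> F1 \<and> X \<omega> \<inter> Z2 \<in> F2}
         = measure P {\<omega>\<in>space P. X \<omega> \<inter> Z1 \<in> F1} * measure P {\<omega>\<in>space P. X \<omega> \<inter> Z2 \<in> F2}"
  using assms unfolding site_field_def by blast+

lemma site_field_swap:
  assumes "site_field P X q"
  shows "site_field P (\<lambda>\<omega>. prod.swap ` X \<omega>) q"
proof -
  have eq: "prod.swap ` A \<inter> Z \<in> F \<longleftrightarrow> A \<inter> prod.swap ` Z \<in> (\<lambda>S. prod.swap ` S) ` F" for A Z :: "(int \<times> int) set" and F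
  proof -
    have sw: "prod.swap ` (prod.swap ` B) = B" for B :: "(int \<times> int) set"
      by (simp add: image_image)
    have 1: "prod.swap ` A \<inter> Z = prod.swap ` (A \<inter> prod.swap ` Z)"
      by (simp add: image_Int sw)
    show ?thesis
    proof
      assume "prod.swap ` A \<inter> Z \<in> F"
      then have "prod.swap ` (prod.swap ` A \<inter> Z) \<in> (\<lambda>S. prod.swap ` S) ` F"
        by (rule imageI)
      then show "A \<inter> prod.swap ` Z \<in> (\<lambda>S. prod.swap ` S) ` F"
        by (simp only: 1 sw)
    next
      assume "A \<inter> prod.swap ` Z \<in> (\<lambda>S. prod.swap ` S) ` F"
      then obtain S where "A \<inter> prod.swap ` Z = prod.swap ` S" "S \<in> F"
        by blast
      then show "prod.swap ` A \<inter> Z \<in> F"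
        by (simp only: 1 sw)
    qed
  qed
  have mem: "z \<notin> prod.swap ` A \<longleftrightarrow> prod.swap z \<notin> A" for z and A :: "(int \<times> int) set"
    by (cases z) auto
  show ?thesis
    unfolding site_field_def eq mem
  proof (intro conjI allI impI)
    fix Z1 Z2 :: "(int \<times> int) set" and F1 F2
    assume "finite Z1" "finite Z2" "Z1 \<inter> Z2 = {}"
    moreover from this have "prod.swap ` Z1 \<inter> prod.swap ` Z2 = {}"
      by (simp flip: image_Int)
    ultimately show "measure P {\<omega>\<in>space P. X \<omega> \<inter> prod.swap ` Z1 \<in> (`) prod.swap ` F1 \<and> X \<omega> \<inter> prod.swap ` Z2 \<in> (`) prod.swap ` F2}
         = measure P {\<omega>\<in>space P. X \<omega> \<inter> prod.swap ` Z1 \<in> (`) prod.swap ` F1} * measure P {\<omega>\<in>space P. X \<omega> \<inter> prod.swap ` Z2 \<in> (`) prod.swap ` F2}"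
      using assms unfolding site_field_def by simp
  qed (use assms in \<open>auto simp: site_field_def\<close>)
qed

lemma finite_rect [simp]: "finite (rect x y w h)"
  by (simp add: rect_def)

lemma hcross_event:
  assumes "site_field P X q"
  shows "{\<omega>\<in>space P. \<not> hcross (X \<omega>) x y w h} \<in> sets P"
proof -
  have "{\<omega>\<in>space P. \<not> hcross (X \<omega>) x y w h} = {\<omega>\<in>space P. X \<omega> \<inter> rect x y w h \<in> {S. \<not> hcross S x y w h}}"
    using hcross_restrict[of x y w h "rect x y w h"] by auto
  also have "\<dots> \<in> sets P"
    by (rule site_fieldD(2)[OF assms finite_rect])
  finally show ?thesis .
qed

text \<open>With \<open>L = 2\<^sup>n\<close>, a failure at scale \<open>2 L\<close> requires an independent failure in each of two strips of five
  events each, so a failure probability of at most \<open>1/25\<close> is preserved: \<open>(5/25)\<^sup>2 = 1/25\<close>.\<close>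

lemma hcross_prob:
  assumes "site_field P X q" "q \<le> 1 / 50"
  shows "measure P {\<omega>\<in>space P. \<not> hcross (X \<omega>) x y (2 * 2 ^ n) (2 ^ n)} \<le> 1 / 25 \<and>
    measure P {\<omega>\<in>space P. \<not> hcross (X \<omega>) x y (2 ^ n) (2 ^ n)} \<le> 1 / 25"
  using assms(1)
\<comment> \<open>The field is generalised because vertical crossings are horizontal crossings of
  the transposed field.\<close>
proof (induction n arbitrary: X x y)
  case 0
  interpret prob_space P by (rule site_fieldD(1)[OF 0])
  have ev: "{\<omega>\<in>space P. z \<notin> X \<omega>} \<in> events" "prob {\<omega>\<in>space P. z \<notin> X \<omega>} \<le> q" for z
  proof -
    have "{\<omega>\<in>space P. z \<notin> X \<omega>} = {\<omega>\<in>space P. X \<omega> \<inter> {z} \<in> {{}}}" by auto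
    moreover have "{\<omega>\<in>space P. X \<omega> \<inter> {z} \<in> {{}}} \<in> events"
      by (intro site_fieldD(2)[OF 0]) simp
    ultimately show "{\<omega>\<in>space P. z \<notin> X \<omega>} \<in> events" by simp
    show "prob {\<omega>\<in>space P. z \<notin> X \<omega>} \<le> q"
      by (rule site_fieldD(3)[OF 0])
  qed
  \<comment> \<open>The rectangle consists of two sites, which is why q \<le> 1 / 50 is required for
    a bound of 1 / 25.\<close>
  have "prob {\<omega>\<in>space P. \<not> hcross (X \<omega>) x y 2 1} \<le> prob ({\<omega>\<in>space P. (x, y) \<notin> X \<omega>} \<union> {\<omega>\<in>space P. (x + 1, y) \<notin> X \<omega>})"
  proof (rule finite_measure_mono)
    have "hcross (X \<omega>) x y 2 1" if "(x, y) \<in> X \<omega>" "(x + 1, y) \<in> X \<omega>" for \<omega>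
    proof (rule hcross_row)
      have "{x..<x + 2} = {x, x + 1}" by auto
      then show "{x..<x + 2} \<times> {y} \<subseteq> X \<omega>" using that by auto
    qed simp
    then show "{\<omega>\<in>space P. \<not> hcross (X \<omega>) x y 2 1} \<subseteq> {\<omega>\<in>space P. (x, y) \<notin> X \<omega>} \<union> {\<omega>\<in>space P. (x + 1, y) \<notin> X \<omega>}"
      by blast
  qed (use ev in auto)
  also have "\<dots> \<le> prob {\<omega>\<in>space P. (x, y) \<notin> X \<omega>} + prob {\<omega>\<in>space P. (x + 1, y) \<notin> X \<omega>}"
    using ev by (intro measure_Un_le) auto
  also have "\<dots> \<le> 1 / 25"
    using ev(2)[of "(x, y)"] ev(2)[of "(x + 1, y)"] assms(2) by simp
  finally have 1: "prob {\<omega>\<in>space P. \<not> hcross (X \<omega>) x y 2 1} \<le> 1 / 25" .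
  have "prob {\<omega>\<in>space P. \<not> hcross (X \<omega>) x y 1 1} \<le> prob {\<omega>\<in>space P. (x, y) \<notin> X \<omega>}"
  proof (rule finite_measure_mono)
    have "hcross (X \<omega>) x y 1 1" if "(x, y) \<in> X \<omega>" for \<omega>
    proof (rule hcross_row)
      have "{x..<x + 1} = {x}" by auto
      then show "{x..<x + 1} \<times> {y} \<subseteq> X \<omega>" using that by auto
    qed simp
    then show "{\<omega>\<in>space P. \<not> hcross (X \<omega>) x y 1 1} \<subseteq> {\<omega>\<in>space P. (x, y) \<notin> X \<omega>}"
      by blast
  qed (use ev in auto)
  also have "\<dots> \<le> 1 / 25"
    using ev(2)[of "(x, y)"] assms(2) by simp
  finally show ?case
    using 1 by simp
next
  case (Suc n)
  interpret prob_space P by (rule site_fieldD(1)[OF Suc.prems])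
  define L :: int where "L = 2 ^ n"
  have L: "0 \<le> L" by (simp add: L_def)
  note sw = site_field_swap[OF Suc.prems]
  have H: "prob {\<omega>\<in>space P. \<not> hcross (X \<omega>) x y (2 * L) L} \<le> 1 / 25" for x y
    using Suc.IH[OF Suc.prems, of x y] by (simp add: L_def)
  have V: "prob {\<omega>\<in>space P. \<not> vcross (X \<omega>) x y L L} \<le> 1 / 25" for x y
    using Suc.IH[OF sw, of y x] by (simp add: L_def vcross_def)
  have evH: "{\<omega>\<in>space P. \<not> hcross (X \<omega>) x y w h} \<in> events" for x y w h
    using hcross_event[OF Suc.prems] .
  have evV: "{\<omega>\<in>space P. \<not> vcross (X \<omega>) x y w h} \<in> events" for x y w h
    using hcross_event[OF sw] by (simp add: vcross_def)
  have strip: "prob {\<omega>\<in>space P. \<not> hcross (X \<omega>) x y (4 * L) L} \<le> 1 / 5" for x y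
  proof -
    let ?H = "\<lambda>x. {\<omega>\<in>space P. \<not> hcross (X \<omega>) x y (2 * L) L}" and ?V = "\<lambda>x. {\<omega>\<in>space P. \<not> vcross (X \<omega>) x y L L}"
    have "prob {\<omega>\<in>space P. \<not> hcross (X \<omega>) x y (4 * L) L}
        \<le> prob ((((?H x \<union> ?H (x + L)) \<union> ?H (x + 2 * L)) \<union> ?V (x + L)) \<union> ?V (x + 2 * L))"
    proof (rule finite_measure_mono)
      show "{\<omega>\<in>space P. \<not> hcross (X \<omega>) x y (4 * L) L}
          \<subseteq> (((?H x \<union> ?H (x + L)) \<union> ?H (x + 2 * L)) \<union> ?V (x + L)) \<union> ?V (x + 2 * L)"
        using hcross_strip[OF _ _ _ _ _ L] by blast
    qed (intro sets.Un evH evV)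
    also have "\<dots> \<le> (((prob (?H x) + prob (?H (x + L))) + prob (?H (x + 2 * L))) + prob (?V (x + L))) + prob (?V (x + 2 * L))"
      by (intro order.trans[OF measure_Un_le] add_right_mono measure_Un_le sets.Un evH evV)
    also have "\<dots> \<le> 1 / 5"
      using H[of x y] H[of "x + L" y] H[of "x + 2 * L" y] V[of "x + L" y] V[of "x + 2 * L" y] by linarith
    finally show ?thesis .
  qed
  have "prob {\<omega>\<in>space P. \<not> hcross (X \<omega>) x y (4 * L) (2 * L)}
      \<le> prob {\<omega>\<in>space P. X \<omega> \<inter> rect x y (4 * L) L \<in> {S. \<not> hcross S x y (4 * L) L}
          \<and> X \<omega> \<inter> rect x (y + L) (4 * L) L \<in> {S. \<not> hcross S x (y + L) (4 * L) L}}"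
  proof (rule finite_measure_mono)
    have sub: "rect x y (4 * L) L \<subseteq> rect x y (4 * L) (2 * L)" "rect x (y + L) (4 * L) L \<subseteq> rect x y (4 * L) (2 * L)"
      using L by (auto simp: rect_def)
    show "{\<omega>\<in>space P. \<not> hcross (X \<omega>) x y (4 * L) (2 * L)}
        \<subseteq> {\<omega>\<in>space P. X \<omega> \<inter> rect x y (4 * L) L \<in> {S. \<not> hcross S x y (4 * L) L}
          \<and> X \<omega> \<inter> rect x (y + L) (4 * L) L \<in> {S. \<not> hcross S x (y + L) (4 * L) L}}"
    proof (intro subsetI CollectI conjI; elim CollectE conjE)
      fix \<omega> assume \<omega>: "\<omega> \<in> space P" "\<not> hcross (X \<omega>) x y (4 * L) (2 * L)"
      show "\<omega> \<in> space P" by (rule \<omega>(1))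
      show "\<not> hcross (X \<omega> \<inter> rect x y (4 * L) L) x y (4 * L) L"
        using \<omega>(2) hcross_mono[OF _ _ sub(1)] by blast
      show "\<not> hcross (X \<omega> \<inter> rect x (y + L) (4 * L) L) x (y + L) (4 * L) L"
        using \<omega>(2) hcross_mono[OF _ _ sub(2)] by blast
    qed
    show "{\<omega>\<in>space P. X \<omega> \<inter> rect x y (4 * L) L \<in> {S. \<not> hcross S x y (4 * L) L}
          \<and> X \<omega> \<inter> rect x (y + L) (4 * L) L \<in> {S. \<not> hcross S x (y + L) (4 * L) L}} \<in> events"
      by (intro sets.sets_Collect_conj site_fieldD(2)[OF Suc.prems] finite_rect)
  qed
  also have "\<dots> = prob {\<omega>\<in>space P. X \<omega> \<inter> rect x y (4 * L) L \<in> {S. \<not> hcross S x y (4 * L) L}}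
      * prob {\<omega>\<in>space P. X \<omega> \<inter> rect x (y + L) (4 * L) L \<in> {S. \<not> hcross S x (y + L) (4 * L) L}}"
  proof -
    have "rect x y (4 * L) L \<inter> rect x (y + L) (4 * L) L = {}"
      by (auto simp: rect_def)
    then show ?thesis
      by (rule site_fieldD(4)[OF Suc.prems finite_rect finite_rect])
  qed
  also have "\<dots> = prob {\<omega>\<in>space P. \<not> hcross (X \<omega>) x y (4 * L) L} * prob {\<omega>\<in>space P. \<not> hcross (X \<omega>) x (y + L) (4 * L) L}"
    using hcross_restrict[OF order_refl, of _ x y "4 * L" L] hcross_restrict[OF order_refl, of _ x "y + L" "4 * L" L]
    by simp
  also have "\<dots> \<le> 1 / 5 * (1 / 5)"
    using strip by (intro mult_mono) auto
  finally have A: "prob {\<omega>\<in>space P. \<not> hcross (X \<omega>) x y (4 * L) (2 * L)} \<le> 1 / 25"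
    by simp
  \<comment> \<open>A crossing of the lower half, of size 2 L by L, also crosses the square.\<close>
  have "prob {\<omega>\<in>space P. \<not> hcross (X \<omega>) x y (2 * L) (2 * L)} \<le> prob {\<omega>\<in>space P. \<not> hcross (X \<omega>) x y (2 * L) L}"
  proof (rule finite_measure_mono)
    have sub: "rect x y (2 * L) L \<subseteq> rect x y (2 * L) (2 * L)"
      using L by (auto simp: rect_def)
    show "{\<omega>\<in>space P. \<not> hcross (X \<omega>) x y (2 * L) (2 * L)} \<subseteq> {\<omega>\<in>space P. \<not> hcross (X \<omega>) x y (2 * L) L}"
      using hcross_mono[OF _ _ sub] by blast
  qed (rule evH)
  then have B: "prob {\<omega>\<in>space P. \<not> hcross (X \<omega>) x y (2 * L) (2 * L)} \<le> 1 / 25"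
    using H[of x y] by linarith
  have "2 * 2 ^ Suc n = 4 * L" "2 ^ Suc n = 2 * L"
    by (simp_all add: L_def)
  then show ?case
    using A B by simp
qed

section \<open>Percolation at high intensity\<close>

text \<open>A plane spanned by two coordinate axes is divided into small squares. A square is open
  when a ball of radius above a is centred in the cell attached to it, and that ball then covers the
  square. Distinct cells are independent, and a large t makes closed squares rare enough for the
  planar crossings, which thus occur with probability at least 24 / 25 at arbitrarily large
  scales.\<close>

lemma boolean_supercritical:
  assumes d: "CARD('d::finite) \<ge> 2" and \<nu>: "finite_borel \<nu>" and pos: "emeasure \<nu> {0<..} > 0"
  shows "\<exists>t0. \<forall>t\<ge>t0. \<not> (annulus_prob TYPE('d) (scale_measure (ennreal t) \<nu>) \<longlongrightarrow> 0) at_top"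
proof -
  interpret \<nu>: finite_measure \<nu> using finite_borelD[OF \<nu>] by simp
  have sets_\<nu>: "sets \<nu> = sets borel" using finite_borelD[OF \<nu>] by simp
  \<comment> \<open>Continuity from below: the open half-line is the increasing union of the
    half-lines beyond 1 / (n + 1).\<close>
  obtain a where a: "0 < a" "0 < measure \<nu> {a<..}"
  proof -
    have "(\<lambda>n. measure \<nu> {1 / real (Suc n)<..}) \<longlonglongrightarrow> measure \<nu> (\<Union>n. {1 / real (Suc n)<..})"
    proof (rule \<nu>.finite_Lim_measure_incseq)
      show "range (\<lambda>n. {1 / real (Suc n)<..}) \<subseteq> sets \<nu>"
        unfolding sets_\<nu> by (intro image_subsetI) simp
      have "1 / real (Suc n) \<le> 1 / real (Suc m)" if "m \<le> n" for m n
        using that by (intro divide_left_mono) auto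
      then show "incseq (\<lambda>n. {1 / real (Suc n)<..})"
        unfolding incseq_def by (intro allI impI) (simp only: greaterThan_subset_iff)
    qed
    also have "(\<Union>n. {1 / real (Suc n)<..}) = {0<..}"
    proof (intro equalityI subsetI)
      fix x :: real assume "x \<in> {0<..}"
      then obtain n where "1 / real (Suc n) < x"
        using reals_Archimedean[of x] by (auto simp: inverse_eq_divide)
      then show "x \<in> (\<Union>n. {1 / real (Suc n)<..})"
        by (intro UN_I[of n]) auto
    next
      fix x :: real assume "x \<in> (\<Union>n. {1 / real (Suc n)<..})"
      then obtain n where "1 / real (Suc n) < x" by auto
      moreover have "0 < 1 / real (Suc n)" by simp
      ultimately show "x \<in> {0<..}"
        unfolding greaterThan_iff by (rule order.strict_trans[rotated])
    qed
    finally have "(\<lambda>n. measure \<nu> {1 / real (Suc n)<..}) \<longlonglongrightarrow> measure \<nu> {0<..}" .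
    moreover have "0 < measure \<nu> {0<..}"
      using pos by (simp add: \<nu>.emeasure_eq_measure)
    ultimately obtain n where "0 < measure \<nu> {1 / real (Suc n)<..}"
      using order_tendstoD(1) eventually_happens'[OF sequentially_bot] by blast
    then show thesis
      by (intro that[of "1 / real (Suc n)"]) auto
  qed
  obtain i j :: 'd where ij: "i \<noteq> j"
  proof -
    have "\<exists>i j :: 'd. i \<noteq> j"
    proof (rule ccontr)
      assume "\<nexists>i j :: 'd. i \<noteq> j"
      then have "(UNIV :: 'd set) \<subseteq> {undefined}" by auto
      from card_mono[OF _ this] d show False by simp
    qed
    then show thesis using that by blast
  qed
  \<comment> \<open>Points of one closed cell differ by at most d \<delta> = a / 2 in the l1 norm,
    so a ball of radius above a centred there covers the whole cell.\<close>
  define \<delta> where "\<delta> = a / (2 * real CARD('d))"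
  have \<delta>: "0 < \<delta>" "real CARD('d) * \<delta> < a"
    using a(1) d by (auto simp: \<delta>_def)
  \<comment> \<open>The corner of a cell lies in the plane of the coordinates i and j, while the
    cell itself is a d-dimensional cube: a planar cell would have no volume and contain no
    centres.\<close>
  define lo :: "int \<times> int \<Rightarrow> real ^ 'd"
    where "lo z = (\<chi> k. if k = i then \<delta> * fst z else if k = j then \<delta> * snd z else 0)" for z
  define cell :: "int \<times> int \<Rightarrow> (real ^ 'd) set" where "cell z = box (lo z) (lo z + (\<chi> k. \<delta>))" for z
  have cell_iff: "c \<in> cell z \<longleftrightarrow> (\<forall>k. lo z $ k < c $ k \<and> c $ k < lo z $ k + \<delta>)" for c z
    by (simp add: cell_def mem_box_cart)
  have cell_vol: "emeasure lborel (cell z) = ennreal (\<delta> ^ CARD('d))" for z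
  proof -
    have "lo z \<bullet> b \<le> (lo z + (\<chi> k. \<delta>)) \<bullet> b" if "b \<in> Basis" for b
      using that \<delta>(1) by (auto simp: Basis_vec_def inner_axis)
    then have "emeasure lborel (cell z) = ennreal (\<Prod>b\<in>Basis. ((lo z + (\<chi> k. \<delta>)) - lo z) \<bullet> b)"
      unfolding cell_def by (intro emeasure_lborel_box)
    also have "(\<Prod>b\<in>Basis. ((lo z + (\<chi> k. \<delta>)) - lo z) \<bullet> b) = (\<Prod>b\<in>(Basis :: (real ^ 'd) set). \<delta>)"
      by (intro prod.cong refl) (auto simp: Basis_vec_def inner_axis)
    finally show ?thesis by simp
  qed
  have cell_disj: "cell z \<inter> cell z' = {}" if "z \<noteq> z'" for z z'
  proof (rule ccontr)
    assume "cell z \<inter> cell z' \<noteq> {}"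
    then obtain c where c: "c \<in> cell z" "c \<in> cell z'" by blast
    have eq: "m = m'" if "\<delta> * real_of_int m < u" "u < \<delta> * real_of_int m + \<delta>" "\<delta> * real_of_int m' < u" "u < \<delta> * real_of_int m' + \<delta>" for m m' :: int and u
    proof -
      have "\<delta> * real_of_int m < \<delta> * (real_of_int m' + 1)" "\<delta> * real_of_int m' < \<delta> * (real_of_int m + 1)"
        using that by (simp_all add: algebra_simps)
      then have "real_of_int m < real_of_int m' + 1" "real_of_int m' < real_of_int m + 1"
        using \<delta>(1) by simp_all
      then show ?thesis by linarith
    qed
    have "fst z = fst z'"
      using c[unfolded cell_iff] by (intro eq[of _ "c $ i"]) (auto simp: lo_def dest: spec[of _ i])
    moreover have "snd z = snd z'"
      using c[unfolded cell_iff] ij by (intro eq[of _ "c $ j"]) (auto simp: lo_def dest: spec[of _ j])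
    ultimately show False
      using that by (simp add: prod_eq_iff)
  qed
  define T :: "int \<times> int \<Rightarrow> ((real ^ 'd) \<times> real) set" where "T z = cell z \<times> {a<..}" for z
  have T: "T z \<in> sets borel" for z
    unfolding T_def cell_def borel_prod[symmetric] by simp
  have T_disj: "T z \<inter> T z' = {}" if "z \<noteq> z'" for z z'
    using cell_disj[OF that] by (auto simp: T_def)
  define X :: "((real ^ 'd) \<times> real) set \<Rightarrow> (int \<times> int) set" where "X C = {z. C \<inter> T z \<noteq> {}}" for C
  define e :: "real ^ 2 \<Rightarrow> real ^ 'd"
    where "e p = (\<chi> k. if k = i then \<delta> * p $ 1 else if k = j then \<delta> * p $ 2 else 0)" for p
  have e_squares: "e p \<in> covered_region C" if mem: "p \<in> squares (X C)" for p C
  proof -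
    obtain z where z: "z \<in> X C" "real_of_int (fst z) \<le> p $ 1" "p $ 1 \<le> real_of_int (fst z) + 1"
      "real_of_int (snd z) \<le> p $ 2" "p $ 2 \<le> real_of_int (snd z) + 1"
      using mem unfolding squares_def by force
    obtain c r where cr: "(c, r) \<in> C" "c \<in> cell z" "a < r"
      using z(1) by (auto simp: X_def T_def)
    have "\<bar>(c - e p) $ k\<bar> \<le> \<delta>" for k
    proof -
      have bnd: "\<delta> * m \<le> \<delta> * u" "\<delta> * u \<le> \<delta> * m + \<delta>" if "m \<le> u" "u \<le> m + 1" for m u
        using that \<delta>(1) mult_left_mono[of m u \<delta>] mult_left_mono[of u "m + 1" \<delta>] by (auto simp: algebra_simps)
      have "lo z $ k \<le> e p $ k \<and> e p $ k \<le> lo z $ k + \<delta>"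
        using bnd[OF z(2,3)] bnd[OF z(4,5)] \<delta>(1) z by (auto simp: lo_def e_def)
      moreover have "lo z $ k < c $ k \<and> c $ k < lo z $ k + \<delta>"
        using cr(2)[unfolded cell_iff] by blast
      ultimately show ?thesis
        by (simp add: abs_le_iff)
    qed
    then have "norm (c - e p) \<le> (\<Sum>k\<in>(UNIV :: 'd set). \<delta>)"
      by (intro order.trans[OF norm_le_l1_cart] sum_mono)
    then have "dist c (e p) < r"
      using \<delta>(2) cr(3) by (simp add: dist_norm)
    then show ?thesis
      using cr(1) unfolding covered_region_def by force
  qed
  have cont_e: "continuous_on UNIV e"
    unfolding e_def
  proof (rule continuous_on_vec_lambda)
    show "continuous_on UNIV (\<lambda>p :: real ^ 2. if k = i then \<delta> * p $ 1 else if k = j then \<delta> * p $ 2 else 0)" for k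
      by (cases "k = i"; cases "k = j") (auto intro!: continuous_intros)
  qed
  have ecoord: "e p $ i = \<delta> * p $ 1" "norm (e p) \<le> \<delta> * (\<bar>p $ 1\<bar> + \<bar>p $ 2\<bar>)" for p
  proof -
    show "e p $ i = \<delta> * p $ 1" by (simp add: e_def)
    have "norm (e p) \<le> (\<Sum>k\<in>UNIV. \<bar>e p $ k\<bar>)" by (rule norm_le_l1_cart)
    also have "\<dots> = (\<Sum>k\<in>{i, j}. \<bar>e p $ k\<bar>)"
      by (intro sum.mono_neutral_right) (auto simp: e_def)
    also have "\<dots> = \<delta> * (\<bar>p $ 1\<bar> + \<bar>p $ 2\<bar>)"
      using ij \<delta>(1) by (simp add: e_def abs_mult algebra_simps)
    finally show "norm (e p) \<le> \<delta> * (\<bar>p $ 1\<bar> + \<bar>p $ 2\<bar>)" .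
  qed
  have cross: "C \<in> crossing 0 (2 * \<delta> * 2 ^ n)" if h: "hcross (X C) 0 0 (2 * 2 ^ n) (2 ^ n)" for C n
  proof -
    obtain g where g: "path g" "path_image g \<subseteq> squares (X C \<inter> rect 0 0 (2 * 2 ^ n) (2 ^ n))"
      "pathstart g $ 1 = 0" "pathfinish g $ 1 = 2 * 2 ^ n"
      using h by (auto simp: hcross_def)
    have sq: "path_image g \<subseteq> squares (X C)"
      using g(2) squares_mono[of "X C \<inter> rect 0 0 (2 * 2 ^ n) (2 ^ n)" "X C"] by blast
    have "path (e \<circ> g)"
      using continuous_on_subset[OF cont_e] by (intro path_continuous_image[OF g(1)]) auto
    moreover have "path_image (e \<circ> g) \<subseteq> covered_region C"
      using sq e_squares by (auto simp: path_image_compose)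
    \<comment> \<open>The crossing starts at first coordinate 0 and height at most 2^n, hence at
      norm at most \<delta> 2^n, and ends at norm at least twice that: a rectangle twice as long as
      high yields a crossing of the annulus.\<close>
    moreover have "dist 0 (pathstart (e \<circ> g)) \<le> 2 * \<delta> * 2 ^ n / 2"
    proof -
      have "0 \<le> pathstart g $ 2" "pathstart g $ 2 \<le> 2 ^ n"
        using squares_rect(3,4)[of "pathstart g" "X C" 0 0 "2 * 2 ^ n" "2 ^ n"] g(2) by auto
      then have "norm (e (pathstart g)) \<le> \<delta> * 2 ^ n"
        using ecoord(2)[of "pathstart g"] g(3) \<delta>(1) by (auto intro: order.trans mult_left_mono)
      then show ?thesis
        by (simp add: pathstart_compose)
    qed
    moreover have "2 * \<delta> * 2 ^ n \<le> dist 0 (pathfinish (e \<circ> g))"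
      using component_le_norm_cart[of "e (pathfinish g)" i] ecoord(1)[of "pathfinish g"] g(4) \<delta>(1)
      by (simp add: pathfinish_compose abs_mult)
    ultimately show ?thesis
      unfolding crossing_def using \<delta>(1) by (auto intro!: joined_in_spheres[of "e \<circ> g"])
  qed
  define m where "m = measure \<nu> {a<..}"
  \<comment> \<open>From t0 on a cell contains at least 50 suitable centres on average, and exp (-
    50) < 1 / 50.\<close>
  define t0 where "t0 = 50 / (\<delta> ^ CARD('d) * m)"
  have "\<not> (annulus_prob TYPE('d) (scale_measure (ennreal t) \<nu>) \<longlongrightarrow> 0) at_top" if t: "t0 \<le> t" for t
  proof
    assume lim: "(annulus_prob TYPE('d) (scale_measure (ennreal t) \<nu>) \<longlongrightarrow> 0) at_top"
    let ?\<nu> = "scale_measure (ennreal t) \<nu>"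
    note \<nu>t = finite_borel_scale[OF \<nu>, of t]
    have m: "0 < m" using a by (simp add: m_def)
    have tpos: "0 < t" "50 \<le> t * (\<delta> ^ CARD('d) * m)"
    proof -
      have "0 < t0" using m \<delta>(1) by (simp add: t0_def)
      then show "0 < t" using t by linarith
      have "0 < \<delta> ^ CARD('d) * m" using m \<delta>(1) by simp
      then show "50 \<le> t * (\<delta> ^ CARD('d) * m)"
        using t unfolding t0_def by (simp add: pos_divide_le_eq)
    qed
    let ?P = "blaw ?\<nu> :: ((real ^ 'd) \<times> real) set measure"
    interpret P: prob_space ?P by (rule prob_space_blaw[OF \<nu>t])
    have sets_P: "P.events = sets config_algebra" and space_P: "space ?P = UNIV"
      using sets_blaw[OF \<nu>t] space_blaw[OF \<nu>t] by auto
    have meas: "{C. X C \<inter> Z \<in> F} \<in> P.events" if Z: "finite Z" for Z F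
    proof -
      have "{C. X C \<inter> Z = A} \<in> P.events" if "A \<subseteq> Z" for A
      proof (cases "Z = {}")
        case False
        have "{C. X C \<inter> Z = A} = (\<Inter>z\<in>Z. if z \<in> A then {C. C \<inter> T z \<noteq> {}} else {C. C \<inter> T z = {}})"
        proof (intro set_eqI)
          fix C
          have "X C \<inter> Z = A \<longleftrightarrow> (\<forall>z\<in>Z. z \<in> A \<longleftrightarrow> C \<inter> T z \<noteq> {})"
            using that unfolding X_def by blast
          also have "\<dots> \<longleftrightarrow> (\<forall>z\<in>Z. C \<in> (if z \<in> A then {C. C \<inter> T z \<noteq> {}} else {C. C \<inter> T z = {}}))"
          proof (rule ball_cong[OF refl])
            show "(z \<in> A \<longleftrightarrow> C \<inter> T z \<noteq> {}) \<longleftrightarrow> C \<in> (if z \<in> A then {C. C \<inter> T z \<noteq> {}} else {C. C \<inter> T z = {}})" for z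
              by (cases "z \<in> A") simp_all
          qed
          finally show "C \<in> {C. X C \<inter> Z = A} \<longleftrightarrow> C \<in> (\<Inter>z\<in>Z. if z \<in> A then {C. C \<inter> T z \<noteq> {}} else {C. C \<inter> T z = {}})"
            by (simp only: mem_Collect_eq INT_iff)
        qed
        moreover have "(if z \<in> A then {C. C \<inter> T z \<noteq> {}} else {C. C \<inter> T z = {}}) \<in> P.events" for z
          using hit_event_measurable[OF T] void_event_measurable[OF T] by (simp add: sets_P)
        ultimately show ?thesis
          using False Z by (simp only:) (intro sets.finite_INT, auto)
      qed (use that sets.top[of ?P] space_P in auto)
      moreover have "{C. X C \<inter> Z \<in> F} = (\<Union>A\<in>{A. A \<subseteq> Z \<and> A \<in> F}. {C. X C \<inter> Z = A})"
        by auto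
      moreover have "finite {A. A \<subseteq> Z \<and> A \<in> F}"
        using Z by (rule finite_subset[rotated, OF finite_Pow_iff[THEN iffD2]]) auto
      ultimately show ?thesis
        by (simp only:) (intro sets.finite_UN, auto)
    qed
    have field: "site_field ?P X (1 / 50)"
      unfolding site_field_def space_P
    proof (intro conjI allI impI)
      show "prob_space ?P" by (rule P.prob_space_axioms)
      show "{C \<in> UNIV. X C \<inter> Z \<in> F} \<in> P.events" if "finite Z" for Z F
        using meas[OF that] by simp
      show "P.prob {C \<in> UNIV. z \<notin> X C} \<le> 1 / 50" for z
      proof -
        have "emeasure (lborel \<Otimes>\<^sub>M ?\<nu>) (T z) = ennreal (\<delta> ^ CARD('d)) * emeasure ?\<nu> {a<..}"
          unfolding T_def by (subst emeasure_boolean_Times[OF \<nu>t]) (simp_all only: cell_vol, simp_all add: cell_def)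
        also have "\<dots> = ennreal (t * (\<delta> ^ CARD('d) * m))"
          using tpos(1) \<delta>(1) m
          by (simp add: \<nu>.emeasure_eq_measure m_def[symmetric] ennreal_mult[symmetric] mult.left_commute)
        finally have "P.prob {C. C \<inter> T z = {}} = exp (- (t * (\<delta> ^ CARD('d) * m)))"
          using void_blaw[OF \<nu>t T] tpos(2) by simp
        also have "\<dots> = 1 / exp (t * (\<delta> ^ CARD('d) * m))"
          by (simp add: exp_minus inverse_eq_divide)
        also have "\<dots> \<le> 1 / 50"
          using exp_ge_add_one_self[of "t * (\<delta> ^ CARD('d) * m)"] tpos(2) by (intro divide_left_mono) linarith+
        finally show ?thesis by (simp add: X_def)
      qed
      fix Z1 Z2 :: "(int \<times> int) set" and F1 F2
      assume Z: "finite Z1" "finite Z2" "Z1 \<inter> Z2 = {}"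
      \<comment> \<open>The two sets of sites become two disjoint Borel sets of centres and radii,
        indexed by truth values, on which the process is independent.\<close>
      define B where "B k = (\<Union>z\<in>(if k then Z1 else Z2). T z)" for k
      have "P.indep_vars (\<lambda>_. config_algebra) (\<lambda>k C. C \<inter> B k) {True, False}"
      proof (rule poisson_law_indep[OF boolean_law_blaw[OF \<nu>t, unfolded boolean_law_def] sets_boolean_measure[OF \<nu>t]])
        show "B k \<in> sets borel" for k
          using Z T by (auto simp: B_def intro!: sets.finite_UN)
        have "B True \<inter> B False = {}"
        proof (rule ccontr)
          assume "B True \<inter> B False \<noteq> {}"
          then obtain z1 z2 p where "z1 \<in> Z1" "z2 \<in> Z2" "p \<in> T z1" "p \<in> T z2"
            by (auto simp: B_def)
          then show False
            using Z(3) T_disj[of z1 z2] by (cases "z1 = z2") blast+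
        qed
        then show "disjoint_family_on B {True, False}"
          by (auto simp: disjoint_family_on_def)
      qed simp
      from P.indep_varsD_finite[OF this, of "\<lambda>k. if k then {C. X C \<inter> Z1 \<in> F1} else {C. X C \<inter> Z2 \<in> F2}"]
      have "P.prob ({C. X (C \<inter> B True) \<inter> Z1 \<in> F1} \<inter> {C. X (C \<inter> B False) \<inter> Z2 \<in> F2})
          = P.prob {C. X (C \<inter> B True) \<inter> Z1 \<in> F1} * P.prob {C. X (C \<inter> B False) \<inter> Z2 \<in> F2}"
        using meas[OF Z(1)] meas[OF Z(2)] by (simp add: sets_P space_P vimage_def)
      moreover have "X (C \<inter> B True) \<inter> Z1 = X C \<inter> Z1" "X (C \<inter> B False) \<inter> Z2 = X C \<inter> Z2" for C
        by (auto simp: X_def B_def)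
      ultimately show "P.prob {C \<in> UNIV. X C \<inter> Z1 \<in> F1 \<and> X C \<inter> Z2 \<in> F2}
          = P.prob {C \<in> UNIV. X C \<inter> Z1 \<in> F1} * P.prob {C \<in> UNIV. X C \<inter> Z2 \<in> F2}"
        by (simp add: Int_def)
    qed
    have lower: "24 / 25 \<le> annulus_prob TYPE('d) ?\<nu> (2 * \<delta> * 2 ^ n)" for n
    proof -
      have ev: "{C. \<not> hcross (X C) 0 0 (2 * 2 ^ n) (2 ^ n)} \<in> P.events"
        using hcross_event[OF field] space_P by simp
      have "24 / 25 \<le> 1 - P.prob {C. \<not> hcross (X C) 0 0 (2 * 2 ^ n) (2 ^ n)}"
        using hcross_prob[OF field order_refl, of 0 0 n] space_P by simp
      also have "\<dots> = P.prob (space ?P - {C. \<not> hcross (X C) 0 0 (2 * 2 ^ n) (2 ^ n)})"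
        using P.prob_compl[OF ev] by simp
      also have "\<dots> \<le> P.prob (crossing 0 (2 * \<delta> * 2 ^ n))"
        using cross crossing_measurable sets_P by (intro P.finite_measure_mono) auto
      finally show ?thesis
        by (simp add: annulus_prob_def)
    qed
    have "filterlim (\<lambda>n. (2 :: real) ^ n) at_top sequentially"
      by (intro filterlim_at_infinity_imp_filterlim_at_top filterlim_realpow_sequentially_gt1 always_eventually) auto
    then have "filterlim (\<lambda>n. 2 * \<delta> * 2 ^ n) at_top sequentially"
      using \<delta>(1) by (intro filterlim_tendsto_pos_mult_at_top[OF tendsto_const]) auto
    from filterlim_compose[OF lim this]
    have "(\<lambda>n. annulus_prob TYPE('d) ?\<nu> (2 * \<delta> * 2 ^ n)) \<longlonglongrightarrow> 0" .
    then have "24 / 25 \<le> (0 :: real)"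
      using lower by (intro LIMSEQ_le_const) auto
    then show False by simp
  qed
  then show ?thesis by blast
qed

section \<open>Critical parameters\<close>

definition vanishing :: "'d::finite itself \<Rightarrow> real measure \<Rightarrow> bool" where
  "vanishing d \<nu> \<longleftrightarrow> (annulus_prob d \<nu> \<longlongrightarrow> 0) at_top"

lemma finite_borel_add:
  assumes "finite_borel \<mu>" "finite_borel \<nu>"
  shows "finite_borel (add_measure \<mu> \<nu>)"
    and "A \<in> sets borel \<Longrightarrow> emeasure (add_measure \<mu> \<nu>) A = emeasure \<mu> A + emeasure \<nu> A"
proof -
  note D = finite_borelD[OF assms(1)] finite_borelD[OF assms(2)]
  show e: "emeasure (add_measure \<mu> \<nu>) A = emeasure \<mu> A + emeasure \<nu> A" if "A \<in> sets borel" for A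
    using that D by (intro emeasure_add_measure) auto
  have s: "sets (add_measure \<mu> \<nu>) = sets borel"
    using D by simp
  have "emeasure (add_measure \<mu> \<nu>) (space (add_measure \<mu> \<nu>)) \<noteq> \<infinity>"
    using sets_eq_imp_space_eq[OF s] e[of UNIV] finite_measure.emeasure_finite[OF D(1), of UNIV]
      finite_measure.emeasure_finite[OF D(5), of UNIV] by simp
  then show "finite_borel (add_measure \<mu> \<nu>)"
    unfolding finite_borel_def using s by (auto intro: finite_measureI)
qed

lemma vanishing_mono:
  assumes "vanishing TYPE('d::finite) \<nu>" "finite_borel \<nu>1" "finite_borel \<nu>2" "finite_borel \<nu>"
    and "\<And>A. A \<in> sets borel \<Longrightarrow> emeasure \<nu> A = emeasure \<nu>1 A + emeasure \<nu>2 A"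
  shows "vanishing TYPE('d) \<nu>1"
  unfolding vanishing_def
proof (rule tendsto_sandwich[OF _ _ tendsto_const])
  show "(annulus_prob TYPE('d) \<nu> \<longlongrightarrow> 0) at_top"
    using assms(1) by (simp add: vanishing_def)
  show "\<forall>\<^sub>F s in at_top. annulus_prob TYPE('d) \<nu>1 s \<le> annulus_prob TYPE('d) \<nu> s"
    by (intro always_eventually allI annulus_prob_mono[OF assms(2-5)])
qed simp

lemma vanishing_scale_mono:
  assumes "finite_borel \<nu>" "0 \<le> s" "s \<le> t" "vanishing TYPE('d::finite) (scale_measure (ennreal t) \<nu>)"
  shows "vanishing TYPE('d) (scale_measure (ennreal s) \<nu>)"
proof (rule vanishing_mono[OF assms(4)])
  fix A :: "real set"
  have "ennreal t = ennreal s + ennreal (t - s)"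
    using assms by (simp add: ennreal_plus[symmetric] del: ennreal_plus)
  then show "emeasure (scale_measure (ennreal t) \<nu>) A
      = emeasure (scale_measure (ennreal s) \<nu>) A + emeasure (scale_measure (ennreal (t - s)) \<nu>) A"
    by (simp add: distrib_right)
qed (intro finite_borel_scale assms)+

lemma vanishing_shrink:
  assumes \<nu>: "finite_borel \<nu>" and \<rho>: "0 < \<rho>"
  shows "vanishing TYPE('d::finite) (shrink CARD('d) \<rho> \<nu>) \<longleftrightarrow> vanishing TYPE('d) \<nu>"
proof -
  have lim: "filterlim (\<lambda>s. k * s) at_top at_top" if "0 < k" for k :: real
    using that by (intro filterlim_tendsto_pos_mult_at_top[OF tendsto_const _ filterlim_ident]) auto
  have eq: "annulus_prob TYPE('d) (shrink CARD('d) \<rho> \<nu>) = (\<lambda>s. annulus_prob TYPE('d) \<nu> (\<rho> * s))"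
    using annulus_prob_shrink[OF \<nu> \<rho>] by blast
  show ?thesis
    unfolding vanishing_def eq
  proof
    assume "((\<lambda>s. annulus_prob TYPE('d) \<nu> (\<rho> * s)) \<longlongrightarrow> 0) at_top"
    from filterlim_compose[OF this lim[of "1 / \<rho>"]] show "(annulus_prob TYPE('d) \<nu> \<longlongrightarrow> 0) at_top"
      using \<rho> by simp
  next
    assume "(annulus_prob TYPE('d) \<nu> \<longlongrightarrow> 0) at_top"
    from filterlim_compose[OF this lim[OF \<rho>]] show "((\<lambda>s. annulus_prob TYPE('d) \<nu> (\<rho> * s)) \<longlongrightarrow> 0) at_top" .
  qed
qed

lemma shrink_scale:
  assumes "finite_borel \<nu>"
  shows "scale_measure t (shrink d \<rho> \<nu>) = shrink d \<rho> (scale_measure t \<nu>)"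
proof -
  have "(*) (1 / \<rho>) \<in> \<nu> \<rightarrow>\<^sub>M borel"
    using finite_borelD(2)[OF assms] by (simp cong: measurable_cong_sets)
  then show ?thesis
    unfolding shrink_def
    by (intro measure_eqI) (auto simp: emeasure_distr space_scale_measure mult_ac measurable_cong_sets[OF sets_scale_measure refl])
qed

section \<open>Radius measures under scaling, contraction and mixture\<close>

lemma radius_measure_scale:
  assumes "radius_measure \<nu>"
  shows "radius_measure (scale_measure (ennreal t) \<nu>)"
  using assms finite_measure.emeasure_finite[OF radius_measureD(3)[OF assms], of "space \<nu>"]
  unfolding radius_measure_def
  by (auto intro!: finite_measureI simp: space_scale_measure ennreal_mult_eq_top_iff)

lemma measurable_divide_radius:
  assumes "radius_measure \<nu>" "0 < \<rho>"
  shows "(\<lambda>r. r / \<rho>) \<in> \<nu> \<rightarrow>\<^sub>M \<nu>"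
proof -
  have "(\<lambda>r. r / \<rho>) \<in> restrict_space borel {0<..} \<rightarrow>\<^sub>M restrict_space borel {0<..}"
    using assms(2) by (intro measurable_restrict_space3) auto
  then show ?thesis
    using measurable_cong_sets[OF radius_measureD(1)[OF assms(1)] radius_measureD(1)[OF assms(1)]] by simp
qed

lemma radius_measure_contract:
  assumes "radius_measure \<nu>" "0 < \<rho>"
  shows "radius_measure (contract d \<rho> \<nu>)"
proof -
  have "finite_measure (distr \<nu> \<nu> (\<lambda>r. r / \<rho>))"
    by (rule finite_measure.finite_measure_distr[OF radius_measureD(3)[OF assms(1)] measurable_divide_radius[OF assms]])
  then have "radius_measure (distr \<nu> \<nu> (\<lambda>r. r / \<rho>))"
    using assms(1) by (simp add: radius_measure_def)
  then show ?thesis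
    unfolding contract_def by (rule radius_measure_scale)
qed

lemma extend_scale:
  assumes "radius_measure \<nu>"
  shows "extend_to_reals (scale_measure (ennreal t) \<nu>) = scale_measure (ennreal t) (extend_to_reals \<nu>)"
proof (rule measure_eqI)
  show "sets (extend_to_reals (scale_measure (ennreal t) \<nu>)) = sets (scale_measure (ennreal t) (extend_to_reals \<nu>))"
    by (simp add: extend_to_reals_def)
  fix A assume "A \<in> sets (extend_to_reals (scale_measure (ennreal t) \<nu>))"
  then have "A \<in> sets borel"
    by (simp add: extend_to_reals_def)
  then show "emeasure (extend_to_reals (scale_measure (ennreal t) \<nu>)) A
    = emeasure (scale_measure (ennreal t) (extend_to_reals \<nu>)) A"
    using emeasure_extend[OF assms] emeasure_extend[OF radius_measure_scale[OF assms]] by simp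
qed

lemma extend_contract:
  assumes "radius_measure \<nu>" "0 < \<rho>"
  shows "extend_to_reals (contract d \<rho> \<nu>) = shrink d \<rho> (extend_to_reals \<nu>)"
proof (rule measure_eqI)
  show "sets (extend_to_reals (contract d \<rho> \<nu>)) = sets (shrink d \<rho> (extend_to_reals \<nu>))"
    by (simp add: extend_to_reals_def shrink_def)
  fix A assume "A \<in> sets (extend_to_reals (contract d \<rho> \<nu>))"
  then have A: "A \<in> sets borel"
    by (simp add: extend_to_reals_def)
  have A': "(*) (1 / \<rho>) -` A \<in> sets borel"
    using A measurable_sets[of "(*) (1 / \<rho>)" borel borel A] by simp
  have A0: "A \<inter> {0<..} \<in> sets \<nu>"
    using A radius_measureD(1)[OF assms(1)] by (auto simp: sets_restrict_space)
  have m: "(*) (1 / \<rho>) \<in> extend_to_reals \<nu> \<rightarrow>\<^sub>M borel"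
    using finite_borelD(2)[OF finite_borel_extend[OF assms(1)]] by (simp cong: measurable_cong_sets)
  have "(\<lambda>r. r / \<rho>) -` (A \<inter> {0<..}) \<inter> space \<nu> = ((*) (1 / \<rho>) -` A) \<inter> {0<..}"
    using assms(2) radius_measureD(2)[OF assms(1)] by (auto simp: field_simps zero_less_divide_iff)
  then show "emeasure (extend_to_reals (contract d \<rho> \<nu>)) A = emeasure (shrink d \<rho> (extend_to_reals \<nu>)) A"
    using emeasure_extend[OF radius_measure_contract[OF assms] A] measurable_divide_radius[OF assms] A0
      emeasure_extend[OF assms(1) A'] m A finite_borelD(3)[OF finite_borel_extend[OF assms(1)]]
    by (simp add: contract_def shrink_def emeasure_distr)
qed

lemma mixture_measure:
  assumes "radius_measure \<nu>1" "radius_measure \<nu>2" "0 < \<rho>"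
  shows "radius_measure (two_scale_mixture d \<alpha> \<nu>1 \<rho> \<nu>2)"
    and "A \<in> sets borel \<Longrightarrow> emeasure (extend_to_reals (two_scale_mixture d \<alpha> \<nu>1 \<rho> \<nu>2)) A
      = ennreal \<alpha> * emeasure (extend_to_reals \<nu>1) A
        + ennreal (1 - \<alpha>) * emeasure (shrink d \<rho> (extend_to_reals \<nu>2)) A"
proof -
  let ?\<mu>1 = "scale_measure (ennreal \<alpha>) \<nu>1" and ?\<mu>2 = "scale_measure (ennreal (1 - \<alpha>)) (contract d \<rho> \<nu>2)"
  have r1: "radius_measure ?\<mu>1"
    by (rule radius_measure_scale[OF assms(1)])
  have r2: "radius_measure ?\<mu>2"
    by (intro radius_measure_scale radius_measure_contract assms)
  have s: "sets ?\<mu>1 = sets ?\<mu>2"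
    using radius_measureD(1)[OF r1] radius_measureD(1)[OF r2] by simp
  have s': "sets (add_measure ?\<mu>1 ?\<mu>2) = sets (restrict_space borel {0<..})"
    using radius_measureD(1)[OF r1] by simp
  have "space (add_measure ?\<mu>1 ?\<mu>2) = {0<..}"
    using sets_eq_imp_space_eq[OF s'] by (simp add: space_restrict_space)
  moreover have "{0<..} \<in> sets ?\<mu>1"
    using sets.top[of ?\<mu>1] radius_measureD(2)[OF r1] by simp
  ultimately have "emeasure (add_measure ?\<mu>1 ?\<mu>2) (space (add_measure ?\<mu>1 ?\<mu>2)) \<noteq> \<infinity>"
    using emeasure_add_measure[OF s, of "{0<..}"] finite_measure.emeasure_finite[OF radius_measureD(3)[OF r1], of "{0<..}"]
      finite_measure.emeasure_finite[OF radius_measureD(3)[OF r2], of "{0<..}"] by simp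
  then show r: "radius_measure (two_scale_mixture d \<alpha> \<nu>1 \<rho> \<nu>2)"
    unfolding radius_measure_def two_scale_mixture_def using s' by (auto intro: finite_measureI)
  assume A: "A \<in> sets borel"
  then have A0: "A \<inter> {0<..} \<in> sets ?\<mu>1"
    using radius_measureD(1)[OF r1] by (auto simp: sets_restrict_space)
  have "emeasure (extend_to_reals (two_scale_mixture d \<alpha> \<nu>1 \<rho> \<nu>2)) A
      = emeasure ?\<mu>1 (A \<inter> {0<..}) + emeasure ?\<mu>2 (A \<inter> {0<..})"
    unfolding emeasure_extend[OF r A] unfolding two_scale_mixture_def
    using s A0 by (rule emeasure_add_measure)
  also have "\<dots> = emeasure (extend_to_reals ?\<mu>1) A + emeasure (extend_to_reals ?\<mu>2) A"
    unfolding emeasure_extend[OF r1 A] emeasure_extend[OF r2 A] ..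
  also have "\<dots> = ennreal \<alpha> * emeasure (extend_to_reals \<nu>1) A
        + ennreal (1 - \<alpha>) * emeasure (shrink d \<rho> (extend_to_reals \<nu>2)) A"
    by (simp add: extend_scale[OF assms(1)] extend_scale[OF radius_measure_contract[OF assms(2,3)]]
        extend_contract[OF assms(2,3)])
  finally show "emeasure (extend_to_reals (two_scale_mixture d \<alpha> \<nu>1 \<rho> \<nu>2)) A
      = ennreal \<alpha> * emeasure (extend_to_reals \<nu>1) A
        + ennreal (1 - \<alpha>) * emeasure (shrink d \<rho> (extend_to_reals \<nu>2)) A" .
qed

section \<open>Scaling and finiteness of the critical parameter, bounds for the mixture\<close>

lemma critical_parameter_eq:
  assumes "radius_measure \<nu>"
  shows "critical_parameter TYPE('d::finite) \<nu>
    = Sup (ennreal ` {t. 0 < t \<and> vanishing TYPE('d) (scale_measure (ennreal t) (extend_to_reals \<nu>))})"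
  unfolding critical_parameter_def vanishing_def
  by (simp add: subcritical_iff[OF radius_measure_scale[OF assms]] extend_scale[OF assms])

lemma critical_parameter_lower:
  assumes "radius_measure \<nu>" "0 < t" "vanishing TYPE('d::finite) (scale_measure (ennreal t) (extend_to_reals \<nu>))"
  shows "ennreal t \<le> critical_parameter TYPE('d) \<nu>"
  unfolding critical_parameter_eq[OF assms(1)] using assms(2,3) by (intro Sup_upper) auto

lemma vanishing_below_critical:
  assumes \<nu>: "radius_measure \<nu>" and t: "0 \<le> t" "ennreal t < critical_parameter TYPE('d::finite) \<nu>"
  shows "vanishing TYPE('d) (scale_measure (ennreal t) (extend_to_reals \<nu>))"
proof -
  obtain u where u: "ennreal t < ennreal u" "0 < u" "vanishing TYPE('d) (scale_measure (ennreal u) (extend_to_reals \<nu>))"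
    using t(2) unfolding critical_parameter_eq[OF \<nu>] less_Sup_iff by blast
  then have "t \<le> u"
    using t(1) by (simp add: ennreal_less_iff)
  then show ?thesis
    by (rule vanishing_scale_mono[OF finite_borel_extend[OF \<nu>] t(1) _ u(3)])
qed

text \<open>Multiplying \<alpha> \<nu> by t is multiplying \<nu> by t \<alpha>, so the admissible
  parameters, and with them their supremum, are divided by \<alpha>.\<close>

lemma critical_parameter_scale:
  assumes \<nu>: "radius_measure \<nu>" and \<alpha>: "0 < \<alpha>"
  shows "critical_parameter TYPE('d::finite) (scale_measure (ennreal \<alpha>) \<nu>) = critical_parameter TYPE('d) \<nu> / ennreal \<alpha>"
proof -
  let ?S = "{t. 0 < t \<and> vanishing TYPE('d) (scale_measure (ennreal t) (extend_to_reals \<nu>))}"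
  have "{t. 0 < t \<and> vanishing TYPE('d) (scale_measure (ennreal t) (extend_to_reals (scale_measure (ennreal \<alpha>) \<nu>)))}
      = {t. 0 < t \<and> vanishing TYPE('d) (scale_measure (ennreal (t * \<alpha>)) (extend_to_reals \<nu>))}"
    using \<alpha> by (auto simp: extend_scale[OF \<nu>] ennreal_mult)
  also have "\<dots> = (\<lambda>t. t / \<alpha>) ` ?S"
  proof (intro equalityI subsetI)
    fix t assume "t \<in> {t. 0 < t \<and> vanishing TYPE('d) (scale_measure (ennreal (t * \<alpha>)) (extend_to_reals \<nu>))}"
    then show "t \<in> (\<lambda>t. t / \<alpha>) ` ?S"
      using \<alpha> by (intro image_eqI[of _ _ "t * \<alpha>"]) auto
  qed (use \<alpha> in auto)
  finally have "critical_parameter TYPE('d) (scale_measure (ennreal \<alpha>) \<nu>) = Sup ((\<lambda>t. ennreal (t / \<alpha>)) ` ?S)"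
    unfolding critical_parameter_eq[OF radius_measure_scale[OF \<nu>]] by (simp only: image_image)
  also have "\<dots> = (SUP t\<in>?S. ennreal t / ennreal \<alpha>)"
    using \<alpha> by (intro SUP_cong refl) (simp add: divide_ennreal)
  also have "\<dots> = (SUP t\<in>?S. ennreal t) / ennreal \<alpha>"
    unfolding divide_ennreal_def by (rule SUP_mult_right_ennreal[symmetric])
  finally show ?thesis
    unfolding critical_parameter_eq[OF \<nu>] .
qed

text \<open>Contraction only rescales the argument of the crossing probability, which does not
  affect its limit at infinity.\<close>

lemma critical_parameter_contract:
  assumes \<nu>: "radius_measure \<nu>" and \<rho>: "0 < \<rho>"
  shows "critical_parameter TYPE('d::finite) (contract CARD('d) \<rho> \<nu>) = critical_parameter TYPE('d) \<nu>"
  unfolding critical_parameter_eq[OF \<nu>] critical_parameter_eq[OF radius_measure_contract[OF \<nu> \<rho>]]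
    extend_contract[OF \<nu> \<rho>] shrink_scale[OF finite_borel_extend[OF \<nu>]]
    vanishing_shrink[OF finite_borel_scale[OF finite_borel_extend[OF \<nu>]] \<rho>] ..

lemma critical_parameter_finite:
  assumes d: "CARD('d::finite) \<ge> 2" and \<nu>: "radius_measure \<nu>" and pos: "emeasure \<nu> (space \<nu>) > 0"
  shows "critical_parameter TYPE('d) \<nu> < \<infinity>"
proof -
  have "emeasure (extend_to_reals \<nu>) {0<..} > 0"
    using pos emeasure_extend[OF \<nu>, of "{0<..}"] radius_measureD(2)[OF \<nu>] by simp
  then obtain t0 where t0: "\<And>t. t \<ge> t0 \<Longrightarrow> \<not> vanishing TYPE('d) (scale_measure (ennreal t) (extend_to_reals \<nu>))"
    using boolean_supercritical[OF d finite_borel_extend[OF \<nu>]] unfolding vanishing_def by auto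
  have "critical_parameter TYPE('d) \<nu> \<le> ennreal t0"
    unfolding critical_parameter_eq[OF \<nu>]
  proof (rule Sup_least, clarify)
    fix t assume "vanishing TYPE('d) (scale_measure (ennreal t) (extend_to_reals \<nu>))"
    then have "t < t0"
      using t0[of t] by force
    then show "ennreal t \<le> ennreal t0"
      by (intro ennreal_leI) auto
  qed
  then show ?thesis
    by (rule le_less_trans) simp
qed

text \<open>Each component is dominated by the mixture, with the other component as
  complement.\<close>

lemma critical_parameter_mixture_le:
  assumes \<nu>1: "radius_measure \<nu>1" and \<nu>2: "radius_measure \<nu>2" and \<alpha>: "0 < \<alpha>" "\<alpha> < 1" and \<rho>: "0 < \<rho>"
  shows "critical_parameter TYPE('d::finite) (two_scale_mixture CARD('d) \<alpha> \<nu>1 \<rho> \<nu>2)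
    \<le> min (critical_parameter TYPE('d) (scale_measure (ennreal \<alpha>) \<nu>1))
          (critical_parameter TYPE('d) (scale_measure (ennreal (1 - \<alpha>)) (contract CARD('d) \<rho> \<nu>2)))"
proof -
  let ?mix = "two_scale_mixture CARD('d) \<alpha> \<nu>1 \<rho> \<nu>2"
  let ?\<mu>1 = "scale_measure (ennreal \<alpha>) \<nu>1" and ?\<mu>2 = "scale_measure (ennreal (1 - \<alpha>)) (contract CARD('d) \<rho> \<nu>2)"
  note mix = mixture_measure[OF \<nu>1 \<nu>2 \<rho>, where d="CARD('d)" and \<alpha>=\<alpha>]
  have r1: "radius_measure ?\<mu>1" and r2: "radius_measure ?\<mu>2"
    by (intro radius_measure_scale radius_measure_contract \<nu>1 \<nu>2 \<rho>)+
  have eq: "emeasure (extend_to_reals ?mix) A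
      = emeasure (extend_to_reals ?\<mu>1) A + emeasure (extend_to_reals ?\<mu>2) A" if "A \<in> sets borel" for A
    using mix(2)[OF that]
    by (simp add: extend_scale[OF \<nu>1] extend_scale[OF radius_measure_contract[OF \<nu>2 \<rho>]] extend_contract[OF \<nu>2 \<rho>])
  have "ennreal t \<le> min (critical_parameter TYPE('d) ?\<mu>1) (critical_parameter TYPE('d) ?\<mu>2)"
    if t: "0 < t" "vanishing TYPE('d) (scale_measure (ennreal t) (extend_to_reals ?mix))" for t
  proof -
    let ?s = "\<lambda>\<mu>. scale_measure (ennreal t) (extend_to_reals \<mu>)"
    have fb: "finite_borel (?s ?\<mu>1)" "finite_borel (?s ?\<mu>2)" "finite_borel (?s ?mix)"
      by (intro finite_borel_scale finite_borel_extend r1 r2 mix(1))+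
    have "vanishing TYPE('d) (?s ?\<mu>1)"
      by (rule vanishing_mono[OF t(2) fb(1,2,3)]) (simp add: eq distrib_left)
    moreover have "vanishing TYPE('d) (?s ?\<mu>2)"
      by (rule vanishing_mono[OF t(2) fb(2,1,3)]) (simp add: eq distrib_left add.commute)
    ultimately show ?thesis
      using t(1) by (simp add: critical_parameter_lower[OF r1] critical_parameter_lower[OF r2])
  qed
  then show ?thesis
    unfolding critical_parameter_eq[OF mix(1)] by (intro Sup_least) auto
qed

text \<open>The factor \<theta> < 1 pays for both margins: b = \<theta> l2 lies strictly below l2,
  and a \<kappa>^d with a = \<theta> l1 stays below l1 for some \<kappa> > 1. Neither involves
  \<alpha>, so \<rho>0 can precede it.\<close>

lemma critical_parameter_mixture_ge:
  assumes \<nu>1: "radius_measure \<nu>1" and \<nu>2: "radius_measure \<nu>2"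
    and l1: "critical_parameter TYPE('d::finite) \<nu>1 = ennreal l1" "0 < l1"
    and l2: "critical_parameter TYPE('d) \<nu>2 = ennreal l2" "0 < l2"
    and \<theta>: "0 < \<theta>" "\<theta> < 1"
  shows "\<exists>\<rho>0\<ge>1. \<forall>\<rho>\<ge>\<rho>0. \<forall>\<alpha>. 0 < \<alpha> \<and> \<alpha> < 1 \<longrightarrow>
    ennreal (\<theta> * min (l1 / \<alpha>) (l2 / (1 - \<alpha>))) \<le> critical_parameter TYPE('d) (two_scale_mixture CARD('d) \<alpha> \<nu>1 \<rho> \<nu>2)"
proof -
  let ?\<nu>1 = "extend_to_reals \<nu>1" and ?\<nu>2 = "extend_to_reals \<nu>2"
  note fb1 = finite_borel_extend[OF \<nu>1] and fb2 = finite_borel_extend[OF \<nu>2]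
  define a b where "a = \<theta> * l1" and "b = \<theta> * l2"
  have ab: "0 < a" "0 < b" "b < l2"
    using \<theta> l1 l2 by (auto simp: a_def b_def)
  obtain \<kappa> where \<kappa>: "1 < \<kappa>" "\<kappa> ^ CARD('d) * \<theta> < 1"
  proof -
    have "((\<lambda>x. x ^ CARD('d) * \<theta>) \<longlongrightarrow> 1 ^ CARD('d) * \<theta>) (at_right 1)"
      by (intro tendsto_intros)
    then have "\<forall>\<^sub>F x in at_right 1. x ^ CARD('d) * \<theta> < 1"
      using \<theta> by (intro order_tendstoD(2)) auto
    moreover have "\<forall>\<^sub>F x in at_right (1 :: real). 1 < x"
      by (simp add: eventually_at_right_less)
    ultimately have "\<forall>\<^sub>F x in at_right 1. 1 < x \<and> x ^ CARD('d) * \<theta> < 1"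
      by eventually_elim simp
    then show thesis
      using that eventually_happens'[of "at_right (1 :: real)"] by auto
  qed
  have "ennreal (\<kappa> ^ CARD('d) * a) < critical_parameter TYPE('d) \<nu>1"
    unfolding l1 using \<kappa> l1(2) \<theta> by (intro ennreal_lessI) (auto simp: a_def mult.assoc[symmetric])
  then have "vanishing TYPE('d) (scale_measure (ennreal (\<kappa> ^ CARD('d) * a)) ?\<nu>1)"
    using \<kappa> ab by (intro vanishing_below_critical[OF \<nu>1]) auto
  then have v1: "vanishing TYPE('d) (scale_measure (ennreal (\<kappa> ^ CARD('d))) (scale_measure (ennreal a) ?\<nu>1))"
    using \<kappa> ab by (simp add: ennreal_mult)
  have v2: "vanishing TYPE('d) (scale_measure (ennreal b) ?\<nu>2)"
    using ab l2 by (intro vanishing_below_critical[OF \<nu>2]) (auto intro: ennreal_lessI)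
  obtain \<rho>0 where \<rho>0: "\<And>\<rho> \<nu>. \<rho>0 \<le> \<rho> \<Longrightarrow> finite_borel \<nu> \<Longrightarrow>
     (\<forall>A\<in>sets borel. emeasure \<nu> A = emeasure (scale_measure (ennreal a) ?\<nu>1) A
        + emeasure (shrink CARD('d) \<rho> (scale_measure (ennreal b) ?\<nu>2)) A) \<Longrightarrow> vanishing TYPE('d) \<nu>"
    using mixture_subcritical[OF finite_borel_scale[OF fb1] finite_borel_scale[OF fb2] \<kappa>(1)
        v1[unfolded vanishing_def] v2[unfolded vanishing_def]] unfolding vanishing_def by blast
  have "ennreal (\<theta> * min (l1 / \<alpha>) (l2 / (1 - \<alpha>))) \<le> critical_parameter TYPE('d) (two_scale_mixture CARD('d) \<alpha> \<nu>1 \<rho> \<nu>2)"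
    if \<rho>: "max 1 \<rho>0 \<le> \<rho>" and \<alpha>: "0 < \<alpha>" "\<alpha> < 1" for \<rho> \<alpha>
  proof -
    define t where "t = \<theta> * min (l1 / \<alpha>) (l2 / (1 - \<alpha>))"
    have t: "0 < t"
      using \<theta> l1 l2 \<alpha> by (simp add: t_def)
    have "t \<le> \<theta> * (l1 / \<alpha>)" "t \<le> \<theta> * (l2 / (1 - \<alpha>))"
      using \<theta> unfolding t_def by (intro mult_left_mono; simp)+
    \<comment> \<open>The factors \<alpha> and 1 - \<alpha> cancel against the denominators in the
      minimum.\<close>
    then have ta: "t * \<alpha> \<le> a" and tb: "t * (1 - \<alpha>) \<le> b"
      using \<alpha> by (auto simp: a_def b_def field_simps)
    have \<rho>': "0 < \<rho>" using \<rho> by simp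
    note mix = mixture_measure[OF \<nu>1 \<nu>2 \<rho>', where d="CARD('d)" and \<alpha>=\<alpha>]
    let ?mix = "extend_to_reals (two_scale_mixture CARD('d) \<alpha> \<nu>1 \<rho> \<nu>2)"
    let ?h = "shrink CARD('d) \<rho> ?\<nu>2"
    note fbh = finite_borel_shrink[OF fb2, of "CARD('d)" \<rho>]
    let ?big = "add_measure (scale_measure (ennreal a) ?\<nu>1) (scale_measure (ennreal b) ?h)"
    \<comment> \<open>What the mixture multiplied by t lacks to reach the dominating measure;
      monotonicity asks for this difference as a measure.\<close>
    let ?rest = "add_measure (scale_measure (ennreal (a - t * \<alpha>)) ?\<nu>1) (scale_measure (ennreal (b - t * (1 - \<alpha>))) ?h)"
    note big = finite_borel_add[OF finite_borel_scale[OF fb1, of a] finite_borel_scale[OF fbh, of b]]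
    note rest = finite_borel_add[OF finite_borel_scale[OF fb1, of "a - t * \<alpha>"] finite_borel_scale[OF fbh, of "b - t * (1 - \<alpha>)"]]
    have "vanishing TYPE('d) ?big"
      using \<rho> big by (intro \<rho>0[of \<rho>]) (auto simp: shrink_scale[OF fb2, symmetric])
    then have "vanishing TYPE('d) (scale_measure (ennreal t) ?mix)"
    proof (rule vanishing_mono[OF _ finite_borel_scale[OF finite_borel_extend[OF mix(1)]] rest(1) big(1)])
      fix A :: "real set" assume A: "A \<in> sets borel"
      have *: "ennreal a = ennreal t * ennreal \<alpha> + ennreal (a - t * \<alpha>)"
        "ennreal b = ennreal t * ennreal (1 - \<alpha>) + ennreal (b - t * (1 - \<alpha>))"
        using t \<alpha> ta tb by (simp_all add: ennreal_mult[symmetric] ennreal_plus[symmetric] del: ennreal_plus)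
      show "emeasure ?big A = emeasure (scale_measure (ennreal t) ?mix) A + emeasure ?rest A"
        using big(2)[OF A] rest(2)[OF A] mix(2)[OF A] * by (simp add: distrib_left distrib_right mult.assoc add_ac)
    qed
    then show ?thesis
      unfolding t_def[symmetric] using t by (intro critical_parameter_lower[OF mix(1)])
  qed
  then show ?thesis
    by (intro exI[of _ "max 1 \<rho>0"]) auto
qed

text \<open>The minimum is the mean of itself with weights \<alpha> and 1 - \<alpha>. The resulting
  bound is free of \<alpha> and turns the relative error \<theta> into an absolute one.\<close>

lemma min_weighted_le:
  fixes \<alpha> x y :: real
  assumes "0 < \<alpha>" "\<alpha> < 1"
  shows "min (x / \<alpha>) (y / (1 - \<alpha>)) \<le> x + y"
proof -
  let ?m = "min (x / \<alpha>) (y / (1 - \<alpha>))"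
  have "?m * \<alpha> \<le> x / \<alpha> * \<alpha>" "?m * (1 - \<alpha>) \<le> y / (1 - \<alpha>) * (1 - \<alpha>)"
    using assms by (intro mult_right_mono; simp)+
  then have "?m * \<alpha> + ?m * (1 - \<alpha>) \<le> x + y"
    using assms by simp
  then show ?thesis
    by (simp add: algebra_simps)
qed

text \<open>Uniform convergence is stated for real values since it requires a distance. The conjunct
  on finiteness ensures that \<open>enn2real\<close> does not hide an infinite limit; the first
  inequality then does the same for the mixtures with \<rho> > 1.\<close>

theorem proposition6:
  fixes \<nu>1 \<nu>2 :: "real measure"
  assumes "CARD('d::finite) \<ge> 2"
    and "radius_measure \<nu>1" "emeasure \<nu>1 (space \<nu>1) > 0"
    and "radius_measure \<nu>2" "emeasure \<nu>2 (space \<nu>2) > 0"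
  shows
    "(\<forall>\<alpha> \<rho>. 0 < \<alpha> \<and> \<alpha> < 1 \<and> 1 < \<rho> \<longrightarrow>
        critical_parameter TYPE('d) (two_scale_mixture CARD('d) \<alpha> \<nu>1 \<rho> \<nu>2)
          \<le> min (critical_parameter TYPE('d) (scale_measure (ennreal \<alpha>) \<nu>1))
                 (critical_parameter TYPE('d) (scale_measure (ennreal (1 - \<alpha>)) (contract CARD('d) \<rho> \<nu>2)))
      \<and> min (critical_parameter TYPE('d) (scale_measure (ennreal \<alpha>) \<nu>1))
            (critical_parameter TYPE('d) (scale_measure (ennreal (1 - \<alpha>)) (contract CARD('d) \<rho> \<nu>2)))
          = min (critical_parameter TYPE('d) \<nu>1 / ennreal \<alpha>)
                (critical_parameter TYPE('d) \<nu>2 / ennreal (1 - \<alpha>)))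
   \<and> (\<forall>\<alpha>. 0 < \<alpha> \<and> \<alpha> < 1 \<longrightarrow>
        ((\<lambda>\<rho>. critical_parameter TYPE('d) (two_scale_mixture CARD('d) \<alpha> \<nu>1 \<rho> \<nu>2)) \<longlongrightarrow>
           min (critical_parameter TYPE('d) \<nu>1 / ennreal \<alpha>)
               (critical_parameter TYPE('d) \<nu>2 / ennreal (1 - \<alpha>))) at_top)
   \<and> (\<forall>\<alpha>. 0 < \<alpha> \<and> \<alpha> < 1 \<longrightarrow>
        min (critical_parameter TYPE('d) \<nu>1 / ennreal \<alpha>)
            (critical_parameter TYPE('d) \<nu>2 / ennreal (1 - \<alpha>)) < \<infinity>)
   \<and> uniform_limit {0<..<1}
        (\<lambda>\<rho> \<alpha>. enn2real (critical_parameter TYPE('d) (two_scale_mixture CARD('d) \<alpha> \<nu>1 \<rho> \<nu>2)))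
        (\<lambda>\<alpha>. enn2real (min (critical_parameter TYPE('d) \<nu>1 / ennreal \<alpha>)
                            (critical_parameter TYPE('d) \<nu>2 / ennreal (1 - \<alpha>))))
        at_top"
proof -
  note \<nu>1 = assms(2) and \<nu>2 = assms(4)
  define l1 l2 where "l1 = enn2real (critical_parameter TYPE('d) \<nu>1)" and "l2 = enn2real (critical_parameter TYPE('d) \<nu>2)"
  have l1: "critical_parameter TYPE('d) \<nu>1 = ennreal l1" and l2: "critical_parameter TYPE('d) \<nu>2 = ennreal l2"
    using critical_parameter_finite[OF assms(1-3)] critical_parameter_finite[OF assms(1,4,5)]
    by (simp_all add: l1_def l2_def)
  have l: "0 \<le> l1" "0 \<le> l2"
    by (simp_all add: l1_def l2_def)
  define f where "f \<alpha> = min (l1 / \<alpha>) (l2 / (1 - \<alpha>))" for \<alpha>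
  have f: "min (critical_parameter TYPE('d) \<nu>1 / ennreal \<alpha>) (critical_parameter TYPE('d) \<nu>2 / ennreal (1 - \<alpha>)) = ennreal (f \<alpha>)"
    "0 \<le> f \<alpha>" "f \<alpha> \<le> l1 + l2" if "0 < \<alpha>" "\<alpha> < 1" for \<alpha>
  proof -
    show "min (critical_parameter TYPE('d) \<nu>1 / ennreal \<alpha>) (critical_parameter TYPE('d) \<nu>2 / ennreal (1 - \<alpha>)) = ennreal (f \<alpha>)"
      using that l by (simp add: l1 l2 divide_ennreal f_def min_def ennreal_le_iff)
    show "0 \<le> f \<alpha>"
      using that l by (simp add: f_def)
    show "f \<alpha> \<le> l1 + l2"
      unfolding f_def using that by (rule min_weighted_le)
  qed
  let ?c = "\<lambda>\<rho> \<alpha>. critical_parameter TYPE('d) (two_scale_mixture CARD('d) \<alpha> \<nu>1 \<rho> \<nu>2)"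
  have eq: "min (critical_parameter TYPE('d) (scale_measure (ennreal \<alpha>) \<nu>1))
        (critical_parameter TYPE('d) (scale_measure (ennreal (1 - \<alpha>)) (contract CARD('d) \<rho> \<nu>2)))
      = min (critical_parameter TYPE('d) \<nu>1 / ennreal \<alpha>) (critical_parameter TYPE('d) \<nu>2 / ennreal (1 - \<alpha>))"
    if "0 < \<alpha>" "\<alpha> < 1" "1 < \<rho>" for \<alpha> \<rho>
    using that critical_parameter_scale[OF \<nu>1, of \<alpha>, where 'd='d]
      critical_parameter_scale[OF radius_measure_contract[OF \<nu>2], of \<rho> "1 - \<alpha>" "CARD('d)", where 'd='d]
      critical_parameter_contract[OF \<nu>2, of \<rho>, where 'd='d] by simp
  have upper: "?c \<rho> \<alpha> \<le> ennreal (f \<alpha>)" if "0 < \<alpha>" "\<alpha> < 1" "1 < \<rho>" for \<alpha> \<rho>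
    using critical_parameter_mixture_le[OF \<nu>1 \<nu>2, of \<alpha> \<rho>, where 'd='d] that
    unfolding eq[OF that] f(1)[OF that(1,2)] by simp
  have lower: "\<exists>\<rho>0\<ge>1. \<forall>\<rho>\<ge>\<rho>0. \<forall>\<alpha>. 0 < \<alpha> \<and> \<alpha> < 1 \<longrightarrow> ennreal (\<theta> * f \<alpha>) \<le> ?c \<rho> \<alpha>"
    if \<theta>: "0 < \<theta>" "\<theta> < 1" for \<theta>
  proof (cases "0 < l1 \<and> 0 < l2")
    case True
    then show ?thesis
      unfolding f_def using critical_parameter_mixture_ge[OF \<nu>1 \<nu>2 l1 _ l2 _ \<theta>] by blast
  next
    case False
    \<comment> \<open>If a critical value vanishes, so does the limit, and the lower bound is
      trivial.\<close>
    then have "l1 = 0 \<or> l2 = 0"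
      using l by linarith
    then have "f \<alpha> = 0" if "0 < \<alpha>" "\<alpha> < 1" for \<alpha>
    proof -
      have "0 \<le> l1 / \<alpha>" "0 \<le> l2 / (1 - \<alpha>)"
        using that l by simp_all
      then show ?thesis
        using \<open>l1 = 0 \<or> l2 = 0\<close> unfolding f_def by (auto intro: min_absorb1 min_absorb2)
    qed
    then show ?thesis
      by (intro exI[of _ 1]) auto
  qed
  have unif: "uniform_limit {0<..<1} (\<lambda>\<rho> \<alpha>. enn2real (?c \<rho> \<alpha>)) f at_top"
  proof (rule uniform_limitI)
    fix e :: real assume e: "0 < e"
    \<comment> \<open>Keeps the loss (1 - \<theta>) (l1 + l2) at most e / 2; the summand e in the
      denominator makes it positive even when both critical values are 0.\<close>
    define \<theta> where "\<theta> = 1 - e / (2 * (l1 + l2 + e))"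
    have pos: "0 < l1 + l2 + e" using l e by linarith
    have \<theta>: "0 < \<theta>" "\<theta> < 1" "(1 - \<theta>) * (l1 + l2) < e"
    proof -
      show "0 < \<theta>" "\<theta> < 1"
        using pos e l by (simp_all add: \<theta>_def field_simps)
      have "(1 - \<theta>) * (l1 + l2) \<le> (1 - \<theta>) * (l1 + l2 + e)"
        using \<open>\<theta> < 1\<close> e by (intro mult_left_mono) auto
      also have "\<dots> = e / 2"
        using pos by (simp add: \<theta>_def field_simps)
      finally show "(1 - \<theta>) * (l1 + l2) < e"
        using e by linarith
    qed
    obtain \<rho>0 where \<rho>0: "1 \<le> \<rho>0" "\<And>\<rho> \<alpha>. \<rho>0 \<le> \<rho> \<Longrightarrow> 0 < \<alpha> \<Longrightarrow> \<alpha> < 1 \<Longrightarrow> ennreal (\<theta> * f \<alpha>) \<le> ?c \<rho> \<alpha>"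
      using lower[OF \<theta>(1,2)] by blast
    have "dist (enn2real (?c \<rho> \<alpha>)) (f \<alpha>) < e" if \<rho>: "\<rho>0 < \<rho>" and \<alpha>: "\<alpha> \<in> {0<..<1}" for \<rho> \<alpha>
    proof -
      have \<alpha>': "0 < \<alpha>" "\<alpha> < 1" using \<alpha> by auto
      have up: "?c \<rho> \<alpha> \<le> ennreal (f \<alpha>)"
        using \<rho> \<rho>0(1) \<alpha>' by (intro upper) auto
      then obtain c where c: "?c \<rho> \<alpha> = ennreal c" "0 \<le> c"
        by (cases "?c \<rho> \<alpha>") (auto simp: top_unique)
      have "c \<le> f \<alpha>"
        using up f(2)[OF \<alpha>'] c by simp
      moreover have "\<theta> * f \<alpha> \<le> c"
        using \<rho>0(2)[of \<rho> \<alpha>] \<rho> \<alpha>' c by simp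
      moreover have "(1 - \<theta>) * f \<alpha> \<le> (1 - \<theta>) * (l1 + l2)"
        using \<theta> f(3)[OF \<alpha>'] by (intro mult_left_mono) auto
      moreover have "(1 - \<theta>) * f \<alpha> = f \<alpha> - \<theta> * f \<alpha>"
        by (simp add: algebra_simps)
      ultimately have "\<bar>c - f \<alpha>\<bar> < e"
        using \<theta>(3) by linarith
      then show ?thesis
        using c by (simp add: dist_real_def)
    qed
    then show "\<forall>\<^sub>F \<rho> in at_top. \<forall>\<alpha>\<in>{0<..<1}. dist (enn2real (?c \<rho> \<alpha>)) (f \<alpha>) < e"
      by (intro eventually_mono[OF eventually_gt_at_top[of \<rho>0]] ballI)
  qed
  \<comment> \<open>The return to [0, \<infinity>]: for \<rho> > 1 the values are bounded by the
    finite limit, so \<open>enn2real\<close> can be undone.\<close>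
  have pointwise: "((\<lambda>\<rho>. ?c \<rho> \<alpha>) \<longlongrightarrow> ennreal (f \<alpha>)) at_top" if \<alpha>: "0 < \<alpha>" "\<alpha> < 1" for \<alpha>
  proof (rule Lim_transform_eventually)
    have "((\<lambda>\<rho>. enn2real (?c \<rho> \<alpha>)) \<longlongrightarrow> f \<alpha>) at_top"
      using \<alpha> by (intro tendsto_uniform_limitI[OF unif]) auto
    then show "((\<lambda>\<rho>. ennreal (enn2real (?c \<rho> \<alpha>))) \<longlongrightarrow> ennreal (f \<alpha>)) at_top"
      by (rule tendsto_ennrealI)
    show "\<forall>\<^sub>F \<rho> in at_top. ennreal (enn2real (?c \<rho> \<alpha>)) = ?c \<rho> \<alpha>"
      using eventually_gt_at_top[of 1]
    proof eventually_elim
      case (elim \<rho>)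
      then have "?c \<rho> \<alpha> \<le> ennreal (f \<alpha>)"
        using \<alpha> by (intro upper) auto
      then show ?case
        by (intro ennreal_enn2real) (auto intro: le_less_trans)
    qed
  qed
  have "uniform_limit {0<..<1} (\<lambda>\<rho> \<alpha>. enn2real (?c \<rho> \<alpha>))
      (\<lambda>\<alpha>. enn2real (min (critical_parameter TYPE('d) \<nu>1 / ennreal \<alpha>) (critical_parameter TYPE('d) \<nu>2 / ennreal (1 - \<alpha>)))) at_top"
    using unif by (rule uniform_limit_cong'[THEN iffD1, rotated 2]) (use f in auto)
  then show ?thesis
    using eq f pointwise upper by simp
qed

end
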